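(* Let $n=2m$ be a positive even integer, $k=2^m$, let $\Gamma$ be a torsion-free discrete subgroup of $\mathrm{SO}^+(n,1)$, and let $\hat\Gamma$ be a subgroup of $\mathrm{Spin}^+(n,1)$ mapped isomorphically onto $\Gamma$ by the double covering $\mathrm{Ad}:\mathrm{Spin}^+(n,1)\to\mathrm{SO}^+(n,1)$. Then the map $$\xi:\hat\Gamma\backslash\mathrm{Spin}^+(n,1)\times_{\Delta_n}\mathbb{C}^k\to\hat\Gamma\backslash(H^n\times\mathbb{C}^k),\qquad \xi\big((\hat\Gamma g,v)S\big)=\hat\Gamma\big(\mathrm{Ad}(g)e_{n+1},\,gv\big),$$ is a complex vector bundle equivalence from the complex spinor bundle $\mu:\hat\Gamma\backslash\mathrm{Spin}^+(n,1)\times_{\Delta_n}\mathbb{C}^k\to\Gamma\backslash H^n$ of $\Gamma\backslash H^n$ to $\nu:\hat\Gamma\backslash(H^n\times\mathbb{C}^k)\to\Gamma\backslash H^n$.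
   Context: $H^n=\{x\in\mathbb{R}^{n+1}:x_1^2+\cdots+x_n^2-x_{n+1}^2=-1,\ x_{n+1}>0\}$; $\mathrm{SO}^+(n,1)$ is the identity component of the special orthogonal group of $x_1^2+\cdots+x_n^2-x_{n+1}^2$, i.e. the orientation preserving isometry group of $H^n$. Clifford algebras use the convention $v^2=-q(v)1$. $\mathrm{C}\ell(n,1)$ is the real Clifford algebra of $q=x_1^2+\cdots+x_n^2-x_{n+1}^2$ on $\mathbb{R}^{n+1}$ with standard generators $e_1,\dots,e_{n+1}$, $\mathrm{C}\ell(n)$ is the subalgebra generated by $e_1,\dots,e_n$, and $\mathbb{C}\ell(n,1)$, $\mathbb{C}\ell(n)$ are the complexifications. $\mathrm{Spin}(n,1)$ is the group of products of an even number of vectors $v\in\mathbb{R}^{n+1}$ with $q(v)=\pm1$, $\mathrm{Spin}^+(n,1)$ is its identity component, and $\mathrm{Ad}(x)w=xwx^{-1}$. $\mathrm{Spin}(n)\subset\mathrm{C}\ell(n)$ is identified with the stabilizer of $e_{n+1}$ in $\mathrm{Spin}^+(n,1)$; write $S=\mathrm{Spin}(n)$. Complex spin representations: fix an isomorphism $\psi:\mathbb{C}\ell(n)\to\mathbb{C}(k)$ of complex algebras, $\mathbb{C}(k)$ being the $k\times k$ complex matrices. $\Delta_n:\mathrm{Spin}(n)\to\mathbb{C}(k)$ is the restriction of $\psi$. With $\omega=e_1\cdots e_n$, let $\rho^\pm:\mathbb{C}\ell(n,1)\to\mathbb{C}\ell(n)$ be the complex algebra homomorphism with $\rho^\pm(e_i)=e_i$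 for $i\le n$ and $\rho^\pm(e_{n+1})=\pm\mathbf{i}^m\omega$; $\Delta_{n,1}:\mathrm{Spin}^+(n,1)\to\mathbb{C}(k)$ is the restriction of $\psi\rho^\pm$ for some choice of sign, and it extends $\Delta_n$. Write $gv=\Delta_{n,1}(g)v$ for $g\in\mathrm{Spin}^+(n,1)$, $v\in\mathbb{C}^k$. The spin structure on $\Gamma\backslash H^n$ corresponding to $\hat\Gamma$ has principal $\mathrm{Spin}(n)$-bundle $\hat\Gamma\backslash\mathrm{Spin}^+(n,1)$. The complex spinor bundle is $\hat\Gamma\backslash\mathrm{Spin}^+(n,1)\times_{\Delta_n}\mathbb{C}^k=\big((\hat\Gamma\backslash\mathrm{Spin}^+(n,1))\times\mathbb{C}^k\big)/S$, the quotient by the free right action $(\hat\Gamma g,v)s=(\hat\Gamma gs,s^{-1}v)$, with projection $\mu((\hat\Gamma g,v)S)=\Gamma(\mathrm{Ad}(g)e_{n+1})$. $\hat\Gamma$ acts on $H^n\times\mathbb{C}^k$ by $g(x,v)=(\mathrm{Ad}(g)x,gv)$, freely and discontinuously, and $\nu(\hat\Gamma(x,v))=\Gamma x$. *)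

theory Defs
  imports "HOL-Analysis.Analysis" "HOL-Algebra.Coset"
begin

section \<open>The Lorentzian quadratic form\<close>

text \<open>
  The index type \<open>'i\<close> plays the role of \<open>{1,...,n+1}\<close>, so that \<open>CARD('i) = n + 1\<close>;
  its greatest element is the index \<open>n+1\<close>.
\<close>

type_synonym 'i minkowski = "(real, 'i) vec"
type_synonym 'k cvec = "(complex, 'k) vec"
type_synonym 'i minkowski_mat = "((real, 'i) vec, 'i) vec"

definition last_ix :: "'i::{finite,linorder}" where
  "last_ix = Max UNIV"

definition eta :: "'i::{finite,linorder} \<Rightarrow> 'a::comm_ring_1" where
  "eta i = (if i = last_ix then - 1 else 1)"

definition lorentz_q :: "'i::{finite,linorder} minkowski \<Rightarrow> real" where
  "lorentz_q x = (\<Sum>i\<in>UNIV. eta i * (x $ i)\<^sup>2)"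

definition hyperbolic_space :: "('i::{finite,linorder} minkowski) set" where
  "hyperbolic_space = {x. lorentz_q x = - 1 \<and> x $ last_ix > 0}"

abbreviation e_last :: "'i::{finite,linorder} minkowski" where
  "e_last \<equiv> axis last_ix 1"


section \<open>The Clifford algebra\<close>

text \<open>
  The Clifford algebra with scalars \<open>'a\<close> is modelled on its standard basis
  \<open>e\<^sub>I = e\<^bsub>i\<^sub>1\<^esub> \<cdots> e\<^bsub>i\<^sub>r\<^esub>\<close> where \<open>I = {i\<^sub>1 < \<cdots> < i\<^sub>r}\<close>: an element is the family of
  its coordinates, indexed by the subsets \<open>I\<close> of \<open>'i\<close>. The scalars \<open>real\<close> give the real
  algebra and the scalars \<open>complex\<close> its complexification. One has
  \<open>e\<^sub>I e\<^sub>J = \<plusminus> e\<^sub>K\<close> with \<open>K\<close> the symmetric difference: moving \<open>e\<^sub>j\<close> to the left past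
  \<open>e\<^sub>i\<close> with \<open>i > j\<close> costs a sign, and \<open>e\<^sub>i\<^sup>2 = - q(e\<^sub>i) = - eta i\<close>.
  The universal property that characterises the Clifford algebra is proved
  below (\<open>clifford_universal\<close>).
\<close>

type_synonym ('a, 'i) clifford = "'a ^ ('i set)"

definition cl_factor :: "'i::{finite,linorder} \<Rightarrow> 'i \<Rightarrow> 'a::comm_ring_1" where
  "cl_factor i j = (if j < i then - 1 else if j = i then - eta i else 1)"

definition cl_sign :: "'i::{finite,linorder} set \<Rightarrow> 'i set \<Rightarrow> 'a::comm_ring_1" where
  "cl_sign I J = (\<Prod>i\<in>I. \<Prod>j\<in>J. cl_factor i j)"

definition cl_mult ::
  "('a::comm_ring_1, 'i::{finite,linorder}) clifford \<Rightarrow> ('a, 'i) clifford \<Rightarrow> ('a, 'i) clifford"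
  (infixl \<open>\<star>\<close> 70) where
  "a \<star> b = (\<chi> K. \<Sum>I\<in>UNIV. cl_sign I (sym_diff I K) * a $ I * b $ (sym_diff I K))"

definition cl_one :: "('a::comm_ring_1, 'i::{finite,linorder}) clifford" where
  "cl_one = axis {} 1"

definition cl_gen :: "'i::{finite,linorder} \<Rightarrow> ('a::comm_ring_1, 'i) clifford" where
  "cl_gen i = axis {i} 1"

definition cl_vec :: "('a::comm_ring_1, 'i::{finite,linorder}) vec \<Rightarrow> ('a, 'i) clifford" where
  "cl_vec v = (\<Sum>i\<in>UNIV. v $ i *s cl_gen i)"

definition cl_list_prod ::
  "('a::comm_ring_1, 'i::{finite,linorder}) clifford list \<Rightarrow> ('a, 'i) clifford" where
  "cl_list_prod xs = foldr (\<star>) xs cl_one"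

definition cl_monoid :: "('a::comm_ring_1, 'i::{finite,linorder}) clifford monoid" where
  "cl_monoid = \<lparr>carrier = UNIV, mult = (\<star>), one = cl_one\<rparr>"

abbreviation cl_inv ::
  "('a::comm_ring_1, 'i::{finite,linorder}) clifford \<Rightarrow> ('a, 'i) clifford" where
  "cl_inv x \<equiv> inv\<^bsub>cl_monoid\<^esub> x"

definition complexify :: "(real, 'i::{finite,linorder}) clifford \<Rightarrow> (complex, 'i) clifford" where
  "complexify a = (\<chi> I. complex_of_real (a $ I))"

text \<open>The subalgebra generated by \<open>e\<^sub>1, \<dots>, e\<^sub>n\<close>, over the scalars \<open>'a\<close>.\<close>

inductive_set cl_sub :: "('a::comm_ring_1, 'i::{finite,linorder}) clifford set" where
  one: "cl_one \<in> cl_sub"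
| gen: "i \<noteq> last_ix \<Longrightarrow> cl_gen i \<in> cl_sub"
| add: "a \<in> cl_sub \<Longrightarrow> b \<in> cl_sub \<Longrightarrow> a + b \<in> cl_sub"
| scale: "a \<in> cl_sub \<Longrightarrow> c *s a \<in> cl_sub"
| mult: "a \<in> cl_sub \<Longrightarrow> b \<in> cl_sub \<Longrightarrow> a \<star> b \<in> cl_sub"

definition cl_omega :: "('a::comm_ring_1, 'i::{finite,linorder}) clifford" where
  "cl_omega = cl_list_prod (map cl_gen (sorted_list_of_set (UNIV - {last_ix})))"


subsection \<open>The model is the Clifford algebra\<close>

lemma eta_sq: "eta i * eta i = (1::'a::comm_ring_1)"
  by (simp add: eta_def)

lemma cl_factor_sq: "cl_factor i j * cl_factor i j = (1::'a::comm_ring_1)"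
  by (simp add: cl_factor_def eta_sq)

lemma prod_sym_diff:
  fixes g :: "'i::finite \<Rightarrow> 'a::comm_ring_1"
  assumes "\<And>i. g i * g i = 1"
  shows "prod g (sym_diff I J) = prod g I * prod g J"
proof -
  have sq: "prod g A * prod g A = 1" for A
    by (simp add: assms flip: prod.distrib)
  have I: "prod g I = prod g (I - J) * prod g (I \<inter> J)"
    by (subst prod.union_disjoint[symmetric]) (auto intro: prod.cong)
  have J: "prod g J = prod g (J - I) * prod g (I \<inter> J)"
    by (subst prod.union_disjoint[symmetric]) (auto intro: prod.cong)
  have "prod g (sym_diff I J) = prod g (I - J) * prod g (J - I)"
    by (rule prod.union_disjoint) auto
  also have "\<dots> = prod g (I - J) * prod g (J - I) * (prod g (I \<inter> J) * prod g (I \<inter> J))"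
    by (simp add: sq)
  finally show ?thesis
    unfolding I J by (simp only: mult_ac)
qed

lemma cl_sign_left:
  "cl_sign (sym_diff I J) K = cl_sign I K * (cl_sign J K :: 'a::comm_ring_1)"
  unfolding cl_sign_def
  by (rule prod_sym_diff) (simp add: cl_factor_sq flip: prod.distrib)

lemma cl_sign_right:
  "cl_sign I (sym_diff J K) = cl_sign I J * (cl_sign I K :: 'a::comm_ring_1)"
  unfolding cl_sign_def
  by (subst prod_sym_diff) (simp_all add: cl_factor_sq prod.distrib)

lemma cl_mult_axis:
  "axis A x \<star> axis B y = axis (sym_diff A B) (cl_sign A B * x * (y::'a::comm_ring_1))"
proof -
  have "(\<Sum>I\<in>UNIV. cl_sign I (sym_diff I K) * axis A x $ I * axis B y $ sym_diff I K)
      = axis (sym_diff A B) (cl_sign A B * x * y) $ K" for K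
  proof -
    have "(\<Sum>I\<in>UNIV. cl_sign I (sym_diff I K) * axis A x $ I * axis B y $ sym_diff I K)
        = cl_sign A (sym_diff A K) * x * axis B y $ sym_diff A K"
      by (subst sum.remove[of _ A]) (auto simp: axis_def intro!: sum.neutral)
    also have "\<dots> = axis (sym_diff A B) (cl_sign A B * x * y) $ K"
    proof (cases "K = sym_diff A B")
      case True
      then have eq: "sym_diff A K = B"
        by blast
      show ?thesis
        unfolding eq unfolding True axis_nth ..
    next
      case False
      then have "sym_diff A K \<noteq> B"
        by blast
      with False show ?thesis
        by (simp add: axis_def del: Un_Diff)
    qed
    finally show ?thesis .
  qed
  then show ?thesis
    by (simp add: cl_mult_def vec_eq_iff del: Un_Diff)
qed

lemma cl_mult_linear:
  "(a + b) \<star> c = a \<star> c + b \<star> c" "c \<star> (a + b) = c \<star> a + c \<star> b"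
  "(r *s a) \<star> c = r *s (a \<star> c)" "c \<star> (r *s a) = r *s (c \<star> a)"
  by (auto simp: cl_mult_def vec_eq_iff sum.distrib algebra_simps sum_distrib_left)

lemma cl_mult_sum:
  "sum f A \<star> c = (\<Sum>x\<in>A. f x \<star> c)" "c \<star> sum f A = (\<Sum>x\<in>A. c \<star> f x)"
proof -
  have [simp]: "0 \<star> d = 0" "d \<star> 0 = 0" for d :: "('a, 'b) clifford"
    by (auto simp: cl_mult_def vec_eq_iff)
  show "sum f A \<star> c = (\<Sum>x\<in>A. f x \<star> c)" "c \<star> sum f A = (\<Sum>x\<in>A. c \<star> f x)"
    by (induction A rule: infinite_finite_induct; simp add: cl_mult_linear)+
qed

lemma cl_expand: "a = (\<Sum>I\<in>UNIV. a $ I *s axis I (1::'a::comm_ring_1))"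
  by (auto simp: vec_eq_iff axis_def if_distrib[where f = "\<lambda>x. _ * x"] cong: if_cong)

lemma cl_mult_expand:
  "a \<star> b = (\<Sum>I\<in>UNIV. \<Sum>J\<in>UNIV. (a $ I * b $ J) *s (axis I 1 \<star> axis J (1::'a::comm_ring_1)))"
proof -
  have "(\<Sum>I\<in>UNIV. a $ I *s axis I 1) \<star> (\<Sum>J\<in>UNIV. b $ J *s axis J (1::'a))
    = (\<Sum>I\<in>UNIV. \<Sum>J\<in>UNIV. (a $ I * b $ J) *s (axis I 1 \<star> axis J 1))"
    by (subst cl_mult_sum(1), subst cl_mult_sum(2))
      (simp add: cl_mult_linear vector_smult_assoc mult.commute)
  then show ?thesis
    by (simp only: cl_expand[symmetric])
qed

lemma cl_mult_assoc: "(a \<star> b) \<star> c = a \<star> (b \<star> c)"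
proof -
  have sd: "sym_diff (sym_diff I J) K = sym_diff I (sym_diff J K)" for I J K :: "'b set"
    by blast
  have "(axis I 1 \<star> axis J 1) \<star> axis K 1 = axis I 1 \<star> (axis J 1 \<star> axis K (1::'a))"
    for I J K :: "'b set"
    by (simp add: cl_mult_axis cl_sign_left cl_sign_right sd mult_ac del: Un_Diff)
  then show ?thesis
    by (subst (1 2) cl_expand[of a], subst (1 2) cl_expand[of b], subst (1 2) cl_expand[of c])
      (simp add: cl_mult_sum cl_mult_linear)
qed

lemma cl_one_mult [simp]: "cl_one \<star> a = a" "a \<star> cl_one = a"
proof -
  have "cl_one \<star> axis I 1 = axis I (1::'a)" "axis I 1 \<star> cl_one = axis I (1::'a)" for I :: "'b set"
    by (simp_all add: cl_one_def cl_mult_axis cl_sign_def)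
  then show "cl_one \<star> a = a" "a \<star> cl_one = a"
    by (subst (1 2) cl_expand[of a]; simp add: cl_mult_sum cl_mult_linear)+
qed

lemma monoid_cl: "monoid cl_monoid"
  by (rule monoidI) (auto simp: cl_monoid_def cl_mult_assoc)

lemma axis_scale: "axis I c = c *s axis I (1::'a::comm_ring_1)"
  by (auto simp: axis_def vec_eq_iff)

lemma cl_gen_relations:
  "cl_gen i \<star> cl_gen i = - eta i *s (cl_one :: ('a::comm_ring_1, 'b::{finite,linorder}) clifford)"
  "i \<noteq> j \<Longrightarrow> cl_gen i \<star> cl_gen j + cl_gen j \<star> cl_gen i
    = (0 :: ('a::comm_ring_1, 'b::{finite,linorder}) clifford)"
proof -
  show "cl_gen i \<star> cl_gen i = - eta i *s (cl_one :: ('a, 'b) clifford)"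
    by (simp add: cl_gen_def cl_mult_axis cl_sign_def cl_factor_def cl_one_def
        flip: axis_scale)
  assume "i \<noteq> j"
  moreover from this have "sym_diff {j} {i} = sym_diff {i} {j}"
    by blast
  moreover have "axis I 1 + axis I (- 1) = (0 :: ('a, 'b) clifford)"
    "axis I (- 1) + axis I 1 = (0 :: ('a, 'b) clifford)" for I
    by (simp_all add: vec_eq_iff axis_def)
  ultimately show "cl_gen i \<star> cl_gen j + cl_gen j \<star> cl_gen i = (0 :: ('a, 'b) clifford)"
    by (cases "i < j") (simp_all add: cl_gen_def cl_mult_axis cl_sign_def cl_factor_def)
qed

lemma cl_vec_axis: "cl_vec (axis i 1) = (cl_gen i :: ('a::comm_ring_1, 'b::{finite,linorder}) clifford)"
proof -
  have "axis i 1 $ k *s cl_gen k = (if k = i then cl_gen i else 0 :: ('a, 'b) clifford)" for k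
    by (auto simp: axis_def vec_eq_iff)
  then show ?thesis
    by (simp add: cl_vec_def)
qed

lemma cl_vec_sq: "cl_vec v \<star> cl_vec v = - lorentz_q v *s cl_one"
proof -
  let ?p = "\<lambda>i j. (v $ i * v $ j) *s (cl_gen i \<star> cl_gen j)"
  have vv: "cl_vec v \<star> cl_vec v = (\<Sum>i\<in>UNIV. \<Sum>j\<in>UNIV. ?p j i)"
    by (simp add: cl_vec_def cl_mult_sum cl_mult_linear vec_eq_iff sum_distrib_left mult_ac)
  also have "\<dots> = (\<Sum>i\<in>UNIV. \<Sum>j\<in>UNIV. ?p i j)"
    by (rule sum.swap)
  finally have "2 *s (cl_vec v \<star> cl_vec v) = (\<Sum>i\<in>UNIV. \<Sum>j\<in>UNIV. ?p i j + ?p j i)"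
    using vv by (simp add: sum.distrib vec_eq_iff)
  also have "\<dots> = (\<Sum>i\<in>UNIV. \<Sum>j\<in>UNIV. if j = i then (- 2 * eta i * (v $ i)\<^sup>2) *s cl_one else 0)"
  proof (intro sum.cong refl)
    fix i j
    have "?p i j + ?p j i = (v $ i * v $ j) *s (cl_gen i \<star> cl_gen j + cl_gen j \<star> cl_gen i)"
      by (simp add: vec_eq_iff algebra_simps)
    then show "?p i j + ?p j i = (if j = i then (- 2 * eta i * (v $ i)\<^sup>2) *s cl_one else 0)"
      by (cases "i = j")
        (auto simp: cl_gen_relations vec_eq_iff power2_eq_square algebra_simps)
  qed
  also have "\<dots> = (- 2 * lorentz_q v) *s cl_one"
    by (simp add: lorentz_q_def vec_eq_iff sum_distrib_left sum_distrib_right mult.assoc)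
  finally show ?thesis
    by (simp add: vec_eq_iff)
qed

lemma cl_sign_less:
  assumes "\<forall>a\<in>A. b < a"
  shows "cl_sign {b} A = (1::'a::comm_ring_1)"
proof -
  have "cl_factor b a = (1::'a)" if "a \<in> A" for a
    using assms that by (auto simp: cl_factor_def dest: order.asym)
  then show ?thesis
    by (simp add: cl_sign_def)
qed

theorem clifford_universal:
  fixes f :: "'i::{finite,linorder} minkowski \<Rightarrow> 'b::real_algebra_1"
  assumes lin: "linear f" and sq: "\<And>v. f v * f v = - lorentz_q v *\<^sub>R 1"
  shows "\<exists>!F. linear F \<and> F cl_one = 1 \<and> (\<forall>a b. F (a \<star> b) = F a * F b) \<and> (\<forall>v. F (cl_vec v) = f v)"
proof -
  define g where "g i = f (axis i 1)" for i
  have gg: "g i * g i = - eta i *\<^sub>R 1" for i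
  proof -
    have "eta k * (axis i 1 $ k)\<^sup>2 = (if k = i then eta i else 0 :: real)" for k
      by (simp add: axis_def)
    then show ?thesis
      by (simp add: g_def sq lorentz_q_def)
  qed
  have anti: "g i * g j = - (g j * g i)" if "i \<noteq> j" for i j
  proof -
    have "lorentz_q (axis i 1 + axis j 1) = (\<Sum>k\<in>UNIV. (if k = i then eta i else 0) + (if k = j then eta j else 0))"
      unfolding lorentz_q_def using that by (intro sum.cong) (auto simp: axis_def)
    then have "lorentz_q (axis i 1 + axis j 1) = eta i + eta j"
      by (simp add: sum.distrib)
    then have "(g i + g j) * (g i + g j) = - (eta i + eta j) *\<^sub>R 1"
      using sq[of "axis i 1 + axis j 1"] by (simp add: g_def linear_add[OF lin])
    then show ?thesis
      by (simp add: algebra_simps gg eq_neg_iff_add_eq_0)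
  qed
  define G where "G I = prod_list (map g (sorted_list_of_set I))" for I :: "'i set"
  have G0 [simp]: "G {} = 1"
    by (simp add: G_def)
  have G_insert: "G (insert b A) = g b * G A" if "\<forall>a\<in>A. b < a" for b A
    using that by (subst G_def, subst sorted_list_of_set_insert_remove)
      (auto simp: G_def insort_is_Cons less_imp_le)
  have step: "g i * G I = cl_sign {i} I *\<^sub>R G (sym_diff {i} I)" for i I
  proof (induction I rule: finite_linorder_min_induct[OF finite])
    case 1
    then show ?case
      by (simp add: cl_sign_def G_insert)
  next
    case (2 b A)
    consider "i < b" | "i = b" | "b < i"
      by fastforce
    then show ?case
    proof cases
      case 1
      then have lt: "\<forall>a\<in>insert b A. i < a"
        using 2 by auto
      then have "sym_diff {i} (insert b A) = insert i (insert b A)"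
        by auto
      moreover have "cl_sign {i} (insert b A) = (1::real)"
        using cl_sign_less[OF lt] .
      ultimately show ?thesis
        by (simp add: G_insert[OF lt])
    next
      case [simp]: 2
      have "sym_diff {i} (insert b A) = A"
        using \<open>\<forall>a\<in>A. b < a\<close> by auto
      moreover have "cl_sign {i} A = (1::real)"
        using \<open>\<forall>a\<in>A. b < a\<close> by (simp add: cl_sign_less)
      then have "cl_sign {i} (insert b A) = (- eta i::real)"
        using \<open>\<forall>a\<in>A. b < a\<close> by (subst (asm) cl_sign_def, subst cl_sign_def) (auto simp: cl_factor_def)
      ultimately show ?thesis
        using gg[of i] \<open>\<forall>a\<in>A. b < a\<close> by (simp add: G_insert flip: mult.assoc)
    next
      case 3
      have lt: "\<forall>a\<in>sym_diff {i} A. b < a"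
        using \<open>\<forall>a\<in>A. b < a\<close> 3 by auto
      have "g i * G (insert b A) = - (g b * (g i * G A))"
        using anti[of i b] 3 \<open>\<forall>a\<in>A. b < a\<close> by (simp add: G_insert flip: mult.assoc)
      also have "\<dots> = - cl_sign {i} A *\<^sub>R G (insert b (sym_diff {i} A))"
        by (simp add: 2 G_insert[OF lt])
      also have "insert b (sym_diff {i} A) = sym_diff {i} (insert b A)"
        using 3 by auto
      also have "- cl_sign {i} A = (cl_sign {i} (insert b A) :: real)"
        using \<open>\<forall>a\<in>A. b < a\<close> 3 by (auto simp: cl_sign_def cl_factor_def)
      finally show ?thesis .
    qed
  qed
  have GG: "G I * G J = cl_sign I J *\<^sub>R G (sym_diff I J)" for I J
  proof (induction I rule: finite_linorder_min_induct[OF finite])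
    case 1
    then show ?case
      by (simp add: cl_sign_def)
  next
    case (2 b A)
    have sA: "cl_sign {b} A = (1::real)"
      using 2 by (simp add: cl_sign_less)
    have ins: "insert b A = sym_diff {b} A"
      using 2 by auto
    have "G (insert b A) * G J = cl_sign A J *\<^sub>R (g b * G (sym_diff A J))"
      using 2 by (simp add: G_insert mult.assoc)
    also have "\<dots> = (cl_sign {b} J * cl_sign A J) *\<^sub>R G (sym_diff {b} (sym_diff A J))"
      unfolding step cl_sign_right by (simp add: sA mult.commute)
    also have "cl_sign {b} J * cl_sign A J = (cl_sign (insert b A) J :: real)"
      unfolding ins cl_sign_left ..
    also have "sym_diff {b} (sym_diff A J) = sym_diff (insert b A) J"
      using 2 by auto
    finally show ?case .
  qed
  define F where "F a = (\<Sum>I\<in>UNIV. a $ I *\<^sub>R G I)" for a :: "(real, 'i) clifford"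
  have linF: "linear F"
    by (rule linearI) (simp_all add: F_def algebra_simps sum.distrib scaleR_sum_right)
  have F_axis: "F (axis I c) = c *\<^sub>R G I" for I c
  proof -
    have "axis I c $ K *\<^sub>R G K = (if K = I then c *\<^sub>R G I else 0)" for K
      by (simp add: axis_def)
    then show ?thesis
      by (simp add: F_def)
  qed
  have F_scale: "F (c *s a) = c *\<^sub>R F a" for c a
    using linF by (simp add: scalar_mult_eq_scaleR linear_scale)
  have F_mult: "F (a \<star> b) = F a * F b" for a b
  proof -
    have *: "F (axis I 1 \<star> axis J 1) = G I * G J" for I J
      by (simp add: cl_mult_axis F_axis GG)
    show ?thesis
      unfolding cl_mult_expand[of a b]
      by (simp only: linear_sum[OF linF] F_scale *) (simp add: F_def sum_product
          mult.commute[where 'a = real])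
  qed
  have gen: "F' (cl_vec v) = (\<Sum>i\<in>UNIV. v $ i *\<^sub>R F' (cl_gen i))"
    if "linear F'" for v and F' :: "(real, 'i) clifford \<Rightarrow> 'b"
    using that by (simp add: cl_vec_def linear_sum linear_scale scalar_mult_eq_scaleR)
  have F_vec: "F (cl_vec v) = f v" for v
  proof -
    have "F (cl_vec v) = (\<Sum>i\<in>UNIV. v $ i *\<^sub>R g i)"
      using G_insert[of "{}"] by (simp add: gen[OF linF] cl_gen_def F_axis)
    also have "\<dots> = f (\<Sum>i\<in>UNIV. v $ i *\<^sub>R axis i 1)"
      using lin by (simp add: g_def linear_sum linear_scale)
    also have "(\<Sum>i\<in>UNIV. v $ i *\<^sub>R axis i 1) = v"
      by (simp add: basis_expansion flip: scalar_mult_eq_scaleR)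
    finally show ?thesis .
  qed
  have uniq: "F' = F" if "linear F'" "F' cl_one = 1" "\<forall>a b. F' (a \<star> b) = F' a * F' b"
    "\<forall>v. F' (cl_vec v) = f v" for F'
  proof
    fix a
    have "F' (axis I 1) = G I" for I
    proof (induction I rule: finite_linorder_min_induct[OF finite])
      case 1
      then show ?case
        using that by (simp add: cl_one_def)
    next
      case (2 b A)
      then have "cl_sign {b} A = (1::real)"
        by (simp add: cl_sign_less)
      moreover have "sym_diff {b} A = insert b A"
        using 2 by auto
      ultimately have "axis (insert b A) 1 = cl_vec (axis b 1) \<star> axis A (1::real)"
        by (simp add: cl_vec_axis cl_gen_def cl_mult_axis)
      then show ?case
        using that 2 by (simp add: G_insert g_def)
    qed
    then show "F' a = F a"
      by (subst cl_expand[of a])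
        (simp add: F_def linear_sum[OF that(1)] scalar_mult_eq_scaleR linear_scale[OF that(1)])
  qed
  have "F cl_one = 1"
    by (simp add: cl_one_def F_axis)
  then show ?thesis
    using linF F_mult F_vec uniq by blast
qed


section \<open>Spin groups and the special Lorentz group\<close>

definition spin_lorentz :: "(real, 'i::{finite,linorder}) clifford set" where
  "spin_lorentz = {cl_list_prod (map cl_vec vs) | vs.
     even (length vs) \<and> (\<forall>v\<in>set vs. lorentz_q v = 1 \<or> lorentz_q v = - 1)}"

definition spin_plus :: "(real, 'i::{finite,linorder}) clifford set" where
  "spin_plus = connected_component_set spin_lorentz cl_one"

text \<open>\<open>Spin(n)\<close>: on \<open>\<real>\<^sup>n\<close>, the vectors with vanishing last coordinate, \<open>q\<close> is positive definite.\<close>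

definition spin_n :: "(real, 'i::{finite,linorder}) clifford set" where
  "spin_n = {cl_list_prod (map cl_vec vs) | vs.
     even (length vs) \<and> (\<forall>v\<in>set vs. v $ last_ix = 0 \<and> lorentz_q v = 1)}"

definition spin_plus_group :: "(real, 'i::{finite,linorder}) clifford monoid" where
  "spin_plus_group = cl_monoid\<lparr>carrier := spin_plus\<rparr>"

definition Ad :: "(real, 'i::{finite,linorder}) clifford \<Rightarrow> 'i minkowski \<Rightarrow> 'i minkowski" where
  "Ad x w = (THE u. cl_vec u = x \<star> cl_vec w \<star> cl_inv x)"

definition SO_lorentz :: "('i::{finite,linorder} minkowski_mat) set" where
  "SO_lorentz = {A. (\<forall>x. lorentz_q (A *v x) = lorentz_q x) \<and> det A = 1}"

definition SO_plus :: "('i::{finite,linorder} minkowski_mat) set" where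
  "SO_plus = connected_component_set SO_lorentz (mat 1)"

definition SO_plus_group :: "('i::{finite,linorder} minkowski_mat) monoid" where
  "SO_plus_group = \<lparr>carrier = SO_plus, mult = (**), one = mat 1\<rparr>"

definition torsion_free :: "('a, 'b) monoid_scheme \<Rightarrow> bool" where
  "torsion_free G \<longleftrightarrow>
     (\<forall>x\<in>carrier G. x \<noteq> \<one>\<^bsub>G\<^esub> \<longrightarrow> (\<forall>j::nat. j > 0 \<longrightarrow> x [^]\<^bsub>G\<^esub> j \<noteq> \<one>\<^bsub>G\<^esub>))"


section \<open>Complex spin representations\<close>

text \<open>\<open>\<psi>\<close> is only constrained on the subalgebra \<open>\<complex>\<ell>(n)\<close> generated by \<open>e\<^sub>1, \<dots>, e\<^sub>n\<close>.\<close>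

definition clifford_matrix_iso ::
  "((complex, 'i::{finite,linorder}) clifford \<Rightarrow> complex ^ 'k ^ 'k) \<Rightarrow> bool" where
  "clifford_matrix_iso \<psi> \<longleftrightarrow>
     bij_betw \<psi> cl_sub UNIV \<and> \<psi> cl_one = mat 1 \<and>
     (\<forall>a\<in>cl_sub. \<forall>b\<in>cl_sub. \<psi> (a + b) = \<psi> a + \<psi> b \<and> \<psi> (a \<star> b) = \<psi> a ** \<psi> b) \<and>
     (\<forall>c. \<forall>a\<in>cl_sub. \<psi> (c *s a) = (\<chi> r. c *s \<psi> a $ r))"

definition clifford_rho ::
  "nat \<Rightarrow> complex \<Rightarrow> ((complex, 'i::{finite,linorder}) clifford \<Rightarrow> (complex, 'i) clifford) \<Rightarrow> bool" where
  "clifford_rho m \<sigma> \<rho> \<longleftrightarrow>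
     range \<rho> \<subseteq> cl_sub \<and> \<rho> cl_one = cl_one \<and>
     (\<forall>a b. \<rho> (a + b) = \<rho> a + \<rho> b \<and> \<rho> (a \<star> b) = \<rho> a \<star> \<rho> b) \<and>
     (\<forall>c a. \<rho> (c *s a) = c *s \<rho> a) \<and>
     (\<forall>i. i \<noteq> last_ix \<longrightarrow> \<rho> (cl_gen i) = cl_gen i) \<and>
     \<rho> (cl_gen last_ix) = (\<sigma> * \<i> ^ m) *s cl_omega"

definition Delta_n ::
  "((complex, 'i::{finite,linorder}) clifford \<Rightarrow> complex ^ 'k ^ 'k)
     \<Rightarrow> (real, 'i) clifford \<Rightarrow> complex ^ 'k ^ 'k" where
  "Delta_n \<psi> s = \<psi> (complexify s)"

definition Delta_n1 ::
  "((complex, 'i::{finite,linorder}) clifford \<Rightarrow> complex ^ 'k ^ 'k)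
     \<Rightarrow> ((complex, 'i) clifford \<Rightarrow> (complex, 'i) clifford)
     \<Rightarrow> (real, 'i) clifford \<Rightarrow> complex ^ 'k ^ 'k" where
  "Delta_n1 \<psi> \<rho> g = \<psi> (\<rho> (complexify g))"


section \<open>Quotient topologies and induced maps\<close>

definition quotient_topology :: "'a topology \<Rightarrow> ('a \<Rightarrow> 'b) \<Rightarrow> 'b topology" where
  "quotient_topology X p =
     topology (\<lambda>U. U \<subseteq> p ` topspace X \<and> openin X {x \<in> topspace X. p x \<in> U})"

lemma openin_quotient_topology:
  "openin (quotient_topology X p) U \<longleftrightarrow>
     U \<subseteq> p ` topspace X \<and> openin X {x \<in> topspace X. p x \<in> U}"
proof -
  have "istopology (\<lambda>U. U \<subseteq> p ` topspace X \<and> openin X {x \<in> topspace X. p x \<in> U})"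
    unfolding istopology_def
  proof (intro conjI allI impI; (elim conjE)?)
    fix S T
    assume "openin X {x \<in> topspace X. p x \<in> S}" "openin X {x \<in> topspace X. p x \<in> T}"
    moreover have "{x \<in> topspace X. p x \<in> S \<inter> T}
        = {x \<in> topspace X. p x \<in> S} \<inter> {x \<in> topspace X. p x \<in> T}"
      by blast
    ultimately show "openin X {x \<in> topspace X. p x \<in> S \<inter> T}"
      by (simp add: openin_Int)
  next
    fix K
    assume K: "\<forall>S\<in>K. S \<subseteq> p ` topspace X \<and> openin X {x \<in> topspace X. p x \<in> S}"
    have "{x \<in> topspace X. p x \<in> \<Union>K} = (\<Union>S\<in>K. {x \<in> topspace X. p x \<in> S})"
      by blast
    with K show "openin X {x \<in> topspace X. p x \<in> \<Union>K}"
      by (auto intro: openin_Union)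
  qed blast+
  then show ?thesis
    by (simp add: quotient_topology_def)
qed

lemma topspace_quotient_topology: "topspace (quotient_topology X p) = p ` topspace X"
proof
  have "{x \<in> topspace X. p x \<in> p ` topspace X} = topspace X"
    by blast
  then show "p ` topspace X \<subseteq> topspace (quotient_topology X p)"
    by (intro openin_subset) (simp add: openin_quotient_topology)
  show "topspace (quotient_topology X p) \<subseteq> p ` topspace X"
    using openin_quotient_topology[of X p] openin_topspace by blast
qed

lemma quotient_map_quotient_topology: "quotient_map X (quotient_topology X p) p"
  by (auto simp: quotient_map_def topspace_quotient_topology openin_quotient_topology)

text \<open>The map \<open>p x \<mapsto> f x\<close>, for \<open>x \<in> P\<close>.\<close>

definition descend :: "'a set \<Rightarrow> ('a \<Rightarrow> 'b) \<Rightarrow> ('a \<Rightarrow> 'c) \<Rightarrow> 'b \<Rightarrow> 'c" where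
  "descend P p f y = (THE z. \<exists>x\<in>P. p x = y \<and> f x = z)"

lemma descend_eq:
  assumes "x \<in> P" "\<And>x'. x' \<in> P \<Longrightarrow> p x' = p x \<Longrightarrow> f x' = f x"
  shows "descend P p f (p x) = f x"
proof -
  have "(THE z. \<exists>x'\<in>P. p x' = p x \<and> f x' = z) = f x"
    using assms by (intro the_equality) metis+
  then show ?thesis
    by (simp only: descend_def)
qed


section \<open>Complex vector bundles\<close>

definition complex_vector_space_on ::
  "'e set \<Rightarrow> ('e \<Rightarrow> 'e \<Rightarrow> 'e) \<Rightarrow> (complex \<Rightarrow> 'e \<Rightarrow> 'e) \<Rightarrow> bool" where
  "complex_vector_space_on V pl sc \<longleftrightarrow>
     (\<exists>z. comm_group \<lparr>carrier = V, mult = pl, one = z\<rparr>) \<and>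
     (\<forall>c. \<forall>u\<in>V. sc c u \<in> V) \<and>
     (\<forall>u\<in>V. sc 1 u = u) \<and>
     (\<forall>c d. \<forall>u\<in>V. sc (c * d) u = sc c (sc d u) \<and> sc (c + d) u = pl (sc c u) (sc d u)) \<and>
     (\<forall>c. \<forall>u\<in>V. \<forall>w\<in>V. sc c (pl u w) = pl (sc c u) (sc c w))"

text \<open>\<open>vb_plus\<close> and \<open>vb_scale\<close> are the fibrewise operations; \<open>vb_plus u w\<close> is only meaningful
  for \<open>u\<close> and \<open>w\<close> in the same fibre.\<close>

record ('e, 'b) vbundle =
  vb_total :: "'e topology"
  vb_base :: "'b topology"
  vb_proj :: "'e \<Rightarrow> 'b"
  vb_plus :: "'e \<Rightarrow> 'e \<Rightarrow> 'e"
  vb_scale :: "complex \<Rightarrow> 'e \<Rightarrow> 'e"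

definition vb_fibre :: "('e, 'b) vbundle \<Rightarrow> 'b \<Rightarrow> 'e set" where
  "vb_fibre E b = {u \<in> topspace (vb_total E). vb_proj E u = b}"

text \<open>Complex vector bundles with fibre \<open>\<complex>\<^sup>k\<close>.\<close>

definition complex_vector_bundle :: "'k::finite itself \<Rightarrow> ('e, 'b) vbundle \<Rightarrow> bool" where
  "complex_vector_bundle TYPE('k) E \<longleftrightarrow>
     continuous_map (vb_total E) (vb_base E) (vb_proj E) \<and>
     (\<forall>b\<in>topspace (vb_base E). complex_vector_space_on (vb_fibre E b) (vb_plus E) (vb_scale E)) \<and>
     (\<forall>b\<in>topspace (vb_base E). \<exists>U (h :: 'b \<times> 'k cvec \<Rightarrow> 'e).
        openin (vb_base E) U \<and> b \<in> U \<and>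
        homeomorphic_map
          (prod_topology (subtopology (vb_base E) U) euclidean)
          (subtopology (vb_total E) {u \<in> topspace (vb_total E). vb_proj E u \<in> U}) h \<and>
        (\<forall>x\<in>U. \<forall>v w c.
           vb_proj E (h (x, v)) = x \<and>
           h (x, v + w) = vb_plus E (h (x, v)) (h (x, w)) \<and>
           h (x, c *s v) = vb_scale E c (h (x, v))))"

definition complex_vector_bundle_equivalence ::
  "'k::finite itself \<Rightarrow> ('e, 'b) vbundle \<Rightarrow> ('f, 'b) vbundle \<Rightarrow> ('e \<Rightarrow> 'f) \<Rightarrow> bool" where
  "complex_vector_bundle_equivalence K E F f \<longleftrightarrow>
     complex_vector_bundle K E \<and> complex_vector_bundle K F \<and> vb_base E = vb_base F \<and>
     homeomorphic_map (vb_total E) (vb_total F) f \<and>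
     (\<forall>u\<in>topspace (vb_total E). vb_proj F (f u) = vb_proj E u) \<and>
     (\<forall>b\<in>topspace (vb_base E). \<forall>u\<in>vb_fibre E b. \<forall>w\<in>vb_fibre E b. \<forall>c.
        f (vb_plus E u w) = vb_plus F (f u) (f w) \<and>
        f (vb_scale E c u) = vb_scale F c (f u))"

text \<open>Fibrewise operations on classes \<open>[g, v]\<close> with \<open>g \<in> G\<close> and \<open>v \<in> \<complex>\<^sup>k\<close>, given by
  \<open>[g, v] + [g, w] = [g, v + w]\<close> and \<open>c [g, v] = [g, c v]\<close>.\<close>

definition class_plus :: "'g set \<Rightarrow> ('g \<Rightarrow> 'k::finite cvec \<Rightarrow> 'e) \<Rightarrow> 'e \<Rightarrow> 'e \<Rightarrow> 'e" where
  "class_plus G cls u u' =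
     (THE z. \<exists>g\<in>G. \<exists>v w. u = cls g v \<and> u' = cls g w \<and> z = cls g (v + w))"

definition class_scale :: "'g set \<Rightarrow> ('g \<Rightarrow> 'k::finite cvec \<Rightarrow> 'e) \<Rightarrow> complex \<Rightarrow> 'e \<Rightarrow> 'e" where
  "class_scale G cls c u = (THE z. \<exists>g\<in>G. \<exists>v. u = cls g v \<and> z = cls g (c *s v))"


section \<open>The two bundles\<close>

definition base_class ::
  "('i::{finite,linorder} minkowski_mat) set \<Rightarrow> 'i minkowski \<Rightarrow> ('i minkowski) set" where
  "base_class \<Gamma> x = (\<lambda>A. A *v x) ` \<Gamma>"

definition base_space ::
  "('i::{finite,linorder} minkowski_mat) set \<Rightarrow> ('i minkowski) set topology" where
  "base_space \<Gamma> = quotient_topology (top_of_set hyperbolic_space) (base_class \<Gamma>)"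

definition spin_coset ::
  "(real, 'i::{finite,linorder}) clifford set \<Rightarrow> (real, 'i) clifford \<Rightarrow> (real, 'i) clifford set" where
  "spin_coset \<Gamma>h g = \<Gamma>h #>\<^bsub>spin_plus_group\<^esub> g"

text \<open>The right action \<open>(C, v) s = (C s, s\<^sup>-\<^sup>1 v)\<close> of \<open>Spin(n)\<close> on pairs of a coset and a spinor.\<close>

definition spinor_act ::
  "((complex, 'i::{finite,linorder}) clifford \<Rightarrow> complex ^ 'k ^ 'k)
     \<Rightarrow> (real, 'i) clifford set \<times> 'k cvec \<Rightarrow> (real, 'i) clifford
     \<Rightarrow> (real, 'i) clifford set \<times> 'k cvec" where
  "spinor_act \<psi> p s = (fst p #>\<^bsub>spin_plus_group\<^esub> s, Delta_n \<psi> (cl_inv s) *v snd p)"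

definition spinor_orbit ::
  "((complex, 'i::{finite,linorder}) clifford \<Rightarrow> complex ^ 'k ^ 'k)
     \<Rightarrow> (real, 'i) clifford set \<times> 'k cvec
     \<Rightarrow> ((real, 'i) clifford set \<times> 'k cvec) set" where
  "spinor_orbit \<psi> p = spinor_act \<psi> p ` spin_n"

definition spinor_class ::
  "(real, 'i::{finite,linorder}) clifford set
     \<Rightarrow> ((complex, 'i) clifford \<Rightarrow> complex ^ 'k ^ 'k)
     \<Rightarrow> (real, 'i) clifford \<Rightarrow> 'k cvec
     \<Rightarrow> ((real, 'i) clifford set \<times> 'k cvec) set" where
  "spinor_class \<Gamma>h \<psi> g v = spinor_orbit \<psi> (spin_coset \<Gamma>h g, v)"

definition spinor_bundle ::
  "('i::{finite,linorder} minkowski_mat) set \<Rightarrow> (real, 'i) clifford set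
     \<Rightarrow> ((complex, 'i) clifford \<Rightarrow> complex ^ 'k ^ 'k)
     \<Rightarrow> (((real, 'i) clifford set \<times> 'k cvec) set, ('i minkowski) set) vbundle" where
  "spinor_bundle \<Gamma> \<Gamma>h \<psi> =
     \<lparr>vb_total = quotient_topology
        (prod_topology (quotient_topology (top_of_set spin_plus) (spin_coset \<Gamma>h)) euclidean)
        (spinor_orbit \<psi>),
      vb_base = base_space \<Gamma>,
      vb_proj = descend (spin_plus \<times> UNIV) (\<lambda>(g, v). spinor_class \<Gamma>h \<psi> g v)
        (\<lambda>(g, v). base_class \<Gamma> (Ad g e_last)),
      vb_plus = class_plus spin_plus (spinor_class \<Gamma>h \<psi>),
      vb_scale = class_scale spin_plus (spinor_class \<Gamma>h \<psi>)\<rparr>"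

definition flat_class ::
  "(real, 'i::{finite,linorder}) clifford set
     \<Rightarrow> ((complex, 'i) clifford \<Rightarrow> complex ^ 'k ^ 'k)
     \<Rightarrow> ((complex, 'i) clifford \<Rightarrow> (complex, 'i) clifford)
     \<Rightarrow> 'i minkowski \<Rightarrow> 'k cvec \<Rightarrow> ('i minkowski \<times> 'k cvec) set" where
  "flat_class \<Gamma>h \<psi> \<rho> x v = (\<lambda>g. (Ad g x, Delta_n1 \<psi> \<rho> g *v v)) ` \<Gamma>h"

definition flat_bundle ::
  "('i::{finite,linorder} minkowski_mat) set \<Rightarrow> (real, 'i) clifford set
     \<Rightarrow> ((complex, 'i) clifford \<Rightarrow> complex ^ 'k ^ 'k)
     \<Rightarrow> ((complex, 'i) clifford \<Rightarrow> (complex, 'i) clifford)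
     \<Rightarrow> (('i minkowski \<times> 'k cvec) set, ('i minkowski) set) vbundle" where
  "flat_bundle \<Gamma> \<Gamma>h \<psi> \<rho> =
     \<lparr>vb_total = quotient_topology (top_of_set (hyperbolic_space \<times> UNIV))
        (\<lambda>(x, v). flat_class \<Gamma>h \<psi> \<rho> x v),
      vb_base = base_space \<Gamma>,
      vb_proj = descend (hyperbolic_space \<times> UNIV) (\<lambda>(x, v). flat_class \<Gamma>h \<psi> \<rho> x v)
        (\<lambda>(x, v). base_class \<Gamma> x),
      vb_plus = class_plus hyperbolic_space (flat_class \<Gamma>h \<psi> \<rho>),
      vb_scale = class_scale hyperbolic_space (flat_class \<Gamma>h \<psi> \<rho>)\<rparr>"

definition spinor_xi ::
  "(real, 'i::{finite,linorder}) clifford set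
     \<Rightarrow> ((complex, 'i) clifford \<Rightarrow> complex ^ 'k ^ 'k)
     \<Rightarrow> ((complex, 'i) clifford \<Rightarrow> (complex, 'i) clifford)
     \<Rightarrow> ((real, 'i) clifford set \<times> 'k cvec) set \<Rightarrow> ('i minkowski \<times> 'k cvec) set" where
  "spinor_xi \<Gamma>h \<psi> \<rho> = descend (spin_plus \<times> UNIV) (\<lambda>(g, v). spinor_class \<Gamma>h \<psi> g v)
     (\<lambda>(g, v). flat_class \<Gamma>h \<psi> \<rho> (Ad g e_last) (Delta_n1 \<psi> \<rho> g *v v))"

end

theory Submission
  imports Defs
begin

text \<open>
  The map \<open>(g, v) \<mapsto> (Ad g e_last, g v)\<close> from \<open>Spin\<^sup>+(n,1) \<times> \<complex>\<^sup>k\<close> to \<open>H\<^sup>n \<times> \<complex>\<^sup>k\<close> has a continuous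
  section, built from the boosts that take \<open>e_last\<close> to \<open>x\<close>, and is therefore a quotient map. Two pairs
  have the same spinor class exactly when their images have the same flat class, because the
  stabilizer of \<open>e_last\<close> in \<open>Spin\<^sup>+(n,1)\<close> is \<open>Spin(n)\<close>. So both total spaces are the same quotient of
  \<open>Spin\<^sup>+(n,1) \<times> \<complex>\<^sup>k\<close>, which makes \<open>\<xi>\<close> a homeomorphism. The flat bundle is locally trivial since a
  torsion-free discrete group acts freely and discontinuously on \<open>H\<^sup>n\<close>, and the spinor bundle
  inherits its local trivializations through \<open>\<xi>\<close>.
\<close>

section \<open>The Lorentz form and the Clifford algebra\<close>

text \<open>The delicate half of the stabilizer statement is that an element of
  \<open>spin_plus\<close> fixing \<open>e_last\<close> is a product of vectors with last coordinate
  0. Its given factors may be timelike, and the Lorentz form has null vectors, so the difference of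
  two vectors need not define a reflection. Keeping \<open>e_last\<close> fixed from the start
  confines the argument to its Euclidean complement, where every nonzero difference can be
  normalised. An element that commutes with all basis vectors up to the grading sign is a scalar,
  and the determinant of left multiplication identifies it as 1 or -1. The other half, that Spin(n)
  lies in the identity component, rests on the connectedness of the sphere S^(n-1), hence on n >= 2.
  Finiteness has one source: all entries of a Lorentz matrix are controlled by the last coordinate
  of its image of \<open>e_last\<close>, so the members of \<Gamma> that move some point of a
  bounded region into the same region form a bounded set of matrices. The spin representation enters
  through three facts: it is multiplicative, continuous, and restricts to \<open>Delta_n\<close> on
  Spin(n).\<close>

definition lorentz_b :: "'i::{finite,linorder} minkowski \<Rightarrow> 'i minkowski \<Rightarrow> real" where
  "lorentz_b v w = (\<Sum>i\<in>UNIV. eta i * v $ i * w $ i)"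

lemma lorentz_q_eq_b: "lorentz_q v = lorentz_b v v"
  by (simp add: lorentz_q_def lorentz_b_def power2_eq_square mult.assoc)

lemma lorentz_b_commute: "lorentz_b v w = lorentz_b w v"
  by (simp add: lorentz_b_def mult_ac)

lemma lorentz_b_linear [simp]:
  "lorentz_b (u + v) w = lorentz_b u w + lorentz_b v w"
  "lorentz_b w (u + v) = lorentz_b w u + lorentz_b w v"
  "lorentz_b (u - v) w = lorentz_b u w - lorentz_b v w"
  "lorentz_b w (u - v) = lorentz_b w u - lorentz_b w v"
  "lorentz_b (- v) w = - lorentz_b v w"
  "lorentz_b w (- v) = - lorentz_b w v"
  "lorentz_b (c *\<^sub>R v) w = c * lorentz_b v w"
  "lorentz_b w (c *\<^sub>R v) = c * lorentz_b w v"
  by (simp_all add: lorentz_b_def sum.distrib sum_subtractf sum_negf sum_distrib_left algebra_simps)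

lemma lorentz_b_axis [simp]: "lorentz_b v (axis i 1) = eta i * v $ i"
  "lorentz_b (axis i 1) v = eta i * v $ i"
proof -
  have "eta j * v $ j * axis i 1 $ j = (if j = i then eta i * v $ i else 0)" for j
    by (simp add: axis_def)
  then show "lorentz_b v (axis i 1) = eta i * v $ i"
    by (simp add: lorentz_b_def)
  then show "lorentz_b (axis i 1) v = eta i * v $ i"
    by (simp only: lorentz_b_commute)
qed

lemma lorentz_q_axis: "lorentz_q (axis i 1) = eta i"
  by (simp add: lorentz_q_eq_b)

lemma eta_last [simp]: "eta last_ix = - 1"
  by (simp add: eta_def)

lemma eta_not_last [simp]: "i \<noteq> last_ix \<Longrightarrow> eta i = 1"
  by (simp add: eta_def)

lemma lorentz_b_inner: "lorentz_b v w = v \<bullet> w - 2 * v $ last_ix * w $ last_ix"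
proof -
  have "lorentz_b v w = (\<Sum>i\<in>UNIV. v $ i * w $ i - (if i = last_ix then 2 * v $ last_ix * w $ last_ix else 0))"
    unfolding lorentz_b_def by (intro sum.cong) (auto simp: eta_def)
  then show ?thesis
    by (simp add: sum_subtractf inner_vec_def)
qed

lemma continuous_on_lorentz_b [continuous_intros]:
  "continuous_on S f \<Longrightarrow> continuous_on S g \<Longrightarrow> continuous_on S (\<lambda>x. lorentz_b (f x) (g x))"
  unfolding lorentz_b_inner by (intro continuous_intros)

lemma bilinear_cl_mult: "bilinear ((\<star>) :: (real, 'i::{finite,linorder}) clifford \<Rightarrow> _)"
  unfolding bilinear_def
  by (auto intro!: linearI simp: cl_mult_linear simp flip: scalar_mult_eq_scaleR)

interpretation cl_mult: bounded_bilinear "(\<star>) :: (real, 'i::{finite,linorder}) clifford \<Rightarrow> _"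
  using bilinear_cl_mult bilinear_conv_bounded_bilinear by blast

lemmas continuous_on_cl_mult [continuous_intros] = cl_mult.continuous_on

lemma linear_cl_vec: "linear (cl_vec :: 'i::{finite,linorder} minkowski \<Rightarrow> _)"
  by (rule linearI) (auto simp: cl_vec_def vec_eq_iff sum.distrib distrib_right sum_distrib_left mult.assoc)

lemmas cl_vec_simps = linear_add[OF linear_cl_vec] linear_diff[OF linear_cl_vec]
  linear_neg[OF linear_cl_vec] linear_scale[OF linear_cl_vec] linear_0[OF linear_cl_vec]

lemma continuous_on_cl_vec [continuous_intros]:
  "continuous_on S f \<Longrightarrow> continuous_on S (\<lambda>x. cl_vec (f x :: 'i::{finite,linorder} minkowski))"
  using linear_cl_vec bounded_linear.continuous_on linear_conv_bounded_linear by blast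

lemma cl_vec_nth: "cl_vec v $ {i} = v $ i"
proof -
  have "v $ j * cl_gen j $ {i} = (if j = i then v $ i else 0)" for j
    by (auto simp: cl_gen_def axis_def)
  then show ?thesis
    by (simp add: cl_vec_def)
qed

lemma cl_vec_inject [simp]: "cl_vec v = cl_vec w \<longleftrightarrow> v = w"
  by (metis cl_vec_nth vec_eq_iff)

lemma cl_vec_square: "cl_vec v \<star> cl_vec v = - lorentz_q v *\<^sub>R cl_one"
  by (simp add: cl_vec_sq scalar_mult_eq_scaleR)

lemma cl_vec_anticommute:
  "cl_vec v \<star> cl_vec w + cl_vec w \<star> cl_vec v = - (2 * lorentz_b v w) *\<^sub>R cl_one"
proof -
  have "cl_vec (v + w) \<star> cl_vec (v + w) = - lorentz_q (v + w) *\<^sub>R cl_one"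
    by (rule cl_vec_square)
  then have "cl_vec v \<star> cl_vec w + cl_vec w \<star> cl_vec v
    = (- lorentz_q (v + w) + lorentz_q v + lorentz_q w) *\<^sub>R cl_one"
    by (simp add: cl_vec_simps cl_mult.add_left cl_mult.add_right cl_vec_square algebra_simps)
  then show ?thesis
    by (simp add: lorentz_q_eq_b lorentz_b_commute[of w v])
qed

lemma cl_vec_anticommute_orthogonal:
  "lorentz_b v w = 0 \<Longrightarrow> cl_vec v \<star> cl_vec w = - (cl_vec w \<star> cl_vec v)"
  using cl_vec_anticommute[of v w] by (simp add: eq_neg_iff_add_eq_0)


section \<open>Products of unit vectors and their action on vectors by conjugation\<close>

abbreviation cl_vec_prod :: "'i::{finite,linorder} minkowski list \<Rightarrow> (real, 'i) clifford" where
  "cl_vec_prod vs \<equiv> cl_list_prod (map cl_vec vs)"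

definition unit_vectors :: "'i::{finite,linorder} minkowski list \<Rightarrow> bool" where
  "unit_vectors vs \<longleftrightarrow> (\<forall>v\<in>set vs. lorentz_q v = 1 \<or> lorentz_q v = - 1)"

lemma unit_vectors_simps [simp]:
  "unit_vectors []"
  "unit_vectors (v # vs) \<longleftrightarrow> (lorentz_q v = 1 \<or> lorentz_q v = - 1) \<and> unit_vectors vs"
  "unit_vectors (vs @ ws) \<longleftrightarrow> unit_vectors vs \<and> unit_vectors ws"
  "unit_vectors (rev vs) \<longleftrightarrow> unit_vectors vs"
  by (auto simp: unit_vectors_def)

lemma cl_list_prod_simps [simp]:
  "cl_list_prod [] = cl_one"
  "cl_list_prod (x # xs) = x \<star> cl_list_prod xs"
  by (simp_all add: cl_list_prod_def)

lemma cl_list_prod_append: "cl_list_prod (xs @ ys) = cl_list_prod xs \<star> cl_list_prod ys"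
  by (induction xs) (simp_all add: cl_mult_assoc)

interpretation cl: monoid cl_monoid
  rewrites "carrier cl_monoid = UNIV" and "mult cl_monoid = (\<star>)" and "one cl_monoid = cl_one"
  by (rule monoid_cl) (simp_all add: cl_monoid_def)

lemma cl_vec_Units:
  assumes "lorentz_q v = 1 \<or> lorentz_q v = - 1"
  shows "cl_vec v \<in> Units cl_monoid" "cl_inv (cl_vec v) = - lorentz_q v *\<^sub>R cl_vec v"
proof -
  have *: "cl_vec v \<star> (- lorentz_q v *\<^sub>R cl_vec v) = cl_one"
    "(- lorentz_q v *\<^sub>R cl_vec v) \<star> cl_vec v = cl_one"
    using assms by (auto simp: cl_mult.scaleR_right cl_mult.scaleR_left cl_mult.minus_right cl_mult.minus_left cl_vec_square)
  then show U: "cl_vec v \<in> Units cl_monoid"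
    unfolding Units_def by (auto simp: cl_monoid_def)
  show "cl_inv (cl_vec v) = - lorentz_q v *\<^sub>R cl_vec v"
    using cl.inv_unique[OF cl.Units_l_inv[OF U] *(1)] U by simp
qed

lemma cl_inv_mult:
  assumes "x \<in> Units cl_monoid" "y \<in> Units cl_monoid"
  shows "cl_inv (x \<star> y) = cl_inv y \<star> cl_inv x"
proof -
  have "(cl_inv y \<star> cl_inv x) \<star> (x \<star> y) = cl_inv y \<star> (cl_inv x \<star> x) \<star> y"
    by (simp add: cl_mult_assoc)
  then have l: "(cl_inv y \<star> cl_inv x) \<star> (x \<star> y) = cl_one"
    using assms by simp
  have xy: "x \<star> y \<in> Units cl_monoid"
    using assms cl.Units_m_closed by blast
  show ?thesis
    using cl.inv_unique[OF l cl.Units_r_inv[OF xy]] xy by simp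
qed

lemma cl_inv_eqI:
  assumes "x \<star> y = cl_one" "y \<star> x = cl_one"
  shows "x \<in> Units cl_monoid" "cl_inv x = y"
proof -
  show U: "x \<in> Units cl_monoid"
    using assms by (auto simp: Units_def cl_monoid_def)
  show "cl_inv x = y"
    using cl.inv_unique[OF assms(2) cl.Units_r_inv[OF U]] U by simp
qed

lemma cl_vec_prod_Units: "unit_vectors vs \<Longrightarrow> cl_vec_prod vs \<in> Units cl_monoid"
  by (induction vs) (use cl_vec_Units cl.Units_m_closed in auto)

text \<open>Conjugation by one unit vector \<open>v\<close> is minus the reflection along
  \<open>v\<close>, by the anticommutation rule, so conjugation by a product maps vectors to
  vectors. This is what gives the definite description in \<open>Ad\<close> a value.\<close>

lemma cl_vec_prod_conj:
  assumes "unit_vectors vs"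
  shows "\<exists>u. cl_vec u = cl_vec_prod vs \<star> cl_vec w \<star> cl_inv (cl_vec_prod vs)"
  using assms
proof (induction vs)
  case Nil
  then show ?case
    by auto
next
  case (Cons v vs)
  then obtain u where u: "cl_vec u = cl_vec_prod vs \<star> cl_vec w \<star> cl_inv (cl_vec_prod vs)"
    by auto
  have q: "lorentz_q v = 1 \<or> lorentz_q v = - 1"
    using Cons by simp
  have "cl_vec_prod (v # vs) \<star> cl_vec w \<star> cl_inv (cl_vec_prod (v # vs))
    = cl_vec v \<star> cl_vec u \<star> cl_inv (cl_vec v)"
    using Cons.prems
    by (simp add: cl_inv_mult cl_vec_prod_Units cl_vec_Units(1)[OF q] u cl_mult_assoc)
  also have "\<dots> = - lorentz_q v *\<^sub>R ((cl_vec v \<star> cl_vec u) \<star> cl_vec v)"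
    using cl_vec_Units(2)[OF q] by (simp add: cl_mult.scaleR_right cl_mult.minus_right)
  also have "(cl_vec v \<star> cl_vec u) = - (2 * lorentz_b v u) *\<^sub>R cl_one - cl_vec u \<star> cl_vec v"
    using cl_vec_anticommute[of v u] by (metis add_diff_cancel_right')
  also have "\<dots> \<star> cl_vec v = - (2 * lorentz_b v u) *\<^sub>R cl_vec v + lorentz_q v *\<^sub>R cl_vec u"
    by (simp add: cl_mult.diff_left cl_mult.scaleR_left cl_mult_assoc cl_vec_square cl_mult.scaleR_right
       cl_mult.minus_left cl_mult.minus_right)
  finally have "cl_vec_prod (v # vs) \<star> cl_vec w \<star> cl_inv (cl_vec_prod (v # vs))
    = cl_vec (- lorentz_q v *\<^sub>R (- (2 * lorentz_b v u) *\<^sub>R v + lorentz_q v *\<^sub>R u))"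
    by (simp add: cl_vec_simps)
  then show ?case
    by metis
qed

text \<open>The Pin group of the form: odd products are included because the induction on
  reflections in \<open>spatial_factorization\<close> passes through them.\<close>

definition cl_units :: "(real, 'i::{finite,linorder}) clifford set" where
  "cl_units = {cl_vec_prod vs | vs. unit_vectors vs}"

lemma cl_units_Units: "x \<in> cl_units \<Longrightarrow> x \<in> Units cl_monoid"
  by (auto simp: cl_units_def cl_vec_prod_Units)

lemma cl_units_mult: "x \<in> cl_units \<Longrightarrow> y \<in> cl_units \<Longrightarrow> x \<star> y \<in> cl_units"
  unfolding cl_units_def by clarify (metis cl_list_prod_append map_append unit_vectors_simps(3))

lemma cl_units_inverse:
  assumes "x \<in> cl_units"
  shows "x \<star> cl_inv x = cl_one" "cl_inv x \<star> x = cl_one"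
  using cl_units_Units[OF assms] by simp_all

lemma cl_vec_Ad:
  assumes "x \<in> cl_units"
  shows "cl_vec (Ad x w) = x \<star> cl_vec w \<star> cl_inv x"
proof -
  obtain u where u: "cl_vec u = x \<star> cl_vec w \<star> cl_inv x"
    using cl_vec_prod_conj assms unfolding cl_units_def by blast
  then have "Ad x w = u"
    unfolding Ad_def by (intro the_equality) (auto simp flip: u)
  with u show ?thesis
    by simp
qed

lemma Ad_eqI: "x \<in> cl_units \<Longrightarrow> cl_vec u \<star> x = x \<star> cl_vec w \<Longrightarrow> Ad x w = u"
  using cl_vec_Ad[of x w] cl_units_inverse(1)[of x]
  by (metis cl_mult_assoc cl_one_mult(2) cl_vec_inject)

lemma Ad_mult:
  assumes "x \<in> cl_units" "y \<in> cl_units"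
  shows "Ad (x \<star> y) w = Ad x (Ad y w)"
proof -
  have "cl_vec (Ad (x \<star> y) w) = cl_vec (Ad x (Ad y w))"
    using assms by (simp add: cl_vec_Ad cl_units_mult cl_inv_mult cl_units_Units cl_mult_assoc)
  then show ?thesis
    by simp
qed

lemma cl_one_units: "cl_one \<in> cl_units"
  unfolding cl_units_def by (metis (mono_tags, lifting) cl_list_prod_simps(1) list.map(1) mem_Collect_eq unit_vectors_simps(1))

lemma Ad_one [simp]: "Ad cl_one w = w"
  by (rule Ad_eqI) (simp_all add: cl_one_units)

lemma linear_Ad:
  assumes "x \<in> cl_units"
  shows "linear (Ad x)"
proof (rule linearI)
  fix v w c
  have "cl_vec (Ad x (v + w)) = cl_vec (Ad x v + Ad x w)"
    using assms by (simp add: cl_vec_Ad cl_vec_simps cl_mult.add_left cl_mult.add_right)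
  then show "Ad x (v + w) = Ad x v + Ad x w"
    by simp
  have "cl_vec (Ad x (c *\<^sub>R v)) = cl_vec (c *\<^sub>R Ad x v)"
    using assms by (simp add: cl_vec_Ad cl_vec_simps cl_mult.scaleR_left cl_mult.scaleR_right)
  then show "Ad x (c *\<^sub>R v) = c *\<^sub>R Ad x v"
    by simp
qed

lemma cl_one_neq_0 [simp]: "cl_one \<noteq> (0 :: (real, 'i::{finite,linorder}) clifford)"
  by (simp add: cl_one_def)

text \<open>The square of a vector in the algebra is a scalar, namely minus the form, and
  conjugation does not change scalars.\<close>

lemma lorentz_q_Ad:
  assumes "x \<in> cl_units"
  shows "lorentz_q (Ad x w) = lorentz_q w"
proof -
  have "cl_vec (Ad x w) \<star> cl_vec (Ad x w) = x \<star> cl_vec w \<star> (cl_inv x \<star> x) \<star> cl_vec w \<star> cl_inv x"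
    using assms by (simp add: cl_vec_Ad cl_mult_assoc)
  also have "\<dots> = x \<star> (cl_vec w \<star> cl_vec w) \<star> cl_inv x"
    using assms by (simp add: cl_units_inverse cl_mult_assoc)
  also have "\<dots> = - lorentz_q w *\<^sub>R cl_one"
    using assms by (simp add: cl_vec_square cl_mult.scaleR_left cl_mult.scaleR_right cl_units_inverse
        cl_mult.minus_left cl_mult.minus_right)
  finally show ?thesis
    by (simp add: cl_vec_square)
qed

lemma lorentz_b_Ad:
  assumes "x \<in> cl_units"
  shows "lorentz_b (Ad x v) (Ad x w) = lorentz_b v w"
  using lorentz_q_Ad[OF assms, of "v + w"] lorentz_q_Ad[OF assms, of v] lorentz_q_Ad[OF assms, of w]
  by (simp add: lorentz_q_eq_b linear_add[OF linear_Ad[OF assms]]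
      lorentz_b_commute[of "Ad x w" "Ad x v"] lorentz_b_commute[of w v])


section \<open>The stabilizer of the last basis vector\<close>

text \<open>The determinant of the left regular representation. It is a multiplicative substitute
  for a spinor norm: it detects which scalars are products of unit vectors, and it is the
  denominator in Cramer's rule for inverses.\<close>

definition cl_det :: "(real, 'i::{finite,linorder}) clifford \<Rightarrow> real" where
  "cl_det x = det (matrix ((\<star>) x))"

lemma linear_cl_mult_left: "linear ((\<star>) (x :: (real, 'i::{finite,linorder}) clifford))"
  using bilinear_cl_mult unfolding bilinear_def by blast

lemma cl_det_mult: "cl_det (x \<star> y) = cl_det x * cl_det y"
proof -
  have "(\<star>) (x \<star> y) = (\<star>) x \<circ> (\<star>) y"
    by (rule ext) (simp add: cl_mult_assoc)
  then show ?thesis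
    by (simp add: cl_det_def matrix_compose[OF linear_cl_mult_left linear_cl_mult_left] det_mul)
qed

lemma cl_det_scalar:
  "cl_det (c *\<^sub>R cl_one :: (real, 'i::{finite,linorder}) clifford) = c ^ CARD('i set)"
proof -
  have "matrix ((\<star>) (c *\<^sub>R cl_one :: (real, 'i) clifford)) $ I $ J = (if I = J then c else 0)" for I J
    by (simp add: matrix_def cl_mult.scaleR_left axis_def)
  then show ?thesis
    unfolding cl_det_def by (subst det_diagonal) auto
qed

text \<open>A unit vector squares to 1 or -1, so the square of its determinant has absolute value 1;
  multiplicativity does the rest.\<close>

lemma abs_cl_det_units:
  assumes "x \<in> cl_units"
  shows "\<bar>cl_det x\<bar> = 1"
proof -
  obtain vs where "unit_vectors vs" "x = cl_vec_prod vs"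
    using assms by (auto simp: cl_units_def)
  moreover have "\<bar>cl_det (cl_vec_prod vs)\<bar> = 1"
    using \<open>unit_vectors vs\<close>
  proof (induction vs)
    case Nil
    then show ?case
      by (simp add: cl_det_scalar[of 1, simplified])
  next
    case (Cons v vs)
    have "cl_det (cl_vec v) * cl_det (cl_vec v) = (- lorentz_q v) ^ CARD('a set)"
      by (simp only: cl_vec_square cl_det_scalar flip: cl_det_mult)
    then have "\<bar>cl_det (cl_vec v)\<bar> * \<bar>cl_det (cl_vec v)\<bar> = \<bar>- lorentz_q v\<bar> ^ CARD('a set)"
      by (simp only: power_abs flip: abs_mult)
    also have "\<dots> = 1"
      using Cons.prems by auto
    finally have "\<bar>cl_det (cl_vec v)\<bar> = 1"
      unfolding square_eq_1_iff by auto
    with Cons show ?case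
      by (simp add: cl_det_mult abs_mult)
  qed
  ultimately show ?thesis
    by simp
qed

lemma cl_units_scalar:
  assumes "c *\<^sub>R cl_one \<in> (cl_units :: (real, 'i::{finite,linorder}) clifford set)"
  shows "c = 1 \<or> c = - 1"
proof -
  have "\<bar>c\<bar> ^ CARD('i set) = 1"
    using abs_cl_det_units[OF assms] by (simp add: cl_det_scalar power_abs)
  then have "\<bar>c\<bar> = 1"
    by (metis abs_ge_zero power_eq_1_iff abs_abs real_norm_def zero_less_card_finite less_irrefl)
  then show ?thesis
    by linarith
qed

lemma continuous_on_det [continuous_intros]:
  fixes A :: "'a::topological_space \<Rightarrow> real ^ 'n::finite ^ 'n"
  assumes "\<And>i j. continuous_on S (\<lambda>x. A x $ i $ j)"
  shows "continuous_on S (\<lambda>x. det (A x))"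
  unfolding det_def by (intro continuous_intros assms)

text \<open>The inverse of \<open>x\<close> solves the linear system
  \<open>x \<star> y = cl_one\<close>. Cramer's rule writes its coordinates as quotients of
  polynomials in those of \<open>x\<close>, with a denominator of absolute value 1 on
  \<open>cl_units\<close>.\<close>

lemma continuous_on_cl_inv:
  "continuous_on cl_units (\<lambda>x :: (real, 'i::{finite,linorder}) clifford. cl_inv x)"
proof -
  let ?A = "\<lambda>x :: (real, 'i) clifford. matrix ((\<star>) x)"
  let ?f = "\<lambda>x. (\<chi> k. det (\<chi> i j. if j = k then cl_one $ i else ?A x $ i $ j) / cl_det x)"
  have eq: "cl_inv x = ?f x" if "x \<in> cl_units" for x
  proof -
    have "cl_det x \<noteq> 0"
      using abs_cl_det_units[OF that] by auto
    moreover have "?A x *v cl_inv x = cl_one"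
      using cl_units_inverse[OF that] by (simp add: matrix_works linear_cl_mult_left)
    ultimately show ?thesis
      using cramer[of "?A x" "cl_inv x" cl_one] by (simp add: cl_det_def)
  qed
  have entry: "continuous_on cl_units (\<lambda>x. ?A x $ i $ j)" for i j
    unfolding matrix_def by (simp, intro continuous_intros)
  have num: "continuous_on cl_units (\<lambda>x. det (\<chi> i j. if j = k then cl_one $ i else ?A x $ i $ j))" for k
  proof (rule continuous_on_det)
    fix i j
    show "continuous_on cl_units (\<lambda>x. (\<chi> i j. if j = k then cl_one $ i else ?A x $ i $ j) $ i $ j)"
      by (cases "j = k") (simp_all add: entry)
  qed
  have den: "cl_det x \<noteq> 0" if "x \<in> cl_units" for x :: "(real, 'i) clifford"
    using abs_cl_det_units[OF that] by auto
  have "continuous_on cl_units (\<lambda>x :: (real, 'i) clifford. cl_det x)"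
    unfolding cl_det_def by (rule continuous_on_det) (rule entry)
  then have "continuous_on cl_units ?f"
    using den by (intro continuous_on_vec_lambda continuous_on_divide num) auto
  then show ?thesis
    by (rule continuous_on_eq) (simp add: eq)
qed

lemma continuous_on_Ad [continuous_intros]:
  assumes "continuous_on S f" "continuous_on S g" "f ` S \<subseteq> cl_units"
  shows "continuous_on S (\<lambda>x. Ad (f x) (g x))"
proof -
  have inv: "continuous_on S (\<lambda>x. cl_inv (f x))"
    using continuous_on_compose2[OF continuous_on_cl_inv assms(1,3)] .
  \<comment> \<open>The coordinates at singletons recover a vector from its image under
    \<open>cl_vec\<close>, which replaces the definite description in \<open>Ad\<close> by an
    explicit formula.\<close>
  have "continuous_on S (\<lambda>x. \<chi> i. (f x \<star> cl_vec (g x) \<star> cl_inv (f x)) $ {i})"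
    by (intro continuous_intros assms inv)
  then show ?thesis
  proof (rule continuous_on_eq)
    fix x assume "x \<in> S"
    then have "cl_vec (Ad (f x) (g x)) = f x \<star> cl_vec (g x) \<star> cl_inv (f x)"
      using assms(3) by (intro cl_vec_Ad) auto
    then show "(\<chi> i. (f x \<star> cl_vec (g x) \<star> cl_inv (f x)) $ {i}) = Ad (f x) (g x)"
      by (simp add: vec_eq_iff cl_vec_nth flip: \<open>cl_vec _ = _\<close>)
  qed
qed

section \<open>The parity grading and graded central elements\<close>

lemma cl_vec_nth_eq_0: "(\<And>i. I \<noteq> {i}) \<Longrightarrow> cl_vec v $ I = 0"
  by (auto simp: cl_vec_def cl_gen_def axis_def intro!: sum.neutral)

lemma even_card_sym_diff_singleton:
  "even (card (sym_diff {i} I)) \<longleftrightarrow> odd (card (I :: 'i::finite set))"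
proof (cases "i \<in> I")
  case True
  then have "sym_diff {i} I = I - {i}"
    by auto
  with True show ?thesis
    using card_Suc_Diff1[OF finite True] by (metis even_Suc)
next
  case False
  then have "sym_diff {i} I = insert i I"
    by auto
  with False show ?thesis
    by simp
qed

text \<open>Multiplication by a vector exchanges the even and the odd part of the algebra. Hence the
  parity of the number of factors depends only on the product, which lets different factorizations
  of one element be compared.\<close>

lemma cl_vec_prod_parity:
  "cl_vec_prod vs $ I \<noteq> 0 \<Longrightarrow> even (card I) \<longleftrightarrow> even (length vs)"
proof (induction vs arbitrary: I)
  case Nil
  then show ?case
    by (auto simp: cl_one_def axis_def split: if_splits)
next
  case (Cons v vs)
  have "(\<Sum>J\<in>UNIV. cl_sign J (sym_diff J I) * cl_vec v $ J * cl_vec_prod vs $ sym_diff J I) \<noteq> 0"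
    using Cons.prems by (simp add: cl_mult_def)
  then obtain J where "cl_vec v $ J \<noteq> 0" and J: "cl_vec_prod vs $ sym_diff J I \<noteq> 0"
    by (metis (no_types, lifting) mult_zero_left mult_zero_right sum.neutral)
  then obtain i where "J = {i}"
    using cl_vec_nth_eq_0 by blast
  with Cons.IH[OF J] show ?case
    using even_card_sym_diff_singleton[of i I] by auto
qed

lemma cl_gen_mult_nth:
  fixes x :: "(real, 'i::{finite,linorder}) clifford"
  shows "(cl_gen i \<star> x) $ sym_diff {i} I = cl_sign {i} I * x $ I"
    "(x \<star> cl_gen i) $ sym_diff I {i} = cl_sign I {i} * x $ I"
proof -
  have sd: "sym_diff A (sym_diff A B) = B" "sym_diff A (sym_diff B A) = B" for A B C :: "'i set"
    by blast+
  have "(\<Sum>J\<in>UNIV. cl_sign J (sym_diff J (sym_diff {i} I)) * axis {i} 1 $ J * x $ sym_diff J (sym_diff {i} I))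
    = (\<Sum>J\<in>UNIV. if J = {i} then cl_sign {i} I * x $ I else 0)"
  proof (intro sum.cong refl)
    fix J
    show "cl_sign J (sym_diff J (sym_diff {i} I)) * axis {i} 1 $ J * x $ sym_diff J (sym_diff {i} I)
      = (if J = {i} then cl_sign {i} I * x $ I else 0)"
      by (cases "J = {i}") (simp_all only: sd, simp_all add: axis_def)
  qed
  then show "(cl_gen i \<star> x) $ sym_diff {i} I = cl_sign {i} I * x $ I"
    by (simp add: cl_mult_def cl_gen_def)
  have *: "sym_diff J (sym_diff I {i}) = {i} \<longleftrightarrow> J = I" for J
    by blast
  have "(\<Sum>J\<in>UNIV. cl_sign J (sym_diff J (sym_diff I {i})) * x $ J * axis {i} 1 $ sym_diff J (sym_diff I {i}))
    = (\<Sum>J\<in>UNIV. if J = I then cl_sign I {i} * x $ I else 0)"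
  proof (intro sum.cong refl)
    fix J
    show "cl_sign J (sym_diff J (sym_diff I {i})) * x $ J * axis {i} 1 $ sym_diff J (sym_diff I {i})
      = (if J = I then cl_sign I {i} * x $ I else 0)"
      using *[of J] by (cases "J = I") (simp_all only: sd, simp_all add: axis_def del: Un_Diff)
  qed
  then show "(x \<star> cl_gen i) $ sym_diff I {i} = cl_sign I {i} * x $ I"
    by (simp add: cl_mult_def cl_gen_def)
qed

text \<open>For \<open>j\<close> different from \<open>i\<close> exactly one of the two orders of
  the pair costs a sign, so each such \<open>j\<close> contributes -1, while \<open>j = i\<close>
  contributes the square of \<open>eta i\<close>, which is 1.\<close>

lemma cl_sign_singleton_swap:
  assumes "i \<in> I"
  shows "cl_sign I {i} * cl_sign {i} I = (- 1 :: real) ^ (card I - 1)"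
proof -
  have "cl_sign I {i} * cl_sign {i} I = (\<Prod>j\<in>I. cl_factor j i * cl_factor i j :: real)"
    by (simp add: cl_sign_def prod.distrib)
  also have "\<dots> = (\<Prod>j\<in>I. if j = i then 1 else - 1)"
    by (intro prod.cong) (auto simp: cl_factor_def eta_sq)
  also have "\<dots> = (\<Prod>j\<in>I - {i}. - 1)"
    using assms by (subst prod.remove[of _ i]) (auto intro: prod.cong)
  finally show ?thesis
    using assms by (simp add: card_Diff_singleton)
qed

lemma cl_sign_square: "cl_sign I J * cl_sign I J = (1::real)"
  unfolding cl_sign_def by (simp add: cl_factor_sq flip: prod.distrib)

text \<open>If \<open>i\<close> lies in \<open>I\<close>, then moving \<open>cl_gen i\<close> past
  the basis element of \<open>I\<close> costs the sign of \<open>card I - 1\<close>, while the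
  hypothesis demands the sign of \<open>card I\<close>. So every coefficient at a nonempty
  \<open>I\<close> vanishes.\<close>

lemma scalar_if_graded_central:
  fixes x :: "(real, 'i::{finite,linorder}) clifford"
  assumes comm: "\<And>i. x \<star> cl_gen i = s *\<^sub>R (cl_gen i \<star> x)"
    and parity: "\<And>I. x $ I \<noteq> 0 \<Longrightarrow> (- 1) ^ card I = s"
  shows "x = x $ {} *\<^sub>R cl_one"
proof -
  have "x $ I = 0" if "I \<noteq> {}" for I
  proof (rule ccontr)
    assume nz: "x $ I \<noteq> 0"
    obtain i where i: "i \<in> I"
      using \<open>I \<noteq> {}\<close> by blast
    have "sym_diff {i} I = sym_diff I {i}"
      by blast
    then have "cl_sign I {i} * x $ I = s * (cl_sign {i} I * x $ I)"
      using comm[of i] cl_gen_mult_nth[where i = i and I = I and x = x] by (metis vector_scaleR_component real_scaleR_def)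
    then have "cl_sign I {i} = s * cl_sign {i} I"
      using nz by simp
    then have "cl_sign I {i} * cl_sign {i} I = s"
      by (simp add: mult.assoc cl_sign_square)
    then have "(- 1) ^ (card I - 1) = ((- 1) ^ card I :: real)"
      using parity[OF nz] cl_sign_singleton_swap[OF i] by simp
    moreover have "card I > 0"
      using that by (simp add: card_gt_0_iff)
    ultimately show False
      by (cases "card I") auto
  qed
  then show ?thesis
    by (auto simp: vec_eq_iff cl_one_def axis_def)
qed

definition spatial_unit :: "'i::{finite,linorder} minkowski \<Rightarrow> bool" where
  "spatial_unit v \<longleftrightarrow> v $ last_ix = 0 \<and> lorentz_q v = 1"

text \<open>The argument of Cartan and Dieudonne, in the Pin group: reflecting in the difference
  of a basis vector and its image makes the basis vector fixed. The sign \<open>(- 1) ^ length vs\<close> turns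
  conjugation by a product of vectors into the product of the corresponding reflections.\<close>

lemma spatial_factorization:
  fixes vs :: "'i::{finite,linorder} minkowski list"
  assumes "CARD('i) \<ge> 2" "unit_vectors vs" "last_ix \<in> J"
    and "\<And>j. j \<in> J \<Longrightarrow> cl_vec_prod vs \<star> cl_gen j = (- 1) ^ length vs *\<^sub>R (cl_gen j \<star> cl_vec_prod vs)"
  shows "\<exists>us. (\<forall>u\<in>set us. spatial_unit u) \<and> cl_vec_prod us = cl_vec_prod vs"
  using assms(2-)
proof (induction "card (- J)" arbitrary: J vs rule: less_induct)
  case (less J vs)
  let ?x = "cl_vec_prod vs" and ?s = "(- 1) ^ length vs :: real"
  have x: "?x \<in> cl_units"
    using less.prems(1) by (auto simp: cl_units_def)
  have ss: "?s * ?s = 1"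
    by (metis minus_one_mult_self)
  show ?case
  proof (cases "J = UNIV")
    case True
    have par: "(- 1) ^ card I = ?s" if "?x $ I \<noteq> 0" for I
      using cl_vec_prod_parity[OF that] by (simp add: minus_one_power_iff)
    have "?x = ?x $ {} *\<^sub>R cl_one"
      using less.prems(3) True par by (intro scalar_if_graded_central) auto
    then obtain c where c: "?x = c *\<^sub>R cl_one"
      by blast
    then consider "?x = cl_one" | "?x = - cl_one"
      using cl_units_scalar[of c] x by fastforce
    then show ?thesis
    proof cases
      case 1
      then show ?thesis
        by (intro exI[of _ "[]"]) simp
    next
      case 2
      \<comment> \<open>The scalar -1 has to be written with spatial factors: it is the square of
        any spatial basis vector, and the assumption on the dimension supplies one.\<close>
      have "UNIV \<noteq> {last_ix :: 'i}"
        using assms(1) by (metis card_1_singleton_iff numeral_le_one_iff semiring_norm(69) One_nat_def)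
      then obtain i :: 'i where "i \<noteq> last_ix"
        by blast
      then have "spatial_unit (axis i 1)"
        by (simp add: spatial_unit_def lorentz_q_axis) (simp add: axis_def)
      with 2 \<open>i \<noteq> last_ix\<close> show ?thesis
        by (intro exI[of _ "[axis i 1, axis i 1]"]) (simp add: cl_vec_square lorentz_q_axis)
    qed
  next
    case False
    then obtain i where i: "i \<notin> J"
      by blast
    \<comment> \<open>\<open>w\<close> is the image of the \<open>i\<close>-th basis vector under
      the product of the reflections along \<open>vs\<close>. These reflections together fix the
      basis vectors indexed by \<open>J\<close>, so \<open>w\<close> is orthogonal to all of
      them.\<close>
    define w where "w = ?s *\<^sub>R Ad ?x (axis i 1)"
    have "cl_vec (Ad ?x (axis i 1)) \<star> ?x = ?x \<star> cl_gen i"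
      using x by (simp add: cl_vec_Ad cl_mult_assoc cl_units_inverse cl_vec_axis)
    then have wx: "cl_vec w \<star> ?x = ?s *\<^sub>R (?x \<star> cl_gen i)"
      by (simp add: w_def cl_vec_simps cl_mult.scaleR_left)
    then have xi: "?x \<star> cl_gen i = ?s *\<^sub>R (cl_vec w \<star> ?x)"
      by (simp add: ss)
    have fix_J: "Ad ?x (axis j 1) = ?s *\<^sub>R axis j 1" if "j \<in> J" for j
      using less.prems(3)[OF that] x
      by (intro Ad_eqI) (simp_all add: cl_vec_simps cl_vec_axis cl_mult.scaleR_left)
    have i_last: "i \<noteq> last_ix"
      using i less.prems(2) by blast
    have smaller: "card (- insert i J) < card (- J)"
      using i by (intro psubset_card_mono) auto
    have qw: "lorentz_q w = 1"
      using lorentz_q_Ad[OF x, of "axis i 1"] ss i_last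
      by (simp add: w_def lorentz_q_eq_b flip: mult.assoc)
    have wJ: "w $ j = 0" if "j \<in> J" for j
    proof -
      have "eta j * w $ j = lorentz_b w (axis j 1)"
        by simp
      also have "\<dots> = ?s * lorentz_b (Ad ?x (axis i 1)) (?s *\<^sub>R Ad ?x (axis j 1))"
        using ss by (simp add: w_def fix_J[OF that] flip: scaleR_scaleR mult.assoc)
      also have "\<dots> = 0"
        using that i by (simp add: lorentz_b_Ad[OF x]) (auto simp: axis_def)
      finally show ?thesis
        by (metis eta_sq mult_zero_right mult.assoc mult_1)
    qed
    show ?thesis
    proof (cases "w = axis i 1")
      case True
      show ?thesis
        by (rule less.hyps[OF smaller less.prems(1)])
          (use less.prems xi True in \<open>auto simp: cl_vec_axis\<close>)
    next
      case False
      \<comment> \<open>Since \<open>last_ix\<close> is in \<open>J\<close>, both \<open>w\<close>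
        and the basis vector have last coordinate 0. The form is Euclidean there, so the nonzero
        difference is not null and can be normalised. The reflection along \<open>u\<close> carries
        \<open>w\<close> back to the \<open>i\<close>-th basis vector and fixes those indexed by
        \<open>J\<close>, which enlarges \<open>J\<close> by \<open>i\<close>.\<close>
      define d where "d = w - axis i 1"
      define u where "u = (1 / norm d) *\<^sub>R d"
      have "d $ last_ix = 0"
        using wJ[OF less.prems(2)] i_last by (simp add: d_def axis_def)
      moreover have "norm d \<noteq> 0"
        using False by (simp add: d_def)
      ultimately have u: "spatial_unit u"
        by (simp add: spatial_unit_def u_def lorentz_q_eq_b lorentz_b_inner power2_norm_eq_inner[symmetric] power2_eq_square)
      have uJ: "cl_vec u \<star> cl_gen j = - (cl_gen j \<star> cl_vec u)" if "j \<in> J" for j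
        unfolding cl_vec_axis[symmetric] using that i wJ[OF that]
        by (intro cl_vec_anticommute_orthogonal) (simp add: u_def d_def, auto simp: axis_def)
      have dw: "cl_vec d \<star> cl_vec w = - (cl_gen i \<star> cl_vec d)"
        using i_last by (simp add: d_def cl_vec_simps cl_mult.diff_left cl_mult.diff_right cl_vec_square qw
            cl_vec_axis[symmetric] lorentz_q_axis)
      have uw: "cl_vec u \<star> cl_vec w = - (cl_gen i \<star> cl_vec u)"
        by (simp add: u_def cl_vec_simps cl_mult.scaleR_left cl_mult.scaleR_right dw)
      have "\<exists>us. (\<forall>u\<in>set us. spatial_unit u) \<and> cl_vec_prod us = cl_vec_prod (u # vs)"
      proof (rule less.hyps[OF smaller])
        show "unit_vectors (u # vs)"
          using u less.prems(1) by (simp add: spatial_unit_def)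
        show "last_ix \<in> insert i J"
          using less.prems(2) by blast
        fix j assume j: "j \<in> insert i J"
        have "cl_vec u \<star> (?x \<star> cl_gen j) = - ?s *\<^sub>R (cl_gen j \<star> (cl_vec u \<star> ?x))"
        proof (cases "j = i")
          case True
          then show ?thesis
            by (simp add: xi cl_mult.scaleR_right uw cl_mult.minus_left flip: cl_mult_assoc)
        next
          case False
          then have "j \<in> J"
            using j by blast
          then show ?thesis
            by (simp add: less.prems(3) cl_mult.scaleR_right uJ cl_mult.minus_left flip: cl_mult_assoc)
        qed
        then show "cl_vec_prod (u # vs) \<star> cl_gen j
          = (- 1) ^ length (u # vs) *\<^sub>R (cl_gen j \<star> cl_vec_prod (u # vs))"
          by (simp add: cl_mult_assoc)
      qed
      then obtain us where us: "\<forall>u\<in>set us. spatial_unit u" "cl_vec_prod us = cl_vec u \<star> ?x"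
        by auto
      \<comment> \<open>The vector \<open>u\<close> squares to -1 in the algebra, so a further
        factor \<open>- u\<close> cancels the reflection that was added.\<close>
      have "cl_vec_prod (- u # us) = - (cl_vec u \<star> cl_vec u) \<star> ?x"
        by (simp add: us cl_vec_simps cl_mult.minus_left cl_mult_assoc)
      also have "\<dots> = ?x"
        using u by (simp add: cl_vec_square spatial_unit_def)
      finally show ?thesis
        using us(1) u by (intro exI[of _ "- u # us"]) (auto simp: spatial_unit_def lorentz_q_eq_b)
    qed
  qed
qed

lemma spin_lorentz_units: "spin_lorentz \<subseteq> cl_units"
  by (auto simp: spin_lorentz_def cl_units_def unit_vectors_def)

text \<open>To fix \<open>e_last\<close> under conjugation is to commute with it, and for an even
  product this is the hypothesis of \<open>spatial_factorization\<close> with \<open>J\<close> the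
  singleton of \<open>last_ix\<close>.\<close>

lemma spin_lorentz_stabilizer:
  fixes x :: "(real, 'i::{finite,linorder}) clifford"
  assumes "CARD('i) \<ge> 2" "x \<in> spin_lorentz" "Ad x e_last = e_last"
  shows "x \<in> spin_n"
proof -
  obtain vs where vs: "x = cl_vec_prod vs" "even (length vs)" "unit_vectors vs"
    using assms(2) by (auto simp: spin_lorentz_def unit_vectors_def)
  have x: "x \<in> cl_units"
    using assms(2) spin_lorentz_units by blast
  have "x \<star> cl_gen last_ix = cl_gen last_ix \<star> x"
    using cl_vec_Ad[OF x, of e_last] assms(3) cl_units_inverse(2)[OF x]
    by (metis cl_mult_assoc cl_one_mult(2) cl_vec_axis)
  then obtain us where us: "\<forall>u\<in>set us. spatial_unit u" "cl_vec_prod us = x"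
    using spatial_factorization[OF assms(1) vs(3), of "{last_ix}"] vs by auto
  \<comment> \<open>The factorization does not tell how many factors \<open>us\<close> has. Any
    nonzero coefficient of \<open>x\<close> ties the parity of \<open>us\<close> to that of
    \<open>vs\<close>.\<close>
  have "x \<noteq> 0"
    using cl_units_inverse(1)[OF x] by (auto simp: cl_mult.zero_left)
  then obtain I where "x $ I \<noteq> 0"
    by (auto simp: vec_eq_iff)
  then have "even (length us)"
    using cl_vec_prod_parity[of us I] cl_vec_prod_parity[of vs I] vs us by simp
  with us show ?thesis
    by (auto simp: spin_n_def spatial_unit_def)
qed


section \<open>The groups and hyperbolic space\<close>

lemma connected_component_set_image:
  assumes "continuous_on S f" "f ` S \<subseteq> T" "x \<in> S"
  shows "f ` connected_component_set S x \<subseteq> connected_component_set T (f x)"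
proof (rule connected_component_maximal)
  show "f x \<in> f ` connected_component_set S x"
    using assms(3) by simp
  show "connected (f ` connected_component_set S x)"
    using assms(1) connected_component_subset continuous_on_subset
    by (blast intro: connected_continuous_image connected_connected_component)
  show "f ` connected_component_set S x \<subseteq> T"
    using assms(2) connected_component_subset by blast
qed

text \<open>Left translation by \<open>a\<close> carries the component of \<open>e\<close> into the
  component of \<open>f a e = a\<close>, which is again that of \<open>e\<close>. Stated for an
  abstract product, it serves both the spin group and the Lorentz group.\<close>

lemma connected_component_set_mult:
  assumes "\<And>a. a \<in> S \<Longrightarrow> continuous_on S (f a)" "\<And>a b. a \<in> S \<Longrightarrow> b \<in> S \<Longrightarrow> f a b \<in> S"
    and "\<And>a. a \<in> S \<Longrightarrow> f a e = a"
    and "a \<in> connected_component_set S e" "b \<in> connected_component_set S e"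
  shows "f a b \<in> connected_component_set S e"
proof -
  have a: "a \<in> S" and e: "e \<in> S"
    using assms(4) connected_component_in by fastforce+
  have "f a ` connected_component_set S e \<subseteq> connected_component_set S (f a e)"
    using assms(1,2) a e by (intro connected_component_set_image) auto
  also have "connected_component_set S (f a e) = connected_component_set S e"
    using assms(3)[OF a] assms(4) connected_component_eq by auto
  finally show ?thesis
    using assms(5) by blast
qed

lemma spin_lorentz_one: "cl_one \<in> spin_lorentz"
  unfolding spin_lorentz_def by (intro CollectI exI[of _ "[]"]) simp

lemma spin_lorentz_mult:
  assumes "x \<in> spin_lorentz" "y \<in> spin_lorentz"
  shows "x \<star> y \<in> spin_lorentz"
proof -
  obtain vs ws where "x = cl_vec_prod vs" "even (length vs)" "\<forall>v\<in>set vs. lorentz_q v = 1 \<or> lorentz_q v = - 1"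
    "y = cl_vec_prod ws" "even (length ws)" "\<forall>v\<in>set ws. lorentz_q v = 1 \<or> lorentz_q v = - 1"
    using assms by (auto simp: spin_lorentz_def)
  then show ?thesis
    unfolding spin_lorentz_def
    by (intro CollectI exI[of _ "vs @ ws"]) (auto simp: cl_list_prod_append)
qed

lemma spin_lorentz_inv:
  assumes "x \<in> spin_lorentz"
  shows "cl_inv x \<in> spin_lorentz"
proof -
  have *: "\<exists>ws. cl_inv (cl_vec_prod vs) = cl_vec_prod ws \<and> unit_vectors ws \<and> length ws = length vs"
    if "unit_vectors vs" for vs :: "'a minkowski list"
    using that
  proof (induction vs)
    case Nil
    then show ?case
      by (intro exI[of _ "[]"]) simp
  next
    case (Cons v vs)
    then obtain ws where ws: "cl_inv (cl_vec_prod vs) = cl_vec_prod ws" "unit_vectors ws" "length ws = length vs"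
      by auto
    have q: "lorentz_q v = 1 \<or> lorentz_q v = - 1"
      using Cons.prems by simp
    show ?case
    proof (intro exI conjI)
      have "cl_inv (cl_vec_prod (v # vs)) = cl_vec_prod ws \<star> cl_inv (cl_vec v)"
        using Cons.prems by (simp add: cl_inv_mult cl_vec_prod_Units cl_vec_Units(1) ws(1))
      then show "cl_inv (cl_vec_prod (v # vs)) = cl_vec_prod (ws @ [- lorentz_q v *\<^sub>R v])"
        by (simp add: cl_vec_Units(2)[OF q] cl_list_prod_append cl_vec_simps)
      show "unit_vectors (ws @ [- lorentz_q v *\<^sub>R v])"
        using q ws(2) by (auto simp: lorentz_q_eq_b)
    qed (simp add: ws)
  qed
  obtain vs where "x = cl_vec_prod vs" "even (length vs)" "unit_vectors vs"
    using assms by (auto simp: spin_lorentz_def unit_vectors_def)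
  then show ?thesis
    using *[of vs] unfolding spin_lorentz_def unit_vectors_def by auto
qed

lemma spin_plus_lorentz: "x \<in> spin_plus \<Longrightarrow> x \<in> spin_lorentz"
  using connected_component_subset unfolding spin_plus_def by blast

lemma spin_plus_units: "x \<in> spin_plus \<Longrightarrow> x \<in> cl_units"
  using spin_plus_lorentz spin_lorentz_units by blast

lemma spin_plus_one: "cl_one \<in> spin_plus"
  by (simp add: spin_plus_def spin_lorentz_one)

lemma spin_plus_mult: "x \<in> spin_plus \<Longrightarrow> y \<in> spin_plus \<Longrightarrow> x \<star> y \<in> spin_plus"
  unfolding spin_plus_def
  by (rule connected_component_set_mult[where f = "(\<star>)"])
    (auto intro!: continuous_intros spin_lorentz_mult)

lemma spin_plus_inv:
  assumes "x \<in> spin_plus"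
  shows "cl_inv x \<in> spin_plus"
proof -
  have "cl_inv ` connected_component_set spin_lorentz cl_one
    \<subseteq> connected_component_set (spin_lorentz :: (real, 'a) clifford set) (cl_inv cl_one)"
    by (rule connected_component_set_image)
      (auto intro: continuous_on_subset[OF continuous_on_cl_inv spin_lorentz_units]
        spin_lorentz_inv spin_lorentz_one)
  with assms show ?thesis
    by (auto simp: spin_plus_def)
qed

lemma spin_plusI:
  assumes "connected S" "S \<subseteq> spin_lorentz" "cl_one \<in> S" "x \<in> S"
  shows "x \<in> spin_plus"
  using assms connected_component_maximal unfolding spin_plus_def by blast

lemma spin_plus_group_simps [simp]:
  "carrier spin_plus_group = spin_plus" "mult spin_plus_group = (\<star>)" "one spin_plus_group = cl_one"
  by (simp_all add: spin_plus_group_def cl_monoid_def)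

lemma group_spin_plus: "group spin_plus_group"
proof (rule groupI)
  fix x :: "(real, 'a) clifford" assume "x \<in> carrier spin_plus_group"
  then show "\<exists>y\<in>carrier spin_plus_group. y \<otimes>\<^bsub>spin_plus_group\<^esub> x = \<one>\<^bsub>spin_plus_group\<^esub>"
    using spin_plus_inv cl_units_inverse(2)[OF spin_plus_units] by auto
qed (auto simp: spin_plus_one spin_plus_mult cl_mult_assoc)

lemma inv_spin_plus_group:
  assumes "x \<in> spin_plus"
  shows "inv\<^bsub>spin_plus_group\<^esub> x = cl_inv x"
  using group.inv_equality[OF group_spin_plus, of "cl_inv x" x] assms
    spin_plus_inv cl_units_inverse(2)[OF spin_plus_units] by auto


section \<open>The special Lorentz group\<close>

definition eta_matrix :: "'i::{finite,linorder} minkowski_mat" where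
  "eta_matrix = (\<chi> i j. if i = j then eta i else 0)"

lemma eta_matrix_vector: "eta_matrix *v x = (\<chi> i. eta i * x $ i)"
proof -
  have "(if i = j then eta i else 0) * x $ j = (if j = i then eta i * x $ i else 0)" for i j
    by simp
  then show ?thesis
    by (simp add: eta_matrix_def matrix_vector_mult_def)
qed

lemma lorentz_b_eq_inner: "lorentz_b v w = v \<bullet> (eta_matrix *v w)"
  by (simp add: lorentz_b_def eta_matrix_vector inner_vec_def mult_ac)

lemma eta_matrix_square: "eta_matrix ** eta_matrix = mat 1"
  by (simp add: matrix_eq eta_matrix_vector vec_eq_iff eta_sq flip: matrix_vector_mul_assoc mult.assoc)

text \<open>The adjoint with respect to the Lorentz form, hence the inverse of a Lorentz isometry.
  Being a formula on all matrices, it is continuous everywhere, which is used both for the identity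
  component and on closures of sets of isometries.\<close>

definition lorentz_adjoint :: "'i::{finite,linorder} minkowski_mat \<Rightarrow> 'i minkowski_mat" where
  "lorentz_adjoint A = eta_matrix ** transpose A ** eta_matrix"

lemma lorentz_isometry_b:
  assumes "\<forall>x. lorentz_q (A *v x) = lorentz_q x"
  shows "lorentz_b (A *v v) (A *v w) = lorentz_b v w"
  using assms[rule_format, of "v + w"] assms[rule_format, of v] assms[rule_format, of w]
  by (simp add: lorentz_q_eq_b matrix_vector_right_distrib
      lorentz_b_commute[of "A *v w" "A *v v"] lorentz_b_commute[of w v])

lemma lorentz_adjoint_inverse:
  assumes "\<forall>x. lorentz_q (A *v x) = lorentz_q x"
  shows "lorentz_adjoint A ** A = mat 1" "A ** lorentz_adjoint A = mat 1"
proof -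
  have "v \<bullet> (transpose A *v (eta_matrix *v (A *v w))) = v \<bullet> (eta_matrix *v w)" for v w
    using lorentz_isometry_b[OF assms, of v w] unfolding lorentz_b_eq_inner
    by (metis dot_lmul_matrix inner_commute transpose_matrix_vector)
  then have "transpose A *v (eta_matrix *v (A *v w)) = eta_matrix *v w" for w
    using vector_eq_ldot by blast
  then have "lorentz_adjoint A *v (A *v w) = w" for w
    by (simp add: lorentz_adjoint_def eta_matrix_square flip: matrix_vector_mul_assoc)
      (simp add: matrix_vector_mul_assoc eta_matrix_square)
  then show "lorentz_adjoint A ** A = mat 1"
    by (simp add: matrix_eq flip: matrix_vector_mul_assoc)
  then show "A ** lorentz_adjoint A = mat 1"
    using matrix_left_right_inverse by blast
qed

lemma SO_lorentz_isometry: "A \<in> SO_lorentz \<Longrightarrow> \<forall>x. lorentz_q (A *v x) = lorentz_q x"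
  by (simp add: SO_lorentz_def)

lemma SO_lorentz_one: "mat 1 \<in> SO_lorentz"
  by (simp add: SO_lorentz_def)

lemma SO_lorentz_mult: "A \<in> SO_lorentz \<Longrightarrow> B \<in> SO_lorentz \<Longrightarrow> A ** B \<in> SO_lorentz"
  by (simp add: SO_lorentz_def det_mul flip: matrix_vector_mul_assoc)

lemma SO_lorentz_adjoint:
  assumes "A \<in> SO_lorentz"
  shows "lorentz_adjoint A \<in> SO_lorentz"
proof -
  note inv = lorentz_adjoint_inverse[OF SO_lorentz_isometry[OF assms]]
  have "lorentz_q (lorentz_adjoint A *v x) = lorentz_q x" for x
    using SO_lorentz_isometry[OF assms, rule_format, of "lorentz_adjoint A *v x"]
    by (simp add: matrix_vector_mul_assoc inv)
  moreover have "det A * det (lorentz_adjoint A) = 1"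
    by (simp add: inv flip: det_mul)
  ultimately show ?thesis
    using assms by (simp add: SO_lorentz_def)
qed

lemma continuous_on_matrix_mult [continuous_intros]:
  fixes f :: "'a::topological_space \<Rightarrow> real ^ 'n::finite ^ 'm::finite" and g :: "'a \<Rightarrow> real ^ 'p::finite ^ 'n"
  assumes "continuous_on S f" "continuous_on S g"
  shows "continuous_on S (\<lambda>x. f x ** g x)"
  unfolding matrix_matrix_mult_def by (intro continuous_intros assms)

lemma continuous_on_lorentz_adjoint: "continuous_on S lorentz_adjoint"
  unfolding lorentz_adjoint_def transpose_def by (intro continuous_intros)

lemma SO_plus_lorentz: "A \<in> SO_plus \<Longrightarrow> A \<in> SO_lorentz"
  using connected_component_subset unfolding SO_plus_def by blast

lemma SO_plus_one: "mat 1 \<in> SO_plus"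
  by (simp add: SO_plus_def SO_lorentz_one)

lemma SO_plus_mult: "A \<in> SO_plus \<Longrightarrow> B \<in> SO_plus \<Longrightarrow> A ** B \<in> SO_plus"
  unfolding SO_plus_def
  by (rule connected_component_set_mult[where f = "(**)"])
    (auto intro!: continuous_intros SO_lorentz_mult)

lemma SO_plus_adjoint:
  assumes "A \<in> SO_plus"
  shows "lorentz_adjoint A \<in> SO_plus"
proof -
  have "lorentz_adjoint ` connected_component_set SO_lorentz (mat 1)
    \<subseteq> connected_component_set (SO_lorentz :: 'a minkowski_mat set) (lorentz_adjoint (mat 1))"
    by (rule connected_component_set_image)
      (auto intro: continuous_on_lorentz_adjoint SO_lorentz_adjoint SO_lorentz_one)
  moreover have "lorentz_adjoint (mat 1) = (mat 1 :: 'a minkowski_mat)"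
    by (simp add: lorentz_adjoint_def transpose_mat eta_matrix_square)
  ultimately show ?thesis
    using assms by (auto simp: SO_plus_def)
qed

lemma SO_plus_group_simps [simp]:
  "carrier SO_plus_group = SO_plus" "mult SO_plus_group = (**)" "one SO_plus_group = mat 1"
  by (simp_all add: SO_plus_group_def)

lemma group_SO_plus: "group SO_plus_group"
proof (rule groupI)
  fix A :: "'a minkowski_mat" assume "A \<in> carrier SO_plus_group"
  then show "\<exists>B\<in>carrier SO_plus_group. B \<otimes>\<^bsub>SO_plus_group\<^esub> A = \<one>\<^bsub>SO_plus_group\<^esub>"
    using SO_plus_adjoint lorentz_adjoint_inverse(1)[OF SO_lorentz_isometry[OF SO_plus_lorentz]] by auto
qed (auto simp: SO_plus_one SO_plus_mult matrix_mul_assoc)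

lemma inv_SO_plus_group:
  assumes "A \<in> SO_plus"
  shows "inv\<^bsub>SO_plus_group\<^esub> A = lorentz_adjoint A"
  using group.inv_equality[OF group_SO_plus, of "lorentz_adjoint A" A] assms
    SO_plus_adjoint lorentz_adjoint_inverse(1)[OF SO_lorentz_isometry[OF SO_plus_lorentz]] by auto


section \<open>Hyperbolic space and boosts\<close>

lemma hyperbolic_space_iff:
  "x \<in> hyperbolic_space \<longleftrightarrow> lorentz_b x x = - 1 \<and> x $ last_ix > 0"
  by (simp add: hyperbolic_space_def lorentz_q_eq_b)

lemma e_last_hyperbolic: "e_last \<in> hyperbolic_space"
  by (simp add: hyperbolic_space_iff)

text \<open>The upper sheet is the graph of \<open>sqrt (1 + x \<bullet> x)\<close> over the
  hyperplane of vectors with last coordinate 0, so it is a continuous image of a convex set.\<close>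

lemma connected_hyperbolic_space: "connected (hyperbolic_space :: 'i::{finite,linorder} minkowski set)"
proof -
  let ?W = "{x :: 'i minkowski. e_last \<bullet> x = 0}"
  let ?f = "\<lambda>x :: 'i minkowski. x + sqrt (1 + x \<bullet> x) *\<^sub>R e_last"
  have W: "x \<in> ?W \<longleftrightarrow> x $ last_ix = 0" for x
    by (simp add: inner_axis')
  have "connected (?f ` ?W)"
    by (intro connected_continuous_image continuous_intros convex_connected convex_hyperplane)
  also have "?f ` ?W = hyperbolic_space"
  proof (intro equalityI subsetI)
    fix y assume "y \<in> ?f ` ?W"
    then obtain x where x: "x $ last_ix = 0" and y: "y = ?f x"
      using W by blast
    have pos: "1 + x \<bullet> x > 0"
      using inner_ge_zero[of x] by linarith
    then have "sqrt (1 + x \<bullet> x) * sqrt (1 + x \<bullet> x) = 1 + x \<bullet> x"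
      by simp
    moreover have "lorentz_b x x = x \<bullet> x"
      using x by (simp add: lorentz_b_inner)
    ultimately show "y \<in> hyperbolic_space"
      using x pos by (simp add: y hyperbolic_space_iff)
  next
    fix y :: "'i minkowski" assume y: "y \<in> hyperbolic_space"
    let ?x = "y - y $ last_ix *\<^sub>R e_last"
    have "?x \<bullet> ?x = lorentz_b ?x ?x"
      by (simp only: lorentz_b_inner) simp
    also have "\<dots> = - 1 + (y $ last_ix)\<^sup>2"
      using y by (simp add: hyperbolic_space_iff power2_eq_square)
    finally have "sqrt (1 + ?x \<bullet> ?x) = y $ last_ix"
      using y by (simp add: hyperbolic_space_iff)
    then have "y = ?f ?x"
      by simp
    moreover have "?x \<in> ?W"
      by (simp only: W) simp
    ultimately show "y \<in> ?f ` ?W"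
      by blast
  qed
  finally show ?thesis .
qed

text \<open>The form takes the value \<open>- (2 + 2 * x $ last_ix)\<close> on
  \<open>x + e_last\<close> for \<open>x\<close> in hyperbolic space, so the factor in front
  normalises that timelike vector to -1.\<close>

definition boost_axis :: "'i::{finite,linorder} minkowski \<Rightarrow> 'i minkowski" where
  "boost_axis x = (1 / sqrt (2 + 2 * x $ last_ix)) *\<^sub>R (x + e_last)"

text \<open>The boost taking \<open>e_last\<close> to \<open>x\<close>, as the product of the reflections in \<open>e_last\<close> and
  in the midpoint of \<open>e_last\<close> and \<open>x\<close>.\<close>

definition boost :: "'i::{finite,linorder} minkowski \<Rightarrow> (real, 'i) clifford" where
  "boost x = cl_vec (boost_axis x) \<star> cl_vec e_last"

lemma lorentz_q_boost_axis:
  assumes "x \<in> hyperbolic_space"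
  shows "lorentz_q (boost_axis x) = - 1"
proof -
  have "lorentz_b (x + e_last) (x + e_last) = - (2 + 2 * x $ last_ix)"
    using assms by (simp add: hyperbolic_space_iff)
  then show ?thesis
    using assms unfolding lorentz_q_eq_b boost_axis_def lorentz_b_linear(7,8)
    by (simp add: hyperbolic_space_iff field_simps)
qed

lemma boost_lorentz:
  assumes "x \<in> hyperbolic_space"
  shows "boost x \<in> spin_lorentz"
  unfolding spin_lorentz_def using lorentz_q_boost_axis[OF assms]
  by (intro CollectI exI[of _ "[boost_axis x, e_last]"]) (simp add: boost_def lorentz_q_axis)

lemma continuous_on_boost: "continuous_on hyperbolic_space boost"
  unfolding boost_def boost_axis_def
  by (intro continuous_intros) (auto simp: hyperbolic_space_def)

text \<open>Boosts depend continuously on a point of the connected space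
  \<open>hyperbolic_space\<close>, and the boost at \<open>e_last\<close> is
  \<open>cl_one\<close>.\<close>

lemma boost_spin_plus:
  assumes "x \<in> hyperbolic_space"
  shows "boost x \<in> spin_plus"
proof (rule spin_plusI)
  show "connected (boost ` (hyperbolic_space :: 'a minkowski set))"
    using connected_continuous_image continuous_on_boost connected_hyperbolic_space .
  show "boost ` (hyperbolic_space :: 'a minkowski set) \<subseteq> spin_lorentz"
    using boost_lorentz by blast
  have "boost_axis e_last = (e_last :: 'a minkowski)"
    by (simp add: boost_axis_def flip: scaleR_2)
  then have "boost e_last = (cl_one :: (real, 'a) clifford)"
    by (simp add: boost_def cl_vec_square lorentz_q_axis)
  then show "cl_one \<in> boost ` (hyperbolic_space :: 'a minkowski set)"
    using e_last_hyperbolic by (metis image_eqI)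
qed (use assms in blast)

text \<open>Both \<open>x\<close> and \<open>e_last\<close> square to 1 in the algebra, so
  multiplying \<open>x + e_last\<close> by \<open>x\<close> on the left equals multiplying it by
  \<open>e_last\<close> on the right. The normalising factor and the second factor of the boost are
  then carried along.\<close>

lemma Ad_boost:
  assumes "x \<in> hyperbolic_space"
  shows "Ad (boost x) e_last = x"
proof (rule Ad_eqI)
  show "boost x \<in> cl_units"
    using boost_spin_plus[OF assms] spin_plus_units by blast
  have "cl_vec x \<star> cl_vec (x + e_last) = cl_vec (x + e_last) \<star> cl_vec e_last"
    using assms by (simp add: cl_vec_simps cl_mult.add_left cl_mult.add_right cl_vec_square
        lorentz_q_axis hyperbolic_space_def)
  then have "cl_vec x \<star> cl_vec (boost_axis x) = cl_vec (boost_axis x) \<star> cl_vec e_last"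
    by (simp only: boost_axis_def cl_vec_simps(4) cl_mult.scaleR_left cl_mult.scaleR_right)
  then show "cl_vec x \<star> boost x = boost x \<star> cl_vec e_last"
    by (simp add: boost_def flip: cl_mult_assoc)
qed

text \<open>Only the sign of the last coordinate is at stake. It varies continuously over the
  connected set \<open>spin_plus\<close>, is positive at \<open>cl_one\<close>, and never vanishes,
  because the form cannot be -1 on a vector with last coordinate 0.\<close>

lemma Ad_hyperbolic:
  assumes "g \<in> spin_plus" "x \<in> hyperbolic_space"
  shows "Ad g x \<in> hyperbolic_space"
proof -
  have q: "lorentz_b (Ad h x) (Ad h x) = - 1" if "h \<in> spin_plus" for h
    using assms(2) lorentz_b_Ad[OF spin_plus_units[OF that]] by (simp add: hyperbolic_space_iff)
  have nz: "Ad h x $ last_ix \<noteq> 0" if "h \<in> spin_plus" for h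
    using q[OF that] by (auto simp: lorentz_b_inner) (smt (verit) inner_ge_zero)
  let ?S = "(\<lambda>h. Ad h x $ last_ix) ` spin_plus"
  have "continuous_on spin_plus (\<lambda>h. Ad h x $ last_ix)"
    using spin_plus_units by (intro continuous_intros) auto
  then have conn: "connected ?S"
    by (intro connected_continuous_image) (simp_all add: spin_plus_def)
  have one: "x $ last_ix \<in> ?S"
    using spin_plus_one by (intro image_eqI[of _ _ cl_one]) simp_all
  have "Ad g x $ last_ix > 0"
  proof (rule ccontr)
    assume "\<not> ?thesis"
    then have "0 \<in> ?S"
      using connectedD_interval[OF conn _ one, of "Ad g x $ last_ix" 0] assms
      by (auto simp: hyperbolic_space_def)
    then show False
      using nz by auto
  qed
  then show ?thesis
    using q[OF assms(1)] by (simp add: hyperbolic_space_iff)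
qed

section \<open>Spin(n) as the stabilizer of the last basis vector in the identity component\<close>

lemma spatial_unit_iff: "spatial_unit v \<longleftrightarrow> v $ last_ix = 0 \<and> norm v = 1"
  by (auto simp: spatial_unit_def lorentz_q_eq_b lorentz_b_inner norm_eq_1)

text \<open>This is the sphere S^(n-1), obtained by radial projection of a punctured hyperplane of
  dimension n. Puncturing disconnects a line, so n >= 2 is required, that is, at least three
  indices.\<close>

lemma connected_spatial_units:
  assumes "CARD('i::{finite,linorder}) \<ge> 3"
  shows "connected {v :: 'i minkowski. spatial_unit v}"
proof -
  let ?W = "{x :: 'i minkowski. e_last \<bullet> x = 0}"
  have W: "x \<in> ?W \<longleftrightarrow> x $ last_ix = 0" for x
    by (simp add: inner_axis')
  have "aff_dim ?W = int (dim ?W)"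
    by (rule aff_dim_subspace) (rule subspace_hyperplane)
  also have "dim ?W = CARD('i) - 1"
    using dim_hyperplane[of "e_last :: 'i minkowski"] by simp
  finally have "aff_dim ?W \<noteq> 1"
    using assms by simp
  then have "connected (?W - {0})"
    by (intro connected_punctured_convex convex_hyperplane)
  then have "connected ((\<lambda>x. (1 / norm x) *\<^sub>R x) ` (?W - {0}))"
    by (intro connected_continuous_image continuous_intros) auto
  also have "(\<lambda>x. (1 / norm x) *\<^sub>R x) ` (?W - {0}) = {v. spatial_unit v}"
  proof (intro equalityI subsetI)
    fix v :: "'i minkowski" assume "v \<in> {v. spatial_unit v}"
    then show "v \<in> (\<lambda>x. (1 / norm x) *\<^sub>R x) ` (?W - {0})"
      by (intro image_eqI[of _ _ v]) (auto simp: spatial_unit_iff inner_axis')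
  qed (auto simp: spatial_unit_iff inner_axis')
  finally show ?thesis .
qed

text \<open>The products of two spatial unit vectors form a connected set, the image of a product of
  two spheres, and the pair \<open>(- u, u)\<close> shows that this set contains
  \<open>cl_one\<close>.\<close>

lemma spatial_unit_mult_spin_plus:
  fixes u v :: "'i::{finite,linorder} minkowski"
  assumes "CARD('i) \<ge> 3" "spatial_unit u" "spatial_unit v"
  shows "cl_vec u \<star> cl_vec v \<in> spin_plus"
proof (rule spin_plusI)
  let ?S = "{v :: 'i minkowski. spatial_unit v}"
  let ?f = "\<lambda>(u, v :: 'i minkowski). cl_vec u \<star> cl_vec v"
  show "connected (?f ` (?S \<times> ?S))"
    unfolding case_prod_unfold
    by (intro connected_continuous_image continuous_intros connected_Times connected_spatial_units assms(1))
  have "cl_vec u \<star> cl_vec v \<in> spin_lorentz" if "spatial_unit u" "spatial_unit v" for u v :: "'i minkowski"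
    unfolding spin_lorentz_def using that
    by (intro CollectI exI[of _ "[u, v]"]) (simp add: spatial_unit_def)
  then show "?f ` (?S \<times> ?S) \<subseteq> spin_lorentz"
    by auto
  have "?f (- u, u) = cl_one"
    using assms(2) by (simp add: cl_vec_simps cl_mult.minus_left cl_vec_square spatial_unit_def)
  moreover have "spatial_unit (- u)"
    using assms(2) by (simp add: spatial_unit_iff)
  ultimately show "cl_one \<in> ?f ` (?S \<times> ?S)"
    using assms(2) by (metis (mono_tags, lifting) SigmaI image_eqI mem_Collect_eq)
qed (use assms in force)

lemma spin_n_spin_plus:
  assumes "CARD('i::{finite,linorder}) \<ge> 3"
  shows "(spin_n :: (real, 'i) clifford set) \<subseteq> spin_plus"
proof -
  have "cl_vec_prod vs \<in> spin_plus"
    if "even (length vs)" "\<forall>v\<in>set vs. spatial_unit v" for vs :: "'i minkowski list"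
    using that
  proof (induction vs rule: induct_list012)
    case (3 u v vs)
    then show ?case
      using spin_plus_mult[OF spatial_unit_mult_spin_plus[OF assms, of u v], of "cl_vec_prod vs"]
      by (simp add: cl_mult_assoc)
  qed (auto simp: spin_plus_one)
  then show ?thesis
    unfolding spin_n_def spatial_unit_def by blast
qed

lemma spatial_commute_e_last:
  "\<forall>v\<in>set vs. spatial_unit v \<Longrightarrow>
    cl_vec e_last \<star> cl_vec_prod vs = (- 1) ^ length vs *\<^sub>R (cl_vec_prod vs \<star> cl_vec e_last)"
proof (induction vs)
  case (Cons v vs)
  have "cl_vec e_last \<star> cl_vec v = - (cl_vec v \<star> cl_vec e_last)"
    using Cons.prems by (intro cl_vec_anticommute_orthogonal) (simp add: spatial_unit_def)
  then have "cl_vec e_last \<star> cl_vec_prod (v # vs) = - (cl_vec v \<star> (cl_vec e_last \<star> cl_vec_prod vs))"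
    by (simp add: cl_mult.minus_left flip: cl_mult_assoc)
  then show ?case
    using Cons by (simp add: cl_mult.scaleR_right cl_mult_assoc)
qed simp

text \<open>Spatial vectors anticommute with \<open>e_last\<close>, so even products of them commute
  with it; the converse is \<open>spin_lorentz_stabilizer\<close>.\<close>

lemma spin_n_eq_stabilizer:
  assumes "CARD('i::{finite,linorder}) \<ge> 3"
  shows "spin_n = {g :: (real, 'i) clifford. g \<in> spin_plus \<and> Ad g e_last = e_last}"
proof (intro equalityI subsetI)
  fix g :: "(real, 'i) clifford" assume g: "g \<in> spin_n"
  then obtain vs where vs: "g = cl_vec_prod vs" "even (length vs)" "\<forall>v\<in>set vs. spatial_unit v"
    by (auto simp: spin_n_def spatial_unit_def)
  have gp: "g \<in> spin_plus"
    using g spin_n_spin_plus[OF assms] by blast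
  have "Ad g e_last = e_last"
    using spatial_commute_e_last[OF vs(3)] vs(2)
    by (intro Ad_eqI spin_plus_units gp) (simp add: vs(1))
  with gp show "g \<in> {g. g \<in> spin_plus \<and> Ad g e_last = e_last}"
    by simp
next
  fix g :: "(real, 'i) clifford" assume "g \<in> {g. g \<in> spin_plus \<and> Ad g e_last = e_last}"
  then show "g \<in> spin_n"
    using assms by (intro spin_lorentz_stabilizer spin_plus_lorentz) auto
qed


section \<open>Discontinuous action and spin representation\<close>

lemma lorentz_adjoint_isometry:
  assumes "\<forall>x. lorentz_q (A *v x) = lorentz_q x"
  shows "lorentz_q (lorentz_adjoint A *v x) = lorentz_q x"
  using assms[rule_format, of "lorentz_adjoint A *v x"]
  by (simp add: matrix_vector_mul_assoc lorentz_adjoint_inverse[OF assms])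

lemma matrix_vector_axis_nth: "(A *v axis j 1) $ i = (A $ i $ j :: real)"
  by (simp add: matrix_vector_mul_component inner_axis)

lemma inner_self_eq_lorentz: "v \<bullet> v = lorentz_q v + 2 * (v $ last_ix)\<^sup>2"
  by (simp add: lorentz_q_eq_b lorentz_b_inner power2_eq_square)

text \<open>The Euclidean square norm of column \<open>j\<close> differs from twice the square of
  its last entry by at most 1, because the column has the same Lorentz square as a basis vector. So
  the columns are bounded by the last row, and the last row by its diagonal entry through the
  inverse matrix.\<close>

lemma lorentz_isometry_entry_bound:
  fixes A :: "'i::{finite,linorder} minkowski_mat"
  assumes "\<forall>x. lorentz_q (A *v x) = lorentz_q x"
  shows "\<bar>A $ i $ j\<bar> \<le> 1 + 2 * \<bar>A $ last_ix $ last_ix\<bar>"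
proof -
  let ?a = "A $ last_ix $ last_ix"
  have comp: "(u $ k)\<^sup>2 \<le> u \<bullet> u" for u :: "'i minkowski" and k
    unfolding inner_vec_def power2_eq_square inner_real_def by (rule member_le_sum) auto
  \<comment> \<open>Up to signs the last column of the inverse is the last row of \<open>A\<close>,
    so the estimate for columns also controls that row.\<close>
  have adj: "lorentz_adjoint A $ k $ last_ix = - (eta k * A $ last_ix $ k)" for k
  proof -
    have "lorentz_adjoint A $ k $ last_ix = (lorentz_adjoint A *v e_last) $ k"
      by (simp add: matrix_vector_axis_nth)
    also have "lorentz_adjoint A *v e_last = eta_matrix *v (transpose A *v - e_last)"
    proof -
      have "eta_matrix *v e_last = (- e_last :: 'i minkowski)"
        by (auto simp: eta_matrix_vector vec_eq_iff) (auto simp: axis_def)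
      then show ?thesis
        by (simp add: lorentz_adjoint_def flip: matrix_vector_mul_assoc)
    qed
    also have "\<dots> $ k = - (eta k * A $ last_ix $ k)"
      by (simp add: eta_matrix_vector matrix_vector_axis_nth transpose_def linear_neg[OF matrix_vector_mul_linear])
    finally show ?thesis .
  qed
  have eta2: "(eta k :: real)\<^sup>2 = 1" for k :: 'i
    by (simp add: power2_eq_square eta_sq)
  have row: "(A $ last_ix $ j)\<^sup>2 \<le> 2 * ?a\<^sup>2"
  proof -
    let ?u = "lorentz_adjoint A *v e_last"
    have "(A $ last_ix $ j)\<^sup>2 = (?u $ j)\<^sup>2"
      by (simp add: matrix_vector_axis_nth adj power_mult_distrib eta2)
    also have "\<dots> \<le> ?u \<bullet> ?u"
      by (rule comp)
    also have "\<dots> = - 1 + 2 * ?a\<^sup>2"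
      by (simp add: inner_self_eq_lorentz lorentz_adjoint_isometry[OF assms] lorentz_q_axis
          matrix_vector_axis_nth adj power_mult_distrib eta2)
    finally show ?thesis
      by simp
  qed
  let ?v = "A *v axis j 1"
  have "(A $ i $ j)\<^sup>2 \<le> ?v \<bullet> ?v"
    using comp[of ?v i] by (simp add: matrix_vector_axis_nth)
  also have "\<dots> = eta j + 2 * (A $ last_ix $ j)\<^sup>2"
    by (simp add: inner_self_eq_lorentz assms lorentz_q_axis matrix_vector_axis_nth)
  also have "\<dots> \<le> 1 + 4 * ?a\<^sup>2"
    using row by (simp add: eta_def)
  also have "\<dots> \<le> (1 + 2 * \<bar>?a\<bar>)\<^sup>2"
    by (simp add: power2_sum power_mult_distrib)
  finally show ?thesis
    by (simp add: abs_le_square_iff[symmetric])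
qed

lemma matrix_norm_le:
  fixes A :: "real ^ 'n::finite ^ 'm::finite"
  assumes "\<And>i j. \<bar>A $ i $ j\<bar> \<le> c"
  shows "norm A \<le> real CARD('m) * (real CARD('n) * c)"
proof -
  have "norm A \<le> (\<Sum>i\<in>UNIV. norm (A $ i))"
    unfolding norm_vec_def by (rule L2_set_le_sum) simp
  also have "\<dots> \<le> (\<Sum>i\<in>(UNIV :: 'm set). real CARD('n) * c)"
  proof (rule sum_mono)
    fix i
    have "norm (A $ i) \<le> (\<Sum>j\<in>UNIV. \<bar>A $ i $ j\<bar>)"
      by (rule norm_le_l1_cart)
    also have "\<dots> \<le> (\<Sum>j\<in>(UNIV :: 'n set). c)"
      by (rule sum_mono) (rule assms)
    finally show "norm (A $ i) \<le> real CARD('n) * c"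
      by simp
  qed
  finally show ?thesis
    by simp
qed

text \<open>The combination \<open>r\<^sub>n\<^sub>+\<^sub>1 p - p\<^sub>n\<^sub>+\<^sub>1 r\<close> is orthogonal to \<open>e_last\<close>, hence spacelike.\<close>

lemma hyperbolic_last_bound:
  assumes "p \<in> hyperbolic_space" "r \<in> hyperbolic_space"
  shows "r $ last_ix \<le> 2 * p $ last_ix * (- lorentz_b p r)"
proof -
  let ?p = "p $ last_ix" and ?r = "r $ last_ix"
  let ?z = "?r *\<^sub>R p - ?p *\<^sub>R r"
  have pos: "?p > 0" "?r > 0" and q: "lorentz_b p p = - 1" "lorentz_b r r = - 1"
    using assms by (auto simp: hyperbolic_space_iff)
  have "lorentz_b ?z ?z = ?z \<bullet> ?z"
    by (simp only: lorentz_b_inner) simp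
  then have "0 \<le> lorentz_b ?z ?z"
    by simp
  also have "lorentz_b ?z ?z = - ?r * ?r - ?p * ?p - 2 * ?r * ?p * lorentz_b p r"
    using q by (simp add: lorentz_b_commute[of r p] algebra_simps)
  finally have "?r * ?r \<le> ?r * (2 * ?p * (- lorentz_b p r))"
    using mult_pos_pos[OF pos(1) pos(1)] by (simp add: algebra_simps)
  then show ?thesis
    using pos mult_le_cancel_left_pos by blast
qed

text \<open>Proper discontinuity in the form needed later. The matrices in question have bounded
  entries, and a bounded set of elements of a discrete subgroup is uniformly discrete, hence
  finite.\<close>

lemma finite_discrete_subgroup_bounded_orbit:
  fixes \<Gamma> :: "'i::{finite,linorder} minkowski_mat set"
  assumes sub: "subgroup \<Gamma> SO_plus_group" and disc: "discrete \<Gamma>"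
    and H: "\<And>A x. A \<in> \<Gamma> \<Longrightarrow> x \<in> hyperbolic_space \<Longrightarrow> A *v x \<in> hyperbolic_space"
  shows "finite {A \<in> \<Gamma>. \<exists>y\<in>hyperbolic_space. y $ last_ix \<le> R \<and> (A *v y) $ last_ix \<le> R}" (is "finite ?F")
proof -
  have lorentz: "A \<in> SO_lorentz" if "A \<in> \<Gamma>" for A
    using that subgroup.subset[OF sub] SO_plus_lorentz by auto
  \<comment> \<open>The last diagonal entry of \<open>A\<close> is the last coordinate of
    \<open>A *v e_last\<close>. Comparing this point with \<open>A *v y\<close>, whose Lorentz
    product with it is \<open>- y $ last_ix\<close>, bounds the entry by \<open>2 * R * R\<close>;
    the general entry bound gives the rest of the constant.\<close>
  have entry: "\<bar>A $ i $ j\<bar> \<le> 1 + 2 * (2 * R * R)" if A: "A \<in> ?F" for A i j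
  proof -
    obtain y where y: "y \<in> hyperbolic_space" "y $ last_ix \<le> R" "(A *v y) $ last_ix \<le> R"
      using A by blast
    have iso: "\<forall>x. lorentz_q (A *v x) = lorentz_q x"
      using A lorentz SO_lorentz_isometry by blast
    have Ay: "A *v y \<in> hyperbolic_space" and Ae: "A *v e_last \<in> hyperbolic_space"
      using H A y(1) e_last_hyperbolic by blast+
    have "(A *v e_last) $ last_ix \<le> 2 * (A *v y) $ last_ix * (- lorentz_b (A *v y) (A *v e_last))"
      by (rule hyperbolic_last_bound[OF Ay Ae])
    also have "- lorentz_b (A *v y) (A *v e_last) = y $ last_ix"
      by (simp add: lorentz_isometry_b[OF iso])
    also have "2 * (A *v y) $ last_ix * y $ last_ix \<le> 2 * R * R"
      using y Ay by (intro mult_mono) (auto simp: hyperbolic_space_def)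
    finally have "\<bar>A $ last_ix $ last_ix\<bar> \<le> 2 * R * R"
      using Ae by (simp add: hyperbolic_space_def matrix_vector_axis_nth)
    then show ?thesis
      using lorentz_isometry_entry_bound[OF iso, of i j] by linarith
  qed
  have "bounded ?F"
    using matrix_norm_le[OF entry] by (auto simp: bounded_iff)
  \<comment> \<open>Discreteness gives each element its own isolating radius. Uniform continuity of
    the map sending \<open>(A, B)\<close> to the product of the inverse of \<open>A\<close> with
    \<open>B\<close>, on a compact set, turns the radius \<open>e\<close> at the identity into one
    separation \<open>d\<close> for all pairs.\<close>
  define K where "K = closure ?F \<times> closure ?F"
  have compact: "compact K"
    unfolding K_def using \<open>bounded ?F\<close> by (intro compact_Times) (simp_all add: compact_closure)
  define f where "f = (\<lambda>(A :: 'i minkowski_mat, B :: 'i minkowski_mat). lorentz_adjoint A ** B)"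
  have "continuous_on K f"
    unfolding f_def case_prod_unfold lorentz_adjoint_def transpose_def by (intro continuous_intros)
  then have unif: "uniformly_continuous_on K f"
    using compact compact_uniformly_continuous by blast
  have "mat 1 \<in> \<Gamma>"
    using subgroup.one_closed[OF sub] by simp
  then obtain e where e: "e > 0" "\<And>B. B \<in> \<Gamma> \<Longrightarrow> dist (mat 1) B < e \<Longrightarrow> B = mat 1"
    using disc unfolding discrete_def isolated_in_dist_Ex_iff by blast
  obtain d where d: "d > 0" "\<And>z z'. z \<in> K \<Longrightarrow> z' \<in> K \<Longrightarrow> dist z' z < d \<Longrightarrow> dist (f z') (f z) < e"
    using uniformly_continuous_onE[OF unif e(1)] by blast
  have "A = B" if A: "A \<in> ?F" and B: "B \<in> ?F" and "dist A B < d" for A B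
  proof -
    have inv: "lorentz_adjoint A ** A = mat 1" "A ** lorentz_adjoint A = mat 1"
      using A lorentz lorentz_adjoint_inverse[OF SO_lorentz_isometry, of A] by auto
    have \<Gamma>: "A \<in> \<Gamma>" "B \<in> \<Gamma>"
      using A B by auto
    have AB: "A \<in> closure ?F" "B \<in> closure ?F"
      by (fact subsetD[OF closure_subset A], fact subsetD[OF closure_subset B])
    have "dist (A, A) (A, B) < d"
      using \<open>dist A B < d\<close> by (simp add: dist_Pair_Pair)
    then have "dist (f (A, A)) (f (A, B)) < e"
      using AB by (intro d(2)) (auto simp: K_def)
    moreover have "f (A, A) = mat 1"
      by (simp add: f_def inv)
    moreover have "f (A, B) \<in> \<Gamma>"
      using subgroup.m_closed[OF sub subgroup.m_inv_closed[OF sub \<Gamma>(1)] \<Gamma>(2)]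
        inv_SO_plus_group[of A] subgroup.subset[OF sub] \<Gamma>(1) by (auto simp: f_def)
    ultimately have "lorentz_adjoint A ** B = mat 1"
      using e(2)[of "f (A, B)"] by (simp add: f_def)
    then have "A ** (lorentz_adjoint A ** B) = A"
      by simp
    then show "A = B"
      by (simp add: matrix_mul_assoc inv)
  qed
  then have "uniform_discrete ?F"
    unfolding uniform_discrete_def using d(1) by blast
  then show ?thesis
    using \<open>bounded ?F\<close> uniform_discrete_finite_iff by blast
qed

text \<open>All powers of \<open>A\<close> fix \<open>x\<close>, so they lie in one finite set. Two
  of them coincide, \<open>A\<close> has finite order, and torsion-freeness applies.\<close>

lemma free_discrete_subgroup:
  fixes \<Gamma> :: "'i::{finite,linorder} minkowski_mat set"
  assumes sub: "subgroup \<Gamma> SO_plus_group" and disc: "discrete \<Gamma>"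
    and H: "\<And>A x. A \<in> \<Gamma> \<Longrightarrow> x \<in> hyperbolic_space \<Longrightarrow> A *v x \<in> hyperbolic_space"
    and tf: "torsion_free (SO_plus_group\<lparr>carrier := \<Gamma>\<rparr>)"
    and A: "A \<in> \<Gamma>" and x: "x \<in> hyperbolic_space" and fix_x: "A *v x = x"
  shows "A = mat 1"
proof (rule ccontr)
  assume "A \<noteq> mat 1"
  let ?G = "SO_plus_group\<lparr>carrier := \<Gamma>\<rparr>"
  interpret G: group ?G
    by (rule subgroup.subgroup_is_group[OF sub group_SO_plus])
  have cl: "A [^]\<^bsub>?G\<^esub> j \<in> \<Gamma>" for j :: nat
    using G.nat_pow_closed[of A j] A by simp
  have "(A [^]\<^bsub>?G\<^esub> j) *v x = x" for j :: nat
    by (induction j) (simp_all add: fix_x flip: matrix_vector_mul_assoc)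
  then have "range (\<lambda>j :: nat. A [^]\<^bsub>?G\<^esub> j)
      \<subseteq> {A \<in> \<Gamma>. \<exists>y\<in>hyperbolic_space. y $ last_ix \<le> x $ last_ix \<and> (A *v y) $ last_ix \<le> x $ last_ix}"
    using cl x by (auto intro!: bexI[of _ x])
  then have "finite (range (\<lambda>j :: nat. A [^]\<^bsub>?G\<^esub> j))"
    using finite_discrete_subgroup_bounded_orbit[OF sub disc H] finite_subset by blast
  then have "\<not> inj (\<lambda>j :: nat. A [^]\<^bsub>?G\<^esub> j)"
    using finite_imageD infinite_UNIV_nat by blast
  then obtain i j :: nat where "A [^]\<^bsub>?G\<^esub> i = A [^]\<^bsub>?G\<^esub> j" "i < j"
    unfolding inj_def by (metis linorder_neqE_nat)
  moreover have "A [^]\<^bsub>?G\<^esub> j = A [^]\<^bsub>?G\<^esub> i \<otimes>\<^bsub>?G\<^esub> A [^]\<^bsub>?G\<^esub> (j - i)"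
    using \<open>i < j\<close> A G.nat_pow_mult[of A i "j - i"] by simp
  ultimately have "A [^]\<^bsub>?G\<^esub> (j - i) = \<one>\<^bsub>?G\<^esub>"
    using G.l_cancel_one'[OF G.nat_pow_closed G.nat_pow_closed, of A A i "j - i"] A by simp
  then show False
    using tf A \<open>A \<noteq> mat 1\<close> \<open>i < j\<close> unfolding torsion_free_def by auto
qed

text \<open>Only finitely many members of \<open>\<Gamma>\<close> matter near \<open>x\<close>.
  Those that move \<open>x\<close> are handled one by one by separating \<open>x\<close> from its
  image, and the finitely many neighbourhoods are intersected.\<close>

lemma discontinuous_discrete_subgroup:
  fixes \<Gamma> :: "'i::{finite,linorder} minkowski_mat set"
  assumes sub: "subgroup \<Gamma> SO_plus_group" and disc: "discrete \<Gamma>"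
    and H: "\<And>A x. A \<in> \<Gamma> \<Longrightarrow> x \<in> hyperbolic_space \<Longrightarrow> A *v x \<in> hyperbolic_space"
    and x: "x \<in> hyperbolic_space"
  shows "\<exists>W. open W \<and> x \<in> W \<and> (\<forall>A\<in>\<Gamma>. \<forall>y\<in>W \<inter> hyperbolic_space. A *v y \<in> W \<longrightarrow> A *v x = x)"
proof -
  \<comment> \<open>Any bound strictly above the last coordinate of \<open>x\<close> cuts out a
    suitable open region around \<open>x\<close>.\<close>
  let ?R = "x $ last_ix + 1"
  let ?F = "{A \<in> \<Gamma>. \<exists>y\<in>hyperbolic_space. y $ last_ix \<le> ?R \<and> (A *v y) $ last_ix \<le> ?R}"
  have "\<exists>U. open U \<and> x \<in> U \<and> (\<forall>y\<in>U. A *v y \<in> U \<longrightarrow> A *v x = x)" for A :: "'i minkowski_mat"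
  proof (cases "A *v x = x")
    case True
    then show ?thesis
      by (intro exI[of _ UNIV]) simp
  next
    case False
    then obtain P Q where PQ: "open P" "open Q" "x \<in> P" "A *v x \<in> Q" "P \<inter> Q = {}"
      by (metis hausdorff)
    have "open ((*v) A -` Q)"
      using PQ(2) by (intro open_vimage matrix_vector_mult_linear_continuous_on)
    then show ?thesis
      using PQ by (intro exI[of _ "P \<inter> (*v) A -` Q"]) (auto intro: open_Int)
  qed
  then obtain U where U: "\<And>A. open (U A)" "\<And>A. x \<in> U A"
    "\<And>A y. y \<in> U A \<Longrightarrow> A *v y \<in> U A \<Longrightarrow> A *v x = x"
    by metis
  let ?W = "{y. y $ last_ix < ?R} \<inter> (\<Inter>A\<in>?F. U A)"
  have "open {y :: 'i minkowski. y $ last_ix < ?R}"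
    by (intro open_Collect_less continuous_intros)
  moreover have "open (\<Inter>A\<in>?F. U A)"
    using finite_discrete_subgroup_bounded_orbit[OF sub disc H] U(1) by (intro open_INT) auto
  ultimately have "open ?W"
    by (rule open_Int)
  moreover have "A *v x = x" if "A \<in> \<Gamma>" "y \<in> ?W" "y \<in> hyperbolic_space" "A *v y \<in> ?W" for A y
  proof -
    have "A \<in> ?F"
      using that less_imp_le by blast
    then show ?thesis
      using that by (intro U(3)[of y A]) blast+
  qed
  ultimately show ?thesis
    using U(2) by (intro exI[of _ ?W]) auto
qed


section \<open>The complex spin representation\<close>

lemma complexify_linear:
  "complexify (a + b) = complexify a + complexify b"
  "complexify (c *\<^sub>R a) = complex_of_real c *s complexify a"
  by (simp_all add: complexify_def vec_eq_iff)

lemma complexify_axis: "complexify (axis I c) = axis I (complex_of_real c)"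
  by (simp add: complexify_def vec_eq_iff axis_def)

lemma complexify_mult: "complexify (a \<star> b) = complexify a \<star> complexify b"
proof -
  have "complex_of_real (cl_factor i j) = cl_factor i j" for i j :: 'a
    by (simp add: cl_factor_def eta_def)
  then have "complex_of_real (cl_sign I J) = cl_sign I J" for I J :: "'a set"
    by (simp add: cl_sign_def)
  then show ?thesis
    by (simp add: complexify_def cl_mult_def vec_eq_iff)
qed

lemma complexify_one: "complexify cl_one = cl_one"
  by (simp add: cl_one_def complexify_axis)

lemma cl_sub_zero: "0 \<in> cl_sub"
  using cl_sub.scale[OF cl_sub.one, of 0] by simp

lemma cl_sub_sum: "(\<And>x. x \<in> A \<Longrightarrow> f x \<in> cl_sub) \<Longrightarrow> sum f A \<in> cl_sub"
  by (induction A rule: infinite_finite_induct) (auto simp: cl_sub_zero cl_sub.add)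

lemma complexify_cl_vec_cl_sub:
  assumes "v $ last_ix = 0"
  shows "complexify (cl_vec v) \<in> cl_sub"
proof -
  have "complexify (cl_vec v) = (\<Sum>i\<in>UNIV. complex_of_real (v $ i) *s cl_gen i)"
    by (simp add: cl_vec_def cl_gen_def complexify_def vec_eq_iff axis_def if_distrib cong: if_cong)
  also have "\<dots> \<in> cl_sub"
  proof (rule cl_sub_sum)
    fix i
    show "complex_of_real (v $ i) *s cl_gen i \<in> cl_sub"
      using assms by (cases "i = last_ix") (auto simp: cl_sub_zero intro: cl_sub.scale cl_sub.gen)
  qed
  finally show ?thesis .
qed

lemma complexify_spin_n_cl_sub:
  assumes "s \<in> spin_n"
  shows "complexify s \<in> cl_sub"
proof -
  have "complexify (cl_vec_prod vs) \<in> cl_sub" if "\<forall>v\<in>set vs. v $ last_ix = 0" for vs :: "'a minkowski list"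
    using that
    by (induction vs) (auto simp: complexify_one complexify_mult cl_sub.one
        intro: cl_sub.mult complexify_cl_vec_cl_sub)
  then show ?thesis
    using assms unfolding spin_n_def by blast
qed

locale spin_representation =
  fixes \<psi> :: "(complex, 'i::{finite,linorder}) clifford \<Rightarrow> complex ^ 'k::finite ^ 'k"
    and \<rho> :: "(complex, 'i) clifford \<Rightarrow> (complex, 'i) clifford"
    and m :: nat and \<sigma> :: complex
  assumes matrix_iso: "clifford_matrix_iso \<psi>" and rho: "clifford_rho m \<sigma> \<rho>"
begin

abbreviation \<Delta> :: "(real, 'i) clifford \<Rightarrow> complex ^ 'k ^ 'k" where
  "\<Delta> \<equiv> Delta_n1 \<psi> \<rho>"

lemma rho_cl_sub: "\<rho> a \<in> cl_sub"
  using rho unfolding clifford_rho_def by blast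

text \<open>\<open>\<psi>\<close> is known to be multiplicative only on \<open>cl_sub\<close>; the
  computation works because \<open>\<rho>\<close> takes its values there.\<close>

lemma Delta_mult: "\<Delta> (a \<star> b) = \<Delta> a ** \<Delta> b"
  using rho matrix_iso rho_cl_sub
  by (simp add: Delta_n1_def complexify_mult clifford_rho_def clifford_matrix_iso_def)

lemma Delta_one: "\<Delta> cl_one = mat 1"
  using rho matrix_iso
  by (simp add: Delta_n1_def complexify_one clifford_rho_def clifford_matrix_iso_def)

lemma linear_Delta: "linear \<Delta>"
proof (rule linearI)
  show "\<Delta> (a + b) = \<Delta> a + \<Delta> b" for a b
    using rho matrix_iso rho_cl_sub
    by (simp add: Delta_n1_def complexify_linear clifford_rho_def clifford_matrix_iso_def)
  have "\<Delta> (c *\<^sub>R a) = (\<chi> r. complex_of_real c *s \<Delta> a $ r)" for c a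
    using rho matrix_iso rho_cl_sub
    by (simp add: Delta_n1_def complexify_linear clifford_rho_def clifford_matrix_iso_def)
  then show "\<Delta> (c *\<^sub>R a) = c *\<^sub>R \<Delta> a" for c a
    by (simp add: vec_eq_iff scaleR_conv_of_real[where 'a = complex])
qed

lemma continuous_on_Delta_vec [continuous_intros]:
  assumes "continuous_on S f" "continuous_on S g"
  shows "continuous_on S (\<lambda>x. \<Delta> (f x) *v g x)"
proof -
  have "continuous_on S (\<lambda>x. \<Delta> (f x))"
    using linear_Delta assms(1) bounded_linear.continuous_on linear_conv_bounded_linear by blast
  with assms(2) show ?thesis
    unfolding matrix_vector_mult_def by (intro continuous_intros)
qed

lemma Delta_inv:
  assumes "g \<in> spin_plus"
  shows "\<Delta> (cl_inv g) *v (\<Delta> g *v v) = v" "\<Delta> g *v (\<Delta> (cl_inv g) *v v) = v"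
  using cl_units_inverse[OF spin_plus_units[OF assms]]
  by (simp_all add: matrix_vector_mul_assoc Delta_one flip: Delta_mult)

text \<open>\<open>\<rho>\<close> fixes the generators of \<open>cl_sub\<close> and hence all of it,
  so the extended representation agrees with the original one. The Spin(n)-action in the spinor
  bundle is thereby expressed by \<open>\<Delta>\<close>.\<close>

lemma Delta_n_eq:
  assumes "s \<in> spin_n"
  shows "Delta_n \<psi> s = \<Delta> s"
proof -
  have "\<rho> a = a" if "a \<in> cl_sub" for a
    using that by (induction rule: cl_sub.induct) (use rho in \<open>simp_all add: clifford_rho_def\<close>)
  then show ?thesis
    using complexify_spin_n_cl_sub[OF assms] by (simp add: Delta_n_def Delta_n1_def)
qed

end


section \<open>Quotient maps and the flat bundle\<close>

text \<open>The saturation of an open set is the union of its preimages under the maps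
  \<open>act a\<close>, which are continuous.\<close>

lemma open_map_quotient_topology_orbits:
  assumes orbit: "\<And>x y. x \<in> topspace X \<Longrightarrow> y \<in> topspace X \<Longrightarrow> p x = p y \<longleftrightarrow> (\<exists>a\<in>A. y = act a x)"
    and cont: "\<And>a. a \<in> A \<Longrightarrow> continuous_map X X (act a)"
  shows "open_map X (quotient_topology X p) p"
  unfolding open_map_def openin_quotient_topology
proof (intro allI impI conjI)
  fix U assume U: "openin X U"
  then show "p ` U \<subseteq> p ` topspace X"
    by (intro image_mono openin_subset)
  have "{x \<in> topspace X. p x \<in> p ` U} = (\<Union>a\<in>A. {x \<in> topspace X. act a x \<in> U})"
    using orbit openin_subset[OF U] by (fastforce simp: image_iff)
  then show "openin X {x \<in> topspace X. p x \<in> p ` U}"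
    using cont U by (auto intro!: openin_Union openin_continuous_map_preimage)
qed

lemma continuous_map_quotient_topology: "continuous_map X (quotient_topology X p) p"
  by (intro quotient_imp_continuous_map quotient_map_quotient_topology)

text \<open>The product of a quotient map with an identity map may fail to be a quotient map.
  Openness survives products, which is why the quotient maps by group actions are treated as open
  maps.\<close>

lemma open_map_prod_fst:
  assumes "open_map X X' f"
  shows "open_map (prod_topology X Y) (prod_topology X' Y) (\<lambda>(x, y). (f x, y))"
  unfolding open_map_def
proof (intro allI impI)
  fix W assume W: "openin (prod_topology X Y) W"
  show "openin (prod_topology X' Y) ((\<lambda>(x, y). (f x, y)) ` W)"
    unfolding openin_prod_topology_alt
  proof (intro allI impI)
    fix x' y assume "(x', y) \<in> (\<lambda>(x, y). (f x, y)) ` W"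
    then obtain x where x: "(x, y) \<in> W" "x' = f x"
      by auto
    then obtain U V where UV: "openin X U" "openin Y V" "x \<in> U" "y \<in> V" "U \<times> V \<subseteq> W"
      using W unfolding openin_prod_topology_alt by meson
    moreover have "openin X' (f ` U)"
      using assms UV(1) by (simp add: open_map_def)
    moreover have "f ` U \<times> V \<subseteq> (\<lambda>(x, y). (f x, y)) ` W"
      using UV(5) by force
    ultimately show "\<exists>U V. openin X' U \<and> openin Y V \<and> x' \<in> U \<and> y \<in> V \<and> U \<times> V \<subseteq> (\<lambda>(x, y). (f x, y)) ` W"
      using x(2) by blast
  qed
qed

lemma continuous_map_prod_fst:
  assumes "continuous_map X X' f"
  shows "continuous_map (prod_topology X Y) (prod_topology X' Y) (\<lambda>(x, y). (f x, y))"
  unfolding case_prod_unfold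
  using continuous_map_compose[OF continuous_map_fst assms]
  by (intro continuous_map_pairedI continuous_map_snd) (simp add: comp_def)

text \<open>Two quotients of one space by the same relation are homeomorphic. This yields both the
  map \<open>\<xi>\<close> and the local trivializations.\<close>

lemma homeomorphic_map_quotient_maps:
  assumes p: "quotient_map X Y p" and q: "quotient_map X Z q"
    and f: "\<And>x. x \<in> topspace X \<Longrightarrow> f (p x) = q x"
    and inj: "\<And>x x'. x \<in> topspace X \<Longrightarrow> x' \<in> topspace X \<Longrightarrow> q x = q x' \<Longrightarrow> p x = p x'"
  shows "homeomorphic_map Y Z f"
proof -
  have "quotient_map X Z (f \<circ> p)"
    by (rule quotient_map_eq[OF q]) (simp add: f)
  then have "quotient_map Y Z f"
    using quotient_map_compose_eq[OF p] by blast
  moreover have "inj_on f (topspace Y)"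
    unfolding quotient_imp_surjective_map[OF p, symmetric]
  proof (intro inj_onI; elim imageE)
    fix y y' x x' assume x: "f y = f y'" "y = p x" "y' = p x'" "x \<in> topspace X" "x' \<in> topspace X"
    then have "q x = q x'"
      by (simp add: f)
    with x inj show "y = y'"
      by blast
  qed
  ultimately show ?thesis
    by (simp add: homeomorphic_map_def)
qed

text \<open>The set \<open>A\<close> may fail to be saturated, as a small sheet over the base does;
  openness of \<open>f\<close> keeps the restriction a quotient map onto its image.\<close>

lemma quotient_map_restrict_open:
  assumes "continuous_map X Y f" "open_map X Y f" "openin X A"
  shows "quotient_map (subtopology X A) (subtopology Y (f ` A)) f"
proof (rule continuous_open_imp_quotient_map)
  have A: "topspace X \<inter> A = A" and fA: "topspace Y \<inter> f ` A = f ` A"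
    using openin_subset[OF assms(3)] continuous_map_image_subset_topspace[OF assms(1)] by blast+
  show "continuous_map (subtopology X A) (subtopology Y (f ` A)) f"
    using assms(1) by (auto simp: continuous_map_in_subtopology continuous_map_from_subtopology)
  show "open_map (subtopology X A) (subtopology Y (f ` A)) f"
    using assms(2,3) by (intro open_map_into_subtopology open_map_from_subtopology) auto
  show "f ` topspace (subtopology X A) = topspace (subtopology Y (f ` A))"
    by (simp add: A fA)
qed

section \<open>Fibrewise linear structure and transport of bundles along a homeomorphism\<close>

lemma complex_vector_space_on_range:
  assumes pl: "\<And>v w. pl (c v) (c w) = c (v + w)" and sc: "\<And>a v. sc a (c v) = c (a *s v)"
  shows "complex_vector_space_on (range (c :: 'k::finite cvec \<Rightarrow> 'e)) pl sc"
proof -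
  have "comm_group \<lparr>carrier = range c, mult = pl, one = c 0\<rparr>"
  proof (rule comm_groupI)
    fix u assume "u \<in> carrier \<lparr>carrier = range c, mult = pl, one = c 0\<rparr>"
    then obtain v where "u = c v"
      by auto
    then show "\<exists>y\<in>carrier \<lparr>carrier = range c, mult = pl, one = c 0\<rparr>.
        y \<otimes>\<^bsub>\<lparr>carrier = range c, mult = pl, one = c 0\<rparr>\<^esub> u = \<one>\<^bsub>\<lparr>carrier = range c, mult = pl, one = c 0\<rparr>\<^esub>"
      by (intro bexI[of _ "c (- v)"]) (simp_all add: pl)
  qed (auto simp: pl add_ac)
  then show ?thesis
    unfolding complex_vector_space_on_def
    by (auto simp: pl sc vector_smult_assoc vector_add_ldistrib vector_sadd_rdistrib intro!: exI[of _ "c 0"])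
qed

lemma complex_vector_space_on_closed:
  assumes "complex_vector_space_on V pl sc" "u \<in> V"
  shows "w \<in> V \<Longrightarrow> pl u w \<in> V" "sc c u \<in> V"
proof -
  obtain z where "comm_group \<lparr>carrier = V, mult = pl, one = z\<rparr>"
    using assms(1) by (auto simp: complex_vector_space_on_def)
  then interpret comm_group "\<lparr>carrier = V, mult = pl, one = z\<rparr>" .
  show "w \<in> V \<Longrightarrow> pl u w \<in> V"
    using m_closed assms(2) by simp
  show "sc c u \<in> V"
    using assms by (simp add: complex_vector_space_on_def)
qed

lemma class_plus_eq:
  assumes "g \<in> G"
    and "\<And>g' v' w'. g' \<in> G \<Longrightarrow> cls g v = cls g' v' \<Longrightarrow> cls g w = cls g' w' \<Longrightarrow> cls g (v + w) = cls g' (v' + w')"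
  shows "class_plus G cls (cls g v) (cls g w) = cls g (v + w)"
  unfolding class_plus_def
proof (rule the_equality)
  show "\<exists>g'\<in>G. \<exists>v' w'. cls g v = cls g' v' \<and> cls g w = cls g' w' \<and> cls g (v + w) = cls g' (v' + w')"
    using assms(1) by blast
qed (use assms(2) in auto)

lemma class_scale_eq:
  assumes "g \<in> G"
    and "\<And>g' v'. g' \<in> G \<Longrightarrow> cls g v = cls g' v' \<Longrightarrow> cls g (c *s v) = cls g' (c *s v')"
  shows "class_scale G cls c (cls g v) = cls g (c *s v)"
  unfolding class_scale_def
proof (rule the_equality)
  show "\<exists>g'\<in>G. \<exists>v'. cls g v = cls g' v' \<and> cls g (c *s v) = cls g' (c *s v')"
    using assms(1) by blast
qed (use assms(2) in auto)

text \<open>Local trivializations of \<open>F\<close> are composed with the inverse of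
  \<open>f\<close>. The inverse is linear on fibres because \<open>f\<close> is linear and injective
  there.\<close>

lemma complex_vector_bundle_transport:
  fixes E :: "('e, 'b) vbundle" and F :: "('f, 'b) vbundle"
  assumes F: "complex_vector_bundle TYPE('k::finite) F" and base: "vb_base E = vb_base F"
    and f: "homeomorphic_map (vb_total E) (vb_total F) f"
    and proj: "\<And>u. u \<in> topspace (vb_total E) \<Longrightarrow> vb_proj F (f u) = vb_proj E u"
    and space: "\<And>b. b \<in> topspace (vb_base E) \<Longrightarrow>
      complex_vector_space_on (vb_fibre E b) (vb_plus E) (vb_scale E)"
    and plus: "\<And>b u w. b \<in> topspace (vb_base E) \<Longrightarrow> u \<in> vb_fibre E b \<Longrightarrow> w \<in> vb_fibre E b \<Longrightarrow>
      f (vb_plus E u w) = vb_plus F (f u) (f w)"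
    and scale: "\<And>b u c. b \<in> topspace (vb_base E) \<Longrightarrow> u \<in> vb_fibre E b \<Longrightarrow>
      f (vb_scale E c u) = vb_scale F c (f u)"
  shows "complex_vector_bundle TYPE('k) E"
  unfolding complex_vector_bundle_def
proof (intro conjI ballI)
  have "continuous_map (vb_total E) (vb_base F) (vb_proj F \<circ> f)"
    by (rule continuous_map_compose[OF homeomorphic_imp_continuous_map[OF f]])
      (use F in \<open>simp add: complex_vector_bundle_def\<close>)
  then show "continuous_map (vb_total E) (vb_base E) (vb_proj E)"
    unfolding base by (rule continuous_map_eq) (simp add: proj)
next
  fix b assume b: "b \<in> topspace (vb_base E)"
  show "complex_vector_space_on (vb_fibre E b) (vb_plus E) (vb_scale E)"
    by (rule space[OF b])
  obtain U and h :: "'b \<times> 'k cvec \<Rightarrow> 'f" where U: "openin (vb_base F) U" "b \<in> U"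
    and h: "homeomorphic_map (prod_topology (subtopology (vb_base F) U) euclidean)
        (subtopology (vb_total F) {u \<in> topspace (vb_total F). vb_proj F u \<in> U}) h"
    and h_lin: "\<forall>x\<in>U. \<forall>v w c. vb_proj F (h (x, v)) = x \<and>
         h (x, v + w) = vb_plus F (h (x, v)) (h (x, w)) \<and> h (x, c *s v) = vb_scale F c (h (x, v))"
    using F[unfolded complex_vector_bundle_def, THEN conjunct2, THEN conjunct2, THEN bspec, OF b[unfolded base]]
    by (elim exE conjE) (rule that)
  have hx: "vb_proj F (h (x, v)) = x" "h (x, v + w) = vb_plus F (h (x, v)) (h (x, w))"
    "h (x, c *s v) = vb_scale F c (h (x, v))" if "x \<in> U" for x v w c
    using h_lin that by auto
  obtain g where fg: "homeomorphic_maps (vb_total E) (vb_total F) f g"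
    using f homeomorphic_map_maps by blast
  then have gf: "g (f u) = u" if "u \<in> topspace (vb_total E)" for u
    using that by (simp add: homeomorphic_maps_def)
  have fg': "f (g u) = u" "g u \<in> topspace (vb_total E)" if "u \<in> topspace (vb_total F)" for u
    using that fg by (auto simp: homeomorphic_maps_def continuous_map_def)
  have ff: "f u \<in> topspace (vb_total F)" if "u \<in> topspace (vb_total E)" for u
    using that fg by (auto simp: homeomorphic_maps_def continuous_map_def)
  let ?TF = "{u \<in> topspace (vb_total F). vb_proj F u \<in> U}"
  let ?TE = "{u \<in> topspace (vb_total E). vb_proj E u \<in> U}"
  have "homeomorphic_map (vb_total F) (vb_total E) g"
    using fg homeomorphic_maps_map homeomorphic_maps_sym by blast
  moreover have "g ` (topspace (vb_total F) \<inter> ?TF) = topspace (vb_total E) \<inter> ?TE"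
  proof (intro equalityI subsetI)
    fix u assume "u \<in> g ` (topspace (vb_total F) \<inter> ?TF)"
    then obtain y where "y \<in> ?TF" "u = g y"
      by blast
    then show "u \<in> topspace (vb_total E) \<inter> ?TE"
      using fg'[of y] proj[of u] by auto
  next
    fix u assume u: "u \<in> topspace (vb_total E) \<inter> ?TE"
    then show "u \<in> g ` (topspace (vb_total F) \<inter> ?TF)"
      using gf[of u] ff[of u] proj[of u] by (intro image_eqI[of _ _ "f u"]) auto
  qed
  ultimately have "homeomorphic_map (subtopology (vb_total F) ?TF) (subtopology (vb_total E) ?TE) g"
    by (rule homeomorphic_map_subtopologies)
  then have gh: "homeomorphic_map (prod_topology (subtopology (vb_base E) U) euclidean)
      (subtopology (vb_total E) ?TE) (g \<circ> h)"
    unfolding base by (rule homeomorphic_map_compose[OF h])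
  have Ub: "U \<subseteq> topspace (vb_base E)"
    using U(1) openin_subset base by auto
  have h_in: "h (x, v) \<in> topspace (vb_total F)" if "x \<in> U" for x v
  proof -
    have "(x, v) \<in> topspace (prod_topology (subtopology (vb_base F) U) (euclidean :: 'k cvec topology))"
      using that Ub base by auto
    then have "h (x, v) \<in> topspace (subtopology (vb_total F) ?TF)"
      using homeomorphic_imp_surjective_map[OF h] by blast
    then show ?thesis
      by simp
  qed
  have "vb_proj E ((g \<circ> h) (x, v)) = x \<and>
      (g \<circ> h) (x, v + w) = vb_plus E ((g \<circ> h) (x, v)) ((g \<circ> h) (x, w)) \<and>
      (g \<circ> h) (x, c *s v) = vb_scale E c ((g \<circ> h) (x, v))" if x: "x \<in> U" for x v w c
  proof -
    let ?u = "\<lambda>v. g (h (x, v))"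
    have xb: "x \<in> topspace (vb_base E)"
      using x Ub by blast
    have fu: "f (?u v) = h (x, v)" and uE: "?u v \<in> topspace (vb_total E)" for v
      using fg' h_in[OF x] by auto
    have pu: "vb_proj E (?u v) = x" for v
      using proj[OF uE, of v] hx(1)[OF x, of v] by (simp add: fu)
    then have fib: "?u v \<in> vb_fibre E x" for v
      using uE by (simp add: vb_fibre_def)
    \<comment> \<open>The inverse cancels \<open>f\<close> only on the total space, so sums and
      multiples must first be known to stay in the fibre.\<close>
    note closed = complex_vector_space_on_closed[OF space[OF xb] fib]
    have "vb_plus E (?u v) (?u w) \<in> topspace (vb_total E)"
      using closed(1)[OF fib, of v w] by (simp add: vb_fibre_def)
    moreover have "f (vb_plus E (?u v) (?u w)) = h (x, v + w)"
      by (simp add: plus[OF xb fib fib] fu hx(2)[OF x])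
    ultimately have "?u (v + w) = vb_plus E (?u v) (?u w)"
      using gf by metis
    moreover have "vb_scale E c (?u v) \<in> topspace (vb_total E)"
      using closed(2)[of c v] by (simp add: vb_fibre_def)
    moreover have "f (vb_scale E c (?u v)) = h (x, c *s v)"
      by (simp add: scale[OF xb fib] fu hx(3)[OF x])
    ultimately show ?thesis
      using gf pu by (metis comp_apply)
  qed
  with gh U show "\<exists>U (h :: 'b \<times> 'k cvec \<Rightarrow> 'e). openin (vb_base E) U \<and> b \<in> U \<and>
      homeomorphic_map (prod_topology (subtopology (vb_base E) U) euclidean)
        (subtopology (vb_total E) {u \<in> topspace (vb_total E). vb_proj E u \<in> U}) h \<and>
      (\<forall>x\<in>U. \<forall>v w c. vb_proj E (h (x, v)) = x \<and>
         h (x, v + w) = vb_plus E (h (x, v)) (h (x, w)) \<and> h (x, c *s v) = vb_scale E c (h (x, v)))"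
    unfolding base by blast
qed


section \<open>The flat bundle over the hyperbolic manifold\<close>

locale hyperbolic_spin_manifold = spin_representation \<psi> \<rho> m \<sigma>
  for \<psi> :: "(complex, 'i::{finite,linorder}) clifford \<Rightarrow> complex ^ 'k::finite ^ 'k"
    and \<rho> :: "(complex, 'i) clifford \<Rightarrow> (complex, 'i) clifford"
    and m :: nat and \<sigma> :: complex +
  fixes \<Gamma> :: "('i minkowski_mat) set" and \<Gamma>h :: "(real, 'i) clifford set"
  assumes dimension: "CARD('i) \<ge> 3"
    and \<Gamma>: "subgroup \<Gamma> SO_plus_group" and discrete: "discrete \<Gamma>"
    and tf: "torsion_free (SO_plus_group\<lparr>carrier := \<Gamma>\<rparr>)"
    and \<Gamma>h: "subgroup \<Gamma>h spin_plus_group"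
    and Ad_iso: "(\<lambda>g. matrix (Ad g)) \<in> iso (spin_plus_group\<lparr>carrier := \<Gamma>h\<rparr>) (SO_plus_group\<lparr>carrier := \<Gamma>\<rparr>)"
begin

abbreviation E :: "(((real, 'i) clifford set \<times> 'k cvec) set, 'i minkowski set) vbundle" where
  "E \<equiv> spinor_bundle \<Gamma> \<Gamma>h \<psi>"

abbreviation F :: "(('i minkowski \<times> 'k cvec) set, 'i minkowski set) vbundle" where
  "F \<equiv> flat_bundle \<Gamma> \<Gamma>h \<psi> \<rho>"

abbreviation flat :: "'i minkowski \<Rightarrow> 'k cvec \<Rightarrow> ('i minkowski \<times> 'k cvec) set" where
  "flat \<equiv> flat_class \<Gamma>h \<psi> \<rho>"

abbreviation spinor :: "(real, 'i) clifford \<Rightarrow> 'k cvec \<Rightarrow> ((real, 'i) clifford set \<times> 'k cvec) set" where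
  "spinor \<equiv> spinor_class \<Gamma>h \<psi>"

abbreviation \<xi> :: "((real, 'i) clifford set \<times> 'k cvec) set \<Rightarrow> ('i minkowski \<times> 'k cvec) set" where
  "\<xi> \<equiv> spinor_xi \<Gamma>h \<psi> \<rho>"

lemma \<Gamma>h_spin_plus: "\<gamma> \<in> \<Gamma>h \<Longrightarrow> \<gamma> \<in> spin_plus"
  using subgroup.subset[OF \<Gamma>h] by auto

lemma \<Gamma>h_units: "\<gamma> \<in> \<Gamma>h \<Longrightarrow> \<gamma> \<in> cl_units"
  using \<Gamma>h_spin_plus spin_plus_units by blast

lemma \<Gamma>h_one: "cl_one \<in> \<Gamma>h"
  using subgroup.one_closed[OF \<Gamma>h] by simp

lemma \<Gamma>h_mult: "\<gamma> \<in> \<Gamma>h \<Longrightarrow> \<delta> \<in> \<Gamma>h \<Longrightarrow> \<gamma> \<star> \<delta> \<in> \<Gamma>h"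
  using subgroup.m_closed[OF \<Gamma>h] by simp

lemma \<Gamma>h_inv: "\<gamma> \<in> \<Gamma>h \<Longrightarrow> cl_inv \<gamma> \<in> \<Gamma>h"
  using subgroup.m_inv_closed[OF \<Gamma>h] inv_spin_plus_group[OF \<Gamma>h_spin_plus] by simp

lemma \<Gamma>_image: "\<Gamma> = (\<lambda>g. matrix (Ad g)) ` \<Gamma>h" "inj_on (\<lambda>g. matrix (Ad g)) \<Gamma>h"
  using Ad_iso by (auto simp: iso_def bij_betw_def)

lemma matrix_Ad: "\<gamma> \<in> \<Gamma>h \<Longrightarrow> matrix (Ad \<gamma>) *v x = Ad \<gamma> x"
  by (simp add: matrix_works linear_Ad \<Gamma>h_units)

lemma \<Gamma>h_mult_image: "\<gamma> \<in> \<Gamma>h \<Longrightarrow> (\<lambda>\<delta>. \<delta> \<star> \<gamma>) ` \<Gamma>h = \<Gamma>h"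
proof (intro equalityI subsetI)
  fix \<delta> assume "\<gamma> \<in> \<Gamma>h" "\<delta> \<in> \<Gamma>h"
  then show "\<delta> \<in> (\<lambda>\<delta>. \<delta> \<star> \<gamma>) ` \<Gamma>h"
    using \<Gamma>h_mult \<Gamma>h_inv cl_units_inverse(2)[OF \<Gamma>h_units]
    by (intro image_eqI[of _ _ "\<delta> \<star> cl_inv \<gamma>"]) (auto simp: cl_mult_assoc)
qed (auto simp: \<Gamma>h_mult)

lemma base_class_eq: "base_class \<Gamma> x = (\<lambda>\<gamma>. Ad \<gamma> x) ` \<Gamma>h"
  unfolding base_class_def \<Gamma>_image(1) image_image using matrix_Ad by (intro image_cong) auto

lemma base_class_eq_iff: "base_class \<Gamma> x = base_class \<Gamma> y \<longleftrightarrow> (\<exists>\<gamma>\<in>\<Gamma>h. y = Ad \<gamma> x)"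
proof
  assume "base_class \<Gamma> x = base_class \<Gamma> y"
  moreover have "y \<in> base_class \<Gamma> y"
    unfolding base_class_eq using \<Gamma>h_one by (metis Ad_one image_eqI)
  ultimately show "\<exists>\<gamma>\<in>\<Gamma>h. y = Ad \<gamma> x"
    unfolding base_class_eq by blast
next
  assume "\<exists>\<gamma>\<in>\<Gamma>h. y = Ad \<gamma> x"
  then obtain \<gamma> where \<gamma>: "\<gamma> \<in> \<Gamma>h" "y = Ad \<gamma> x"
    by blast
  have "base_class \<Gamma> y = (\<lambda>\<delta>. Ad \<delta> x) ` (\<lambda>\<delta>. \<delta> \<star> \<gamma>) ` \<Gamma>h"
    unfolding base_class_eq image_image using \<gamma> \<Gamma>h_units
    by (intro image_cong) (auto simp: Ad_mult)
  then show "base_class \<Gamma> x = base_class \<Gamma> y"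
    unfolding \<Gamma>h_mult_image[OF \<gamma>(1)] base_class_eq by simp
qed

lemma flat_class_eq_iff:
  "flat x v = flat y w \<longleftrightarrow> (\<exists>\<gamma>\<in>\<Gamma>h. y = Ad \<gamma> x \<and> w = \<Delta> \<gamma> *v v)"
proof
  assume "flat x v = flat y w"
  moreover have "(y, w) \<in> flat y w"
    unfolding flat_class_def using \<Gamma>h_one by (intro image_eqI[of _ _ cl_one]) (auto simp: Delta_one)
  ultimately show "\<exists>\<gamma>\<in>\<Gamma>h. y = Ad \<gamma> x \<and> w = \<Delta> \<gamma> *v v"
    unfolding flat_class_def by blast
next
  assume "\<exists>\<gamma>\<in>\<Gamma>h. y = Ad \<gamma> x \<and> w = \<Delta> \<gamma> *v v"
  then obtain \<gamma> where \<gamma>: "\<gamma> \<in> \<Gamma>h" "y = Ad \<gamma> x" "w = \<Delta> \<gamma> *v v"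
    by blast
  have "flat y w = (\<lambda>\<delta>. (Ad \<delta> x, \<Delta> \<delta> *v v)) ` (\<lambda>\<delta>. \<delta> \<star> \<gamma>) ` \<Gamma>h"
    unfolding flat_class_def image_image using \<gamma> \<Gamma>h_units
    by (intro image_cong) (auto simp: Ad_mult Delta_mult matrix_vector_mul_assoc)
  then show "flat x v = flat y w"
    unfolding \<Gamma>h_mult_image[OF \<gamma>(1)] by (simp add: flat_class_def)
qed

lemma \<Gamma>_hyperbolic: "A \<in> \<Gamma> \<Longrightarrow> x \<in> hyperbolic_space \<Longrightarrow> A *v x \<in> hyperbolic_space"
  unfolding \<Gamma>_image(1) by (auto simp: matrix_Ad \<Gamma>h_spin_plus Ad_hyperbolic)

text \<open>The Lorentz matrix of \<open>\<gamma>\<close> has a fixed point in hyperbolic space, so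
  it is the identity matrix; injectivity of \<open>Ad\<close> on \<open>\<Gamma>h\<close> then
  leaves only \<open>cl_one\<close>, and in particular excludes -1.\<close>

lemma \<Gamma>h_free:
  assumes "\<gamma> \<in> \<Gamma>h" "x \<in> hyperbolic_space" "Ad \<gamma> x = x"
  shows "\<gamma> = cl_one"
proof -
  have "matrix (Ad \<gamma>) = mat 1"
    using assms by (intro free_discrete_subgroup[OF \<Gamma> discrete \<Gamma>_hyperbolic tf _ assms(2)])
      (auto simp: \<Gamma>_image(1) matrix_Ad)
  also have "\<dots> = matrix (Ad cl_one)"
    by (auto simp: matrix_def mat_def vec_eq_iff axis_def)
  finally show ?thesis
    using inj_onD[OF \<Gamma>_image(2)] assms(1) \<Gamma>h_one by blast
qed

lemma \<Gamma>h_discontinuous: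
  assumes "x \<in> hyperbolic_space"
  obtains W where "open W" "x \<in> W"
    "\<And>\<gamma> y. \<gamma> \<in> \<Gamma>h \<Longrightarrow> y \<in> W \<inter> hyperbolic_space \<Longrightarrow> Ad \<gamma> y \<in> W \<Longrightarrow> \<gamma> = cl_one"
proof -
  obtain W where W: "open W" "x \<in> W"
    "\<forall>A\<in>\<Gamma>. \<forall>y\<in>W \<inter> hyperbolic_space. A *v y \<in> W \<longrightarrow> A *v x = x"
    using discontinuous_discrete_subgroup[OF \<Gamma> discrete \<Gamma>_hyperbolic assms] by blast
  have "\<gamma> = cl_one" if "\<gamma> \<in> \<Gamma>h" "y \<in> W \<inter> hyperbolic_space" "Ad \<gamma> y \<in> W" for \<gamma> y
  proof -
    have "matrix (Ad \<gamma>) \<in> \<Gamma>"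
      using that(1) \<Gamma>_image(1) by blast
    then have "Ad \<gamma> x = x"
      using W(3) that by (metis matrix_Ad)
    then show ?thesis
      using \<Gamma>h_free that(1) assms by blast
  qed
  with W that show ?thesis
    by blast
qed

lemma flat_class_base: "flat x v = flat y w \<Longrightarrow> base_class \<Gamma> x = base_class \<Gamma> y"
  unfolding flat_class_eq_iff base_class_eq_iff by blast

lemma proj_flat: "vb_proj F (flat x v) = base_class \<Gamma> x" if "x \<in> hyperbolic_space"
proof -
  have "descend (hyperbolic_space \<times> UNIV) (\<lambda>(x, v). flat x v) (\<lambda>(x, v). base_class \<Gamma> x)
      ((\<lambda>(x, v). flat x v) (x, v)) = (\<lambda>(x, v). base_class \<Gamma> x) (x, v)"
    by (rule descend_eq) (use that in \<open>auto dest!: flat_class_base\<close>)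
  then show ?thesis
    by (simp add: flat_bundle_def)
qed

text \<open>The two equalities provide elements \<open>\<gamma>\<close> and \<open>\<delta>\<close>
  of \<open>\<Gamma>h\<close> with the same effect on \<open>x\<close>, and freeness identifies
  them. Having a single element for both vectors is what makes fibrewise addition independent of
  representatives.\<close>

lemma flat_class_eqD:
  assumes "x \<in> hyperbolic_space" "flat x v = flat y v'" "flat x w = flat y w'"
  obtains \<gamma> where "\<gamma> \<in> \<Gamma>h" "y = Ad \<gamma> x" "v' = \<Delta> \<gamma> *v v" "w' = \<Delta> \<gamma> *v w"
proof -
  obtain \<gamma> \<delta> where g: "\<gamma> \<in> \<Gamma>h" "y = Ad \<gamma> x" "v' = \<Delta> \<gamma> *v v"
    and d: "\<delta> \<in> \<Gamma>h" "y = Ad \<delta> x" "w' = \<Delta> \<delta> *v w"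
    using assms(2,3) flat_class_eq_iff by metis
  have "Ad (cl_inv \<delta> \<star> \<gamma>) x = Ad (cl_inv \<delta> \<star> \<delta>) x"
    using g(1,2) d(1,2) by (metis Ad_mult \<Gamma>h_inv \<Gamma>h_units)
  then have "cl_inv \<delta> \<star> \<gamma> = cl_one"
    using g(1) d(1) assms(1) cl_units_inverse(2)[OF \<Gamma>h_units[OF d(1)]]
    by (intro \<Gamma>h_free[of _ x] \<Gamma>h_mult \<Gamma>h_inv) auto
  then have "\<delta> \<star> (cl_inv \<delta> \<star> \<gamma>) = \<delta>"
    by simp
  then have "\<gamma> = \<delta>"
    using cl_units_inverse(1)[OF \<Gamma>h_units[OF d(1)]] by (simp flip: cl_mult_assoc)
  with g d that show ?thesis
    by blast
qed

lemma flat_plus_cong: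
  "x \<in> hyperbolic_space \<Longrightarrow> flat x v = flat y v' \<Longrightarrow> flat x w = flat y w' \<Longrightarrow> flat x (v + w) = flat y (v' + w')"
  by (erule (2) flat_class_eqD) (auto simp: flat_class_eq_iff matrix_vector_right_distrib)

lemma flat_scale_cong: "flat x v = flat y v' \<Longrightarrow> flat x (c *s v) = flat y (c *s v')"
  by (auto simp: flat_class_eq_iff vector_scalar_commute)

lemma plus_flat: "vb_plus F (flat x v) (flat x w) = flat x (v + w)" if "x \<in> hyperbolic_space"
proof -
  have "class_plus hyperbolic_space flat (flat x v) (flat x w) = flat x (v + w)"
    by (rule class_plus_eq[OF that]) (rule flat_plus_cong[OF that])
  then show ?thesis
    by (simp add: flat_bundle_def)
qed

lemma scale_flat: "vb_scale F c (flat x v) = flat x (c *s v)" if "x \<in> hyperbolic_space"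
proof -
  have "class_scale hyperbolic_space flat c (flat x v) = flat x (c *s v)"
    by (rule class_scale_eq[OF that]) (rule flat_scale_cong)
  then show ?thesis
    by (simp add: flat_bundle_def)
qed

lemma base_F: "vb_base F = quotient_topology (top_of_set hyperbolic_space) (base_class \<Gamma>)"
  by (simp add: flat_bundle_def base_space_def)

lemma total_F: "vb_total F = quotient_topology (top_of_set (hyperbolic_space \<times> UNIV)) (\<lambda>(x, v). flat x v)"
  by (simp add: flat_bundle_def)

lemma topspace_base_F: "topspace (vb_base F) = base_class \<Gamma> ` hyperbolic_space"
  by (simp add: base_F topspace_quotient_topology)

lemma topspace_total_F: "topspace (vb_total F) = {flat x v | x v. x \<in> hyperbolic_space}"
  by (auto simp: total_F topspace_quotient_topology)

lemma \<Gamma>h_Ad_hyperbolic: "\<gamma> \<in> \<Gamma>h \<Longrightarrow> x \<in> hyperbolic_space \<Longrightarrow> Ad \<gamma> x \<in> hyperbolic_space"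
  using \<Gamma>h_spin_plus Ad_hyperbolic by blast

lemma fibre_F: "vb_fibre F (base_class \<Gamma> x) = range (flat x)" if x: "x \<in> hyperbolic_space"
proof (intro equalityI subsetI)
  fix u assume "u \<in> vb_fibre F (base_class \<Gamma> x)"
  then obtain y v where y: "u = flat y v" "y \<in> hyperbolic_space" "base_class \<Gamma> y = base_class \<Gamma> x"
    by (auto simp: vb_fibre_def topspace_total_F proj_flat)
  then obtain \<gamma> where "\<gamma> \<in> \<Gamma>h" "x = Ad \<gamma> y"
    using base_class_eq_iff by blast
  then have "u = flat x (\<Delta> \<gamma> *v v)"
    unfolding y(1) flat_class_eq_iff by blast
  then show "u \<in> range (flat x)"
    by blast
qed (use x in \<open>auto simp: vb_fibre_def topspace_total_F proj_flat\<close>)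

lemma open_map_base: "open_map (top_of_set hyperbolic_space) (vb_base F) (base_class \<Gamma>)"
  unfolding base_F
proof (rule open_map_quotient_topology_orbits[where A = \<Gamma>h and act = Ad])
  fix \<gamma> assume "\<gamma> \<in> \<Gamma>h"
  then show "continuous_map (top_of_set hyperbolic_space) (top_of_set hyperbolic_space) (Ad \<gamma>)"
    using \<Gamma>h_Ad_hyperbolic \<Gamma>h_units by (auto intro!: continuous_intros)
qed (simp add: base_class_eq_iff)

lemma open_map_total: "open_map (top_of_set (hyperbolic_space \<times> UNIV)) (vb_total F) (\<lambda>(x, v). flat x v)"
  unfolding total_F
proof (rule open_map_quotient_topology_orbits[where A = \<Gamma>h and act = "\<lambda>\<gamma> (x, v). (Ad \<gamma> x, \<Delta> \<gamma> *v v)"])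
  fix \<gamma> assume "\<gamma> \<in> \<Gamma>h"
  then show "continuous_map (top_of_set (hyperbolic_space \<times> UNIV)) (top_of_set (hyperbolic_space \<times> UNIV))
      (\<lambda>(x, v). (Ad \<gamma> x, \<Delta> \<gamma> *v v))"
    using \<Gamma>h_Ad_hyperbolic \<Gamma>h_units by (auto simp: case_prod_unfold intro!: continuous_intros)
next
  fix p q :: "'i minkowski \<times> 'k cvec"
  show "(case p of (x, v) \<Rightarrow> flat x v) = (case q of (x, v) \<Rightarrow> flat x v)
      \<longleftrightarrow> (\<exists>\<gamma>\<in>\<Gamma>h. q = (case p of (x, v) \<Rightarrow> (Ad \<gamma> x, \<Delta> \<gamma> *v v)))"
    by (cases p, cases q) (simp add: flat_class_eq_iff)
qed

lemma top_of_set_Times_UNIV: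
  "prod_topology (top_of_set S) (euclidean :: 'k cvec topology) = top_of_set (S \<times> UNIV)"
  using prod_topology_subtopology_eu[of S "UNIV :: 'k cvec set"] by (simp only: subtopology_UNIV)

text \<open>No two points of \<open>W\<close> in hyperbolic space are equivalent, so the class map
  to the base has a section \<open>s\<close> over the image \<open>U\<close> of \<open>W\<close>,
  and \<open>h\<close> sends \<open>(b, v)\<close> to the class of \<open>(s b, v)\<close>. It is a
  homeomorphism because its source and its target are quotients of the same sheet, \<open>W\<close>
  within hyperbolic space times the spinor space, with the same fibres.\<close>

lemma flat_local_trivialization:
  assumes "b \<in> topspace (vb_base F)"
  shows "\<exists>U (h :: 'i minkowski set \<times> 'k cvec \<Rightarrow> _). openin (vb_base F) U \<and> b \<in> U \<and>
    homeomorphic_map (prod_topology (subtopology (vb_base F) U) euclidean)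
      (subtopology (vb_total F) {u \<in> topspace (vb_total F). vb_proj F u \<in> U}) h \<and>
    (\<forall>x\<in>U. \<forall>v w c. vb_proj F (h (x, v)) = x \<and>
       h (x, v + w) = vb_plus F (h (x, v)) (h (x, w)) \<and> h (x, c *s v) = vb_scale F c (h (x, v)))"
proof -
  obtain z where z: "z \<in> hyperbolic_space" "b = base_class \<Gamma> z"
    using assms topspace_base_F by blast
  obtain W where W: "open W" "z \<in> W"
    and disj: "\<And>\<gamma> y. \<gamma> \<in> \<Gamma>h \<Longrightarrow> y \<in> W \<inter> hyperbolic_space \<Longrightarrow> Ad \<gamma> y \<in> W \<Longrightarrow> \<gamma> = cl_one"
    using \<Gamma>h_discontinuous[OF z(1)] by blast
  let ?W = "W \<inter> hyperbolic_space" and ?A = "(W \<inter> hyperbolic_space) \<times> (UNIV :: 'k cvec set)"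
  let ?X = "top_of_set (hyperbolic_space \<times> (UNIV :: 'k cvec set))"
  let ?flat = "\<lambda>(x, v). flat x v" and ?base = "\<lambda>(x, v :: 'k cvec). (base_class \<Gamma> x, v)"
  define U where "U = base_class \<Gamma> ` ?W"
  define s where "s = inv_into ?W (base_class \<Gamma>)"
  define h where "h = (\<lambda>(b, v). flat (s b) v)"
  have inj: "inj_on (base_class \<Gamma>) ?W"
  proof (rule inj_onI)
    fix x y assume "x \<in> ?W" "y \<in> ?W" "base_class \<Gamma> x = base_class \<Gamma> y"
    then show "x = y"
      using disj by (force simp: base_class_eq_iff)
  qed
  have s: "s (base_class \<Gamma> x) = x" if "x \<in> ?W" for x
    unfolding s_def using inv_into_f_f[OF inj that] .
  have openW: "openin (top_of_set hyperbolic_space) ?W"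
    using W(1) by (simp add: openin_open_Int Int_commute)
  have openU: "openin (vb_base F) U"
    unfolding U_def using open_map_base openW by (auto simp: open_map_def)
  have openA: "openin ?X ?A"
    using openW unfolding top_of_set_Times_UNIV[symmetric] by (simp add: openin_prod_Times_iff)
  have base_cont: "continuous_map ?X (prod_topology (vb_base F) euclidean) ?base"
    unfolding top_of_set_Times_UNIV[symmetric] base_F
    by (rule continuous_map_prod_fst[OF continuous_map_quotient_topology])
  have base_open: "open_map ?X (prod_topology (vb_base F) euclidean) ?base"
    unfolding top_of_set_Times_UNIV[symmetric] by (rule open_map_prod_fst[OF open_map_base])
  have "quotient_map (subtopology ?X ?A) (subtopology (prod_topology (vb_base F) euclidean) (?base ` ?A)) ?base"
    by (rule quotient_map_restrict_open[OF base_cont base_open openA])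
  moreover have "?base ` ?A = U \<times> UNIV"
    by (force simp: U_def)
  ultimately have q_base: "quotient_map (subtopology ?X ?A) (prod_topology (subtopology (vb_base F) U) euclidean) ?base"
    by (simp only: subtopology_Times subtopology_UNIV)
  have "?flat ` ?A = {u \<in> topspace (vb_total F). vb_proj F u \<in> U}"
  proof (intro equalityI subsetI)
    fix u assume "u \<in> {u \<in> topspace (vb_total F). vb_proj F u \<in> U}"
    then obtain x v y where x: "u = flat x v" "x \<in> hyperbolic_space" "y \<in> ?W" "base_class \<Gamma> x = base_class \<Gamma> y"
      by (auto simp: topspace_total_F U_def proj_flat)
    then obtain \<gamma> where "\<gamma> \<in> \<Gamma>h" "y = Ad \<gamma> x"
      using base_class_eq_iff by blast
    then have "u = flat y (\<Delta> \<gamma> *v v)"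
      unfolding x(1) flat_class_eq_iff by blast
    with x(3) show "u \<in> ?flat ` ?A"
      by blast
  qed (auto simp: topspace_total_F U_def proj_flat)
  moreover have "quotient_map (subtopology ?X ?A) (subtopology (vb_total F) (?flat ` ?A)) ?flat"
    by (rule quotient_map_restrict_open[OF _ open_map_total openA])
      (simp only: total_F continuous_map_quotient_topology)
  ultimately have q_flat: "quotient_map (subtopology ?X ?A)
      (subtopology (vb_total F) {u \<in> topspace (vb_total F). vb_proj F u \<in> U}) ?flat"
    by simp
  have hom: "homeomorphic_map (prod_topology (subtopology (vb_base F) U) euclidean)
      (subtopology (vb_total F) {u \<in> topspace (vb_total F). vb_proj F u \<in> U}) h"
  proof (rule homeomorphic_map_quotient_maps[OF q_base q_flat])
    fix y assume "y \<in> topspace (subtopology ?X ?A)"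
    then show "h (?base y) = ?flat y"
      by (auto simp: h_def s)
  next
    fix y y' assume y: "y \<in> topspace (subtopology ?X ?A)" "y' \<in> topspace (subtopology ?X ?A)" "?flat y = ?flat y'"
    obtain x v x' v' where xv: "y = (x, v)" "y' = (x', v')"
      by (cases y, cases y')
    then obtain \<gamma> where \<gamma>: "\<gamma> \<in> \<Gamma>h" "x' = Ad \<gamma> x" "v' = \<Delta> \<gamma> *v v"
      using y(3) by (auto simp: flat_class_eq_iff)
    then have "\<gamma> = cl_one"
      using disj[of \<gamma> x] y xv by auto
    with \<gamma> show "?base y = ?base y'"
      by (simp add: xv Delta_one)
  qed
  have lin: "vb_proj F (h (x, v)) = x \<and> h (x, v + w) = vb_plus F (h (x, v)) (h (x, w)) \<and>
      h (x, c *s v) = vb_scale F c (h (x, v))" if "x \<in> U" for x v w c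
  proof -
    obtain y where y: "y \<in> ?W" "x = base_class \<Gamma> y"
      using \<open>x \<in> U\<close> by (auto simp: U_def)
    then show ?thesis
      by (simp add: h_def s proj_flat plus_flat scale_flat)
  qed
  have bU: "b \<in> U"
    using z W(2) by (auto simp: U_def)
  show ?thesis
    by (intro exI[of _ U] exI[of _ h] conjI openU bU hom) (use lin in blast)
qed

lemma complex_vector_bundle_flat: "complex_vector_bundle TYPE('k) F"
  unfolding complex_vector_bundle_def
proof (intro conjI ballI)
  let ?X = "top_of_set (hyperbolic_space \<times> (UNIV :: 'k cvec set))"
  have "continuous_map ?X (vb_base F) (base_class \<Gamma> \<circ> fst)"
    unfolding base_F top_of_set_Times_UNIV[symmetric]
    by (rule continuous_map_compose[OF continuous_map_fst continuous_map_quotient_topology])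
  then have "continuous_map ?X (vb_base F) (vb_proj F \<circ> (\<lambda>(x, v). flat x v))"
    by (rule continuous_map_eq) (auto simp: proj_flat)
  then show "continuous_map (vb_total F) (vb_base F) (vb_proj F)"
    using continuous_compose_quotient_map_eq[OF quotient_map_quotient_topology] total_F by metis
next
  fix b assume "b \<in> topspace (vb_base F)"
  then obtain x where "x \<in> hyperbolic_space" "b = base_class \<Gamma> x"
    using topspace_base_F by blast
  then show "complex_vector_space_on (vb_fibre F b) (vb_plus F) (vb_scale F)"
    by (simp add: fibre_F complex_vector_space_on_range plus_flat scale_flat)
qed (rule flat_local_trivialization)

end


section \<open>The spinor bundle\<close>

context hyperbolic_spin_manifold
begin

lemma spin_n_iff: "s \<in> spin_n \<longleftrightarrow> s \<in> spin_plus \<and> Ad s (e_last :: 'i minkowski) = e_last"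
  by (simp add: spin_n_eq_stabilizer[OF dimension])

lemma spin_n_in_spin_plus: "s \<in> spin_n \<Longrightarrow> s \<in> (spin_plus :: (real, 'i) clifford set)"
  by (simp add: spin_n_iff)

lemma spin_n_mult: "s \<in> spin_n \<Longrightarrow> t \<in> spin_n \<Longrightarrow> s \<star> t \<in> (spin_n :: (real, 'i) clifford set)"
  by (simp add: spin_n_iff spin_plus_mult Ad_mult spin_plus_units)

lemma spin_n_inv:
  assumes "s \<in> spin_n"
  shows "cl_inv s \<in> (spin_n :: (real, 'i) clifford set)"
proof -
  have s: "s \<in> spin_plus" "cl_inv s \<in> spin_plus"
    using assms spin_n_iff spin_plus_inv by auto
  have "Ad (cl_inv s \<star> s) e_last = Ad (cl_inv s) e_last"
    using assms s by (simp add: Ad_mult spin_plus_units spin_n_iff)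
  then show ?thesis
    using s cl_units_inverse(2)[OF spin_plus_units[OF s(1)]] by (simp add: spin_n_iff)
qed

lemma spin_n_one: "cl_one \<in> (spin_n :: (real, 'i) clifford set)"
  by (simp add: spin_n_iff spin_plus_one)

lemma spin_n_mult_image:
  assumes "s \<in> spin_n"
  shows "(\<star>) s ` spin_n = (spin_n :: (real, 'i) clifford set)"
proof (intro equalityI subsetI)
  fix t :: "(real, 'i) clifford" assume "t \<in> spin_n"
  then show "t \<in> (\<star>) s ` spin_n"
    using assms spin_n_mult spin_n_inv cl_units_inverse(1)[OF spin_plus_units[OF spin_n_in_spin_plus]]
    by (intro image_eqI[of _ _ "cl_inv s \<star> t"]) (auto simp flip: cl_mult_assoc)
qed (use assms spin_n_mult in auto)

lemma spin_coset_eq: "spin_coset \<Gamma>h g = (\<lambda>\<gamma>. \<gamma> \<star> g) ` \<Gamma>h"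
  by (auto simp: spin_coset_def r_coset_def)

lemma spin_coset_right: "spin_coset \<Gamma>h g #>\<^bsub>spin_plus_group\<^esub> s = spin_coset \<Gamma>h (g \<star> s)"
  by (auto simp: spin_coset_eq r_coset_def cl_mult_assoc)

lemma spin_coset_eq_iff: "spin_coset \<Gamma>h g = spin_coset \<Gamma>h g' \<longleftrightarrow> (\<exists>\<gamma>\<in>\<Gamma>h. g' = \<gamma> \<star> g)"
proof
  assume "spin_coset \<Gamma>h g = spin_coset \<Gamma>h g'"
  moreover have "g' \<in> spin_coset \<Gamma>h g'"
    unfolding spin_coset_eq using \<Gamma>h_one by (intro image_eqI[of _ _ cl_one]) auto
  ultimately show "\<exists>\<gamma>\<in>\<Gamma>h. g' = \<gamma> \<star> g"
    by (auto simp: spin_coset_eq)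
next
  assume "\<exists>\<gamma>\<in>\<Gamma>h. g' = \<gamma> \<star> g"
  then obtain \<gamma> where \<gamma>: "\<gamma> \<in> \<Gamma>h" "g' = \<gamma> \<star> g"
    by blast
  have "spin_coset \<Gamma>h g' = (\<lambda>\<delta>. \<delta> \<star> g) ` (\<lambda>\<delta>. \<delta> \<star> \<gamma>) ` \<Gamma>h"
    by (simp add: spin_coset_eq image_image \<gamma>(2) cl_mult_assoc)
  then show "spin_coset \<Gamma>h g = spin_coset \<Gamma>h g'"
    unfolding \<Gamma>h_mult_image[OF \<gamma>(1)] by (simp add: spin_coset_eq)
qed

lemma spinor_class_eq:
  "spinor g v = (\<lambda>s. (spin_coset \<Gamma>h (g \<star> s), \<Delta> (cl_inv s) *v v)) ` spin_n"
  unfolding spinor_class_def spinor_orbit_def spinor_act_def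
  by (intro image_cong) (simp_all add: spin_coset_right Delta_n_eq spin_n_inv)

text \<open>The two successive quotients amount to one relation, generated by
  \<open>\<Gamma>h\<close> from the left and Spin(n) from the right; only the latter changes the
  spinor.\<close>

lemma spinor_class_eq_iff:
  "spinor g v = spinor g' v' \<longleftrightarrow>
    (\<exists>\<gamma>\<in>\<Gamma>h. \<exists>s\<in>spin_n. g' = \<gamma> \<star> (g \<star> s) \<and> v' = \<Delta> (cl_inv s) *v v)"
proof
  assume "spinor g v = spinor g' v'"
  moreover have "(spin_coset \<Gamma>h g', v') \<in> spinor g' v'"
    unfolding spinor_class_eq using spin_n_one by (intro image_eqI[of _ _ cl_one]) (auto simp: Delta_one)
  ultimately obtain s where s: "s \<in> spin_n" "spin_coset \<Gamma>h g' = spin_coset \<Gamma>h (g \<star> s)" "v' = \<Delta> (cl_inv s) *v v"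
    unfolding spinor_class_eq by blast
  then show "\<exists>\<gamma>\<in>\<Gamma>h. \<exists>s\<in>spin_n. g' = \<gamma> \<star> (g \<star> s) \<and> v' = \<Delta> (cl_inv s) *v v"
    using spin_coset_eq_iff[of "g \<star> s" g'] by auto
next
  assume "\<exists>\<gamma>\<in>\<Gamma>h. \<exists>s\<in>spin_n. g' = \<gamma> \<star> (g \<star> s) \<and> v' = \<Delta> (cl_inv s) *v v"
  then obtain \<gamma> s where s: "\<gamma> \<in> \<Gamma>h" "s \<in> spin_n" "g' = \<gamma> \<star> (g \<star> s)" "v' = \<Delta> (cl_inv s) *v v"
    by blast
  have coset: "spin_coset \<Gamma>h (g' \<star> t) = spin_coset \<Gamma>h (g \<star> (s \<star> t))" for t
    using s(1) spin_coset_eq_iff[of "g \<star> (s \<star> t)" "g' \<star> t"] by (auto simp: s(3) cl_mult_assoc)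
  have inv: "cl_inv (s \<star> t) = cl_inv t \<star> cl_inv s" if "t \<in> spin_n" for t
    using s(2) that by (intro cl_inv_mult cl_units_Units spin_plus_units spin_n_in_spin_plus)
  have "spinor g' v' = (\<lambda>s. (spin_coset \<Gamma>h (g \<star> s), \<Delta> (cl_inv s) *v v)) ` (\<star>) s ` spin_n"
    unfolding spinor_class_eq image_image
    by (intro image_cong) (simp_all add: coset inv s(4) Delta_mult matrix_vector_mul_assoc)
  then show "spinor g v = spinor g' v'"
    unfolding spin_n_mult_image[OF s(2)] spinor_class_eq by simp
qed

text \<open>The classes agree because \<open>Spin(n)\<close> is the whole stabilizer of \<open>e_last\<close>: if \<open>\<gamma>\<close> relates
  the images, then \<open>(\<gamma> g)\<^sup>-\<^sup>1 g'\<close> fixes \<open>e_last\<close>.\<close>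

lemma spinor_flat_eq_iff:
  assumes g: "g \<in> spin_plus" and g': "g' \<in> spin_plus"
  shows "spinor g v = spinor g' v' \<longleftrightarrow>
    flat (Ad g e_last) (\<Delta> g *v v) = flat (Ad g' e_last) (\<Delta> g' *v v')"
proof
  assume "spinor g v = spinor g' v'"
  then obtain \<gamma> s where s: "\<gamma> \<in> \<Gamma>h" "s \<in> spin_n" "g' = \<gamma> \<star> (g \<star> s)" "v' = \<Delta> (cl_inv s) *v v"
    unfolding spinor_class_eq_iff by blast
  then have "Ad g' e_last = Ad \<gamma> (Ad g e_last)"
    using g spin_n_iff \<Gamma>h_units by (simp add: Ad_mult spin_plus_units cl_units_mult)
  moreover have "\<Delta> g' *v v' = \<Delta> \<gamma> *v (\<Delta> g *v v)"
    using s Delta_inv(2)[OF spin_n_in_spin_plus[OF s(2)], of v]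
    by (simp add: Delta_mult flip: matrix_vector_mul_assoc)
  ultimately show "flat (Ad g e_last) (\<Delta> g *v v) = flat (Ad g' e_last) (\<Delta> g' *v v')"
    unfolding flat_class_eq_iff using s(1) by blast
next
  assume "flat (Ad g e_last) (\<Delta> g *v v) = flat (Ad g' e_last) (\<Delta> g' *v v')"
  then obtain \<gamma> where \<gamma>: "\<gamma> \<in> \<Gamma>h" "Ad g' e_last = Ad \<gamma> (Ad g e_last)" "\<Delta> g' *v v' = \<Delta> \<gamma> *v (\<Delta> g *v v)"
    unfolding flat_class_eq_iff by blast
  define h where "h = \<gamma> \<star> g"
  have h: "h \<in> spin_plus"
    using \<gamma>(1) g by (simp add: h_def \<Gamma>h_spin_plus spin_plus_mult)
  define s where "s = cl_inv h \<star> g'"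
  have inv: "cl_inv s = cl_inv g' \<star> h"
  proof (rule cl_inv_eqI)
    show "s \<star> (cl_inv g' \<star> h) = cl_one" "cl_inv g' \<star> h \<star> s = cl_one"
      using cl_units_inverse[OF spin_plus_units[OF h]] cl_units_inverse[OF spin_plus_units[OF g']]
      unfolding s_def by (metis cl_mult_assoc cl_one_mult(2))+
  qed
  have Adh: "Ad g' e_last = Ad h e_last"
    using \<gamma> g by (simp add: h_def Ad_mult \<Gamma>h_units spin_plus_units)
  have "Ad s e_last = Ad (cl_inv h) (Ad h e_last)"
    using h g' by (simp add: s_def Ad_mult spin_plus_units spin_plus_inv Adh)
  also have "\<dots> = e_last"
    using h cl_units_inverse(2)[OF spin_plus_units[OF h]]
    by (simp add: spin_plus_units spin_plus_inv flip: Ad_mult)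
  finally have "s \<in> spin_n"
    using h g' by (simp add: spin_n_iff s_def spin_plus_mult spin_plus_inv)
  moreover have "g' = \<gamma> \<star> (g \<star> s)"
    using cl_units_inverse(1)[OF spin_plus_units[OF h]]
    by (metis cl_mult_assoc cl_one_mult(1) h_def s_def)
  moreover have "v' = \<Delta> (cl_inv s) *v v"
  proof -
    have "\<Delta> (cl_inv s) *v v = \<Delta> (cl_inv g') *v (\<Delta> \<gamma> *v (\<Delta> g *v v))"
      unfolding inv h_def by (simp add: Delta_mult flip: matrix_vector_mul_assoc)
    then show ?thesis
      by (simp add: \<gamma>(3)[symmetric] Delta_inv(1)[OF g'])
  qed
  ultimately show "spinor g v = spinor g' v'"
    unfolding spinor_class_eq_iff using \<gamma>(1) by blast
qed

lemma xi_spinor: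
  assumes "g \<in> spin_plus"
  shows "\<xi> (spinor g v) = flat (Ad g e_last) (\<Delta> g *v v)"
proof -
  have "descend (spin_plus \<times> UNIV) (\<lambda>(g, v). spinor g v) (\<lambda>(g, v). flat (Ad g e_last) (\<Delta> g *v v))
      ((\<lambda>(g, v). spinor g v) (g, v)) = (\<lambda>(g, v). flat (Ad g e_last) (\<Delta> g *v v)) (g, v)"
    by (rule descend_eq) (use assms spinor_flat_eq_iff in auto)
  then show ?thesis
    by (simp add: spinor_xi_def)
qed

lemma spinor_class_base:
  assumes "g \<in> spin_plus" "g' \<in> spin_plus" "spinor g v = spinor g' v'"
  shows "base_class \<Gamma> (Ad g e_last) = base_class \<Gamma> (Ad g' e_last)"
  by (rule flat_class_base) (rule iffD1[OF spinor_flat_eq_iff[OF assms(1,2)] assms(3)])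

lemma proj_spinor:
  assumes "g \<in> spin_plus"
  shows "vb_proj E (spinor g v) = base_class \<Gamma> (Ad g e_last)"
proof -
  have "descend (spin_plus \<times> UNIV) (\<lambda>(g, v). spinor g v) (\<lambda>(g, v). base_class \<Gamma> (Ad g e_last))
      ((\<lambda>(g, v). spinor g v) (g, v)) = (\<lambda>(g, v). base_class \<Gamma> (Ad g e_last)) (g, v)"
    by (rule descend_eq) (use assms in \<open>auto dest!: spinor_class_base[rotated 2]\<close>)
  then show ?thesis
    by (simp add: spinor_bundle_def)
qed

lemma Ad_e_last: "g \<in> spin_plus \<Longrightarrow> Ad g (e_last :: 'i minkowski) \<in> hyperbolic_space"
  using Ad_hyperbolic e_last_hyperbolic by blast

text \<open>Independence of representatives is inherited from the flat classes: equality of spinor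
  classes is equality of their images, and \<open>\<Delta> g\<close> is linear.\<close>

lemma plus_spinor:
  assumes g: "g \<in> spin_plus"
  shows "vb_plus E (spinor g v) (spinor g w) = spinor g (v + w)"
proof -
  have "class_plus spin_plus spinor (spinor g v) (spinor g w) = spinor g (v + w)"
  proof (rule class_plus_eq[OF g])
    fix g' v' w' assume "g' \<in> spin_plus" "spinor g v = spinor g' v'" "spinor g w = spinor g' w'"
    then show "spinor g (v + w) = spinor g' (v' + w')"
      using flat_plus_cong[OF Ad_e_last[OF g]] g
      by (simp add: spinor_flat_eq_iff matrix_vector_right_distrib)
  qed
  then show ?thesis
    by (simp add: spinor_bundle_def)
qed

lemma scale_spinor:
  assumes g: "g \<in> spin_plus"
  shows "vb_scale E c (spinor g v) = spinor g (c *s v)"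
proof -
  have "class_scale spin_plus spinor c (spinor g v) = spinor g (c *s v)"
  proof (rule class_scale_eq[OF g])
    fix g' v' assume g': "g' \<in> spin_plus" and eq: "spinor g v = spinor g' v'"
    have "flat (Ad g e_last) (c *s (\<Delta> g *v v)) = flat (Ad g' e_last) (c *s (\<Delta> g' *v v'))"
      by (rule flat_scale_cong) (rule iffD1[OF spinor_flat_eq_iff[OF g g'] eq])
    then show "spinor g (c *s v) = spinor g' (c *s v')"
      by (simp add: spinor_flat_eq_iff[OF g g'] vector_scalar_commute)
  qed
  then show ?thesis
    by (simp add: spinor_bundle_def)
qed

lemma base_E: "vb_base E = vb_base F"
  by (simp add: spinor_bundle_def flat_bundle_def)

text \<open>The total space is built in two stages, with the product by the spinor space in between.
  The coset map is open, so its product with the identity is still a quotient map and the stages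
  compose.\<close>

lemma quotient_map_spinor:
  "quotient_map (top_of_set (spin_plus \<times> UNIV)) (vb_total E) (\<lambda>(g, v). spinor g v)"
proof -
  let ?X = "top_of_set (spin_plus :: (real, 'i) clifford set)"
  let ?Y = "quotient_topology ?X (spin_coset \<Gamma>h)"
  have "open_map ?X ?Y (spin_coset \<Gamma>h)"
  proof (rule open_map_quotient_topology_orbits[where A = \<Gamma>h and act = "(\<star>)"])
    fix \<gamma> assume "\<gamma> \<in> \<Gamma>h"
    then show "continuous_map ?X ?X ((\<star>) \<gamma>)"
      using \<Gamma>h_spin_plus by (auto intro!: continuous_intros spin_plus_mult)
  qed (simp add: spin_coset_eq_iff)
  then have "open_map (prod_topology ?X euclidean) (prod_topology ?Y euclidean)
      (\<lambda>(g, v :: 'k cvec). (spin_coset \<Gamma>h g, v))"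
    by (rule open_map_prod_fst)
  moreover have "continuous_map (prod_topology ?X euclidean) (prod_topology ?Y euclidean)
      (\<lambda>(g, v :: 'k cvec). (spin_coset \<Gamma>h g, v))"
    by (rule continuous_map_prod_fst[OF continuous_map_quotient_topology])
  moreover have "(\<lambda>(g, v :: 'k cvec). (spin_coset \<Gamma>h g, v)) ` topspace (prod_topology ?X euclidean)
      = topspace (prod_topology ?Y euclidean)"
    by (auto simp: topspace_quotient_topology image_iff)
  ultimately have "quotient_map (prod_topology ?X euclidean) (prod_topology ?Y euclidean)
      (\<lambda>(g, v :: 'k cvec). (spin_coset \<Gamma>h g, v))"
    by (intro continuous_open_imp_quotient_map)
  from quotient_map_compose[OF this quotient_map_quotient_topology[of _ "spinor_orbit \<psi>"]]
  have "quotient_map (top_of_set (spin_plus \<times> UNIV)) (vb_total E)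
      (spinor_orbit \<psi> \<circ> (\<lambda>(g, v :: 'k cvec). (spin_coset \<Gamma>h g, v)))"
    by (simp only: top_of_set_Times_UNIV spinor_bundle_def vbundle.simps)
  then show ?thesis
    by (rule quotient_map_eq) (auto simp: spinor_class_def)
qed

text \<open>The boost gives a continuous right inverse of \<open>(g, v) \<mapsto> (Ad g e_last, g v)\<close>.\<close>

lemma quotient_map_spin_flat:
  "quotient_map (top_of_set (spin_plus \<times> UNIV)) (vb_total F)
    (\<lambda>(g, v). flat (Ad g e_last) (\<Delta> g *v v))"
proof -
  let ?X = "top_of_set ((spin_plus :: (real, 'i) clifford set) \<times> (UNIV :: 'k cvec set))"
  let ?Y = "top_of_set ((hyperbolic_space :: 'i minkowski set) \<times> (UNIV :: 'k cvec set))"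
  let ?f = "\<lambda>(g :: (real, 'i) clifford, v :: 'k cvec). (Ad g e_last, \<Delta> g *v v)"
  let ?s = "\<lambda>(x, v). (boost x, \<Delta> (cl_inv (boost x)) *v v)"
  have boost: "continuous_on (hyperbolic_space \<times> (UNIV :: 'k cvec set)) (\<lambda>p. boost (fst p))"
    by (rule continuous_on_compose2[OF continuous_on_boost]) (auto intro: continuous_on_fst)
  have "continuous_on (hyperbolic_space \<times> (UNIV :: 'k cvec set)) (\<lambda>p. cl_inv (boost (fst p)))"
    by (rule continuous_on_compose2[OF continuous_on_cl_inv boost])
      (auto simp: spin_plus_units boost_spin_plus)
  then have "continuous_map ?Y ?X ?s"
    using boost boost_spin_plus by (auto simp: case_prod_unfold intro!: continuous_intros)
  moreover have "continuous_map ?X ?Y ?f"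
    using Ad_e_last spin_plus_units by (auto simp: case_prod_unfold intro!: continuous_intros)
  moreover have "quotient_map ?Y ?Y (?f \<circ> ?s)"
  proof (rule quotient_map_eq)
    show "quotient_map ?Y ?Y id"
      using homeomorphic_map_id unfolding homeomorphic_map_def by blast
  next
    fix p assume "p \<in> topspace ?Y"
    then show "id p = (?f \<circ> ?s) p"
      by (auto simp: Ad_boost Delta_inv(2)[OF boost_spin_plus])
  qed
  ultimately have "quotient_map ?X ?Y ?f"
    by (rule quotient_map_from_composition)
  from quotient_map_compose[OF this quotient_map_quotient_topology[of _ "\<lambda>(x, v). flat x v"]]
  have "quotient_map ?X (vb_total F) ((\<lambda>(x, v). flat x v) \<circ> ?f)"
    by (simp only: total_F)
  then show ?thesis
    by (rule quotient_map_eq) auto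
qed

lemma homeomorphic_map_xi: "homeomorphic_map (vb_total E) (vb_total F) \<xi>"
proof (rule homeomorphic_map_quotient_maps[OF quotient_map_spinor quotient_map_spin_flat])
  fix p q :: "(real, 'i) clifford \<times> 'k cvec"
  assume "p \<in> topspace (top_of_set (spin_plus \<times> UNIV))" "q \<in> topspace (top_of_set (spin_plus \<times> UNIV))"
    and "(case p of (g, v) \<Rightarrow> flat (Ad g e_last) (\<Delta> g *v v)) = (case q of (g, v) \<Rightarrow> flat (Ad g e_last) (\<Delta> g *v v))"
  then show "(case p of (g, v) \<Rightarrow> spinor g v) = (case q of (g, v) \<Rightarrow> spinor g v)"
    by (cases p, cases q) (simp add: spinor_flat_eq_iff)
qed (auto simp: xi_spinor)

lemma topspace_total_E: "topspace (vb_total E) = {spinor g v | g v. g \<in> spin_plus}"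
  by (subst quotient_imp_surjective_map[OF quotient_map_spinor, symmetric]) auto

lemma fibre_E:
  assumes g: "g \<in> spin_plus"
  shows "vb_fibre E (base_class \<Gamma> (Ad g e_last)) = range (spinor g)"
proof (intro equalityI subsetI)
  fix u assume "u \<in> vb_fibre E (base_class \<Gamma> (Ad g e_last))"
  then obtain h v where u: "u = spinor h v" "h \<in> spin_plus"
    "base_class \<Gamma> (Ad h e_last) = base_class \<Gamma> (Ad g e_last)"
    by (auto simp: vb_fibre_def topspace_total_E proj_spinor)
  then obtain \<gamma> where \<gamma>: "\<gamma> \<in> \<Gamma>h" "Ad g e_last = Ad \<gamma> (Ad h e_last)"
    using base_class_eq_iff by blast
  \<comment> \<open>Chosen so that \<open>\<Delta> g\<close> maps it to
    \<open>\<Delta> \<gamma> *v (\<Delta> h *v v)\<close>, the spinor found over the point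
    \<open>Ad g e_last\<close>.\<close>
  let ?w = "\<Delta> (cl_inv g) *v (\<Delta> \<gamma> *v (\<Delta> h *v v))"
  have "flat (Ad h e_last) (\<Delta> h *v v) = flat (Ad g e_last) (\<Delta> g *v ?w)"
    unfolding flat_class_eq_iff using \<gamma> Delta_inv(2)[OF g] by auto
  then have "u = spinor g ?w"
    using u(1,2) g by (simp add: spinor_flat_eq_iff)
  then show "u \<in> range (spinor g)"
    by blast
qed (use g in \<open>auto simp: vb_fibre_def topspace_total_E proj_spinor\<close>)

lemma base_E_cases:
  assumes "b \<in> topspace (vb_base E)"
  obtains g where "g \<in> spin_plus" "b = base_class \<Gamma> (Ad g e_last)"
  using assms unfolding base_E topspace_base_F by (metis Ad_boost boost_spin_plus imageE)

lemma xi_plus: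
  assumes "b \<in> topspace (vb_base E)" "u \<in> vb_fibre E b" "w \<in> vb_fibre E b"
  shows "\<xi> (vb_plus E u w) = vb_plus F (\<xi> u) (\<xi> w)"
proof -
  obtain g where g: "g \<in> spin_plus" "b = base_class \<Gamma> (Ad g e_last)"
    using base_E_cases[OF assms(1)] .
  then obtain v v' where "u = spinor g v" "w = spinor g v'"
    using assms fibre_E by auto
  then show ?thesis
    using g(1) by (simp add: plus_spinor xi_spinor plus_flat Ad_e_last matrix_vector_right_distrib)
qed

lemma xi_scale:
  assumes "b \<in> topspace (vb_base E)" "u \<in> vb_fibre E b"
  shows "\<xi> (vb_scale E c u) = vb_scale F c (\<xi> u)"
proof -
  obtain g where g: "g \<in> spin_plus" "b = base_class \<Gamma> (Ad g e_last)"
    using base_E_cases[OF assms(1)] .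
  then obtain v where "u = spinor g v"
    using assms fibre_E by auto
  then show ?thesis
    using g(1) by (simp add: scale_spinor xi_spinor scale_flat Ad_e_last vector_scalar_commute)
qed

lemma proj_xi: "u \<in> topspace (vb_total E) \<Longrightarrow> vb_proj F (\<xi> u) = vb_proj E u"
  by (auto simp: topspace_total_E xi_spinor proj_flat proj_spinor Ad_e_last)

lemma complex_vector_bundle_spinor: "complex_vector_bundle TYPE('k) E"
proof (rule complex_vector_bundle_transport[OF complex_vector_bundle_flat base_E homeomorphic_map_xi])
  fix b assume "b \<in> topspace (vb_base E)"
  then obtain g where "g \<in> spin_plus" "b = base_class \<Gamma> (Ad g e_last)"
    using base_E_cases by blast
  then show "complex_vector_space_on (vb_fibre E b) (vb_plus E) (vb_scale E)"
    by (simp add: fibre_E complex_vector_space_on_range plus_spinor scale_spinor)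
qed (rule proj_xi xi_plus xi_scale; assumption)+

lemma xi_equivalence: "complex_vector_bundle_equivalence TYPE('k) E F \<xi>"
  unfolding complex_vector_bundle_equivalence_def
  using complex_vector_bundle_spinor complex_vector_bundle_flat base_E homeomorphic_map_xi
    proj_xi xi_plus xi_scale by (intro conjI ballI allI)

end

text \<open>The projections and \<open>\<xi>\<close> are introduced through definite descriptions on
  classes. The first three conjuncts certify that these descriptions have the intended values, so
  that the equivalence concerns the maps of the informal statement.\<close>

theorem theorem7p1:
  fixes m :: nat
    and \<Gamma> :: "('i::{finite,linorder} minkowski_mat) set"
    and \<Gamma>h :: "(real, 'i) clifford set"
    and \<psi> :: "(complex, 'i) clifford \<Rightarrow> complex ^ 'k::finite ^ 'k"
    and \<rho> :: "(complex, 'i) clifford \<Rightarrow> (complex, 'i) clifford"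
    and \<sigma> :: complex
  assumes "m > 0" and "CARD('i) = 2 * m + 1" and "CARD('k) = 2 ^ m"
    and "subgroup \<Gamma> SO_plus_group" and "discrete \<Gamma>"
    and "torsion_free (SO_plus_group\<lparr>carrier := \<Gamma>\<rparr>)"
    and "subgroup \<Gamma>h spin_plus_group"
    and "(\<lambda>g. matrix (Ad g)) \<in> iso (spin_plus_group\<lparr>carrier := \<Gamma>h\<rparr>) (SO_plus_group\<lparr>carrier := \<Gamma>\<rparr>)"
    and "clifford_matrix_iso \<psi>"
    and "\<sigma> = 1 \<or> \<sigma> = - 1" and "clifford_rho m \<sigma> \<rho>"
  shows "(\<forall>g\<in>spin_plus. \<forall>v.
           vb_proj (spinor_bundle \<Gamma> \<Gamma>h \<psi>) (spinor_class \<Gamma>h \<psi> g v) = base_class \<Gamma> (Ad g e_last)) \<and>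
         (\<forall>x\<in>hyperbolic_space. \<forall>v.
           vb_proj (flat_bundle \<Gamma> \<Gamma>h \<psi> \<rho>) (flat_class \<Gamma>h \<psi> \<rho> x v) = base_class \<Gamma> x) \<and>
         (\<forall>g\<in>spin_plus. \<forall>v.
           spinor_xi \<Gamma>h \<psi> \<rho> (spinor_class \<Gamma>h \<psi> g v)
             = flat_class \<Gamma>h \<psi> \<rho> (Ad g e_last) (Delta_n1 \<psi> \<rho> g *v v)) \<and>
         complex_vector_bundle_equivalence TYPE('k)
           (spinor_bundle \<Gamma> \<Gamma>h \<psi>) (flat_bundle \<Gamma> \<Gamma>h \<psi> \<rho>) (spinor_xi \<Gamma>h \<psi> \<rho>)"
proof -
  have "CARD('i) \<ge> 3"
    using assms(1,2) by simp
  then interpret hyperbolic_spin_manifold \<psi> \<rho> m \<sigma> \<Gamma> \<Gamma>h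
    by (intro hyperbolic_spin_manifold.intro hyperbolic_spin_manifold_axioms.intro
        spin_representation.intro assms)
  show ?thesis
    by (intro conjI ballI allI proj_spinor proj_flat xi_spinor xi_equivalence)
qed

end
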